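(* Let $m,n\ge1$ and $0\le r\le m$. There is a non-empty Zariski open set $\mathscr{A}\subset\mathbb{S}_m(\mathbb{C})^{n+1}$ such that for every $A\in\mathscr{A}\cap\mathbb{S}_m(\mathbb{Q})^{n+1}$ there is a non-empty Zariski open set $\mathscr{C}\subset\mathbb{C}^n$ such that for every $c\in\mathscr{C}\cap\mathbb{Q}^n$, the output of the algorithm SolveSDP on input $(A,c,r)$ is a rational parametrization of a finite set containing all minimizers of the problem \[\inf_{x\in\mathbb{R}^n} c^Tx\quad\text{s.t.}\quad A(x)\succeq0,\ \operatorname{rank}A(x)\le r.\]
   Context: $\mathbb{S}_m(K)$: symmetric $m\times m$ matrices over $K$; $A(x)=A_0+x_1A_1+\cdots+x_nA_n$. A rational parametrization of a finite set $S\subset\mathbb{C}^n$ is a vector $(q,q_0,q_1,\dots,q_n)$ of polynomials in $\mathbb{Q}[t]$ with $q,q_0$ coprime such that $S=\{(q_1(t)/q_0(t),\dots,q_n(t)/q_0(t)) : q(t)=0\}$. For $0\le p\le m$ let $y=(y_{i,j})_{1\le i\le m,1\le j\le m-p}$ be variables, $Y(y)$ the $m\times(m-p)$ matrix with entries $y_{i,j}$, and for $\iota\subset\{1,\dots,m\}$ with $\#\iota=m-p$ let $Y_\iota$ be its submatrix with rows in $\iota$; let $f\subset\mathbb{Q}[x,y]$ consist of the entries of $A(x)Y(y)$ and of $Y_\iota-\mathrm{Id}_{m-p}$, and $\mathcal{V}_{p,\iota}\subset\mathbb{C}^{n+m(m-p)}$ its zero set. With $L_c(x,y)=c^Tx$,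 the Lagrange system $\mathrm{Lag}(\iota)\subset\mathbb{Q}[x,y,z]$ is $f=0$ together with the entries of $(z_1,\dots,z_{(2m-p)(m-p)},1)\begin{bmatrix}\mathrm{Jac}\,f\\\mathrm{Jac}\,L_c\end{bmatrix}$ (Jacobians with respect to $(x,y)$). Algorithm SolveSDP on input $(A,c,r)$: start with an empty parametrization $Q$. For $p=0,\dots,r$: if for some $\iota$ with $\#\iota=m-p$ the set $\mathcal{V}_{p,\iota}$ is not smooth and equidimensional, return an error; otherwise, for each of the $\binom{m}{p}$ subsets $\iota\subset\{1,\dots,m\}$ with $\#\iota=m-p$, compute the elimination ideal $I_\iota=\langle\mathrm{Lag}(\iota)\rangle\cap\mathbb{Q}[x]$, compute a rational parametrization $Q_\iota$ of its zero set (returning an error if $I_\iota$ is not zero-dimensional), and replace $Q$ by a rational parametrization of the union of the finite sets encoded by $Q$ and $Q_\iota$. Finally return $Q$. *)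

theory Defs
  imports "HOL-Analysis.Analysis" "Jordan_Normal_Form.DL_Rank"
begin

inductive polyfun :: "complex set \<Rightarrow> 'v set \<Rightarrow> (('v \<Rightarrow> complex) \<Rightarrow> complex) \<Rightarrow> bool"
  for K :: "complex set" and Vs :: "'v set" where
  pf_const: "a \<in> K \<Longrightarrow> polyfun K Vs (\<lambda>w. a)"
| pf_var: "v \<in> Vs \<Longrightarrow> polyfun K Vs (\<lambda>w. w v)"
| pf_add: "polyfun K Vs f \<Longrightarrow> polyfun K Vs g \<Longrightarrow> polyfun K Vs (\<lambda>w. f w + g w)"
| pf_mult: "polyfun K Vs f \<Longrightarrow> polyfun K Vs g \<Longrightarrow> polyfun K Vs (\<lambda>w. f w * g w)"

definition aff :: "'v set \<Rightarrow> ('v \<Rightarrow> complex) set" where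
  "aff Vs = {w. \<forall>v. v \<notin> Vs \<longrightarrow> w v = 0}"

definition zariski_open_in :: "'v set \<Rightarrow> ('v \<Rightarrow> complex) set \<Rightarrow> ('v \<Rightarrow> complex) set \<Rightarrow> bool" where
  "zariski_open_in Vs X U \<longleftrightarrow>
     (\<exists>F. (\<forall>f\<in>F. polyfun UNIV Vs f) \<and> U = {w \<in> X. \<exists>f\<in>F. f w \<noteq> 0})"

definition cvecs :: "nat \<Rightarrow> (nat \<Rightarrow> complex) set" where
  "cvecs n = aff {..<n}"

text \<open>\<open>\<bbbS>_m(\<complex>)^{n+1}\<close>: tuples \<open>(A_0,\<dots>,A_n)\<close>, \<open>A k i j\<close> = entry \<open>(i,j)\<close> of \<open>A_k\<close>,
  encoded as points with coordinates \<open>(k,i,j)\<close>.\<close>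
definition sym_vars :: "nat \<Rightarrow> nat \<Rightarrow> (nat \<times> nat \<times> nat) set" where
  "sym_vars m n = {(k,i,j). k \<le> n \<and> i < m \<and> j < m}"

definition sym_space :: "nat \<Rightarrow> nat \<Rightarrow> (nat \<times> nat \<times> nat \<Rightarrow> complex) set" where
  "sym_space m n = {A \<in> aff (sym_vars m n). \<forall>k i j. A (k,i,j) = A (k,j,i)}"

type_synonym ratparam = "rat poly \<times> rat poly \<times> rat poly list"

definition cpoly :: "rat poly \<Rightarrow> complex \<Rightarrow> complex" where
  "cpoly q t = poly (map_poly of_rat q) t"

definition is_rat_param :: "nat \<Rightarrow> ratparam \<Rightarrow> (nat \<Rightarrow> complex) set \<Rightarrow> bool" where
  "is_rat_param n Q S \<longleftrightarrow> (case Q of (q, q0, qs) \<Rightarrow>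
     length qs = n \<and> coprime q q0 \<and>
     S = {(\<lambda>i. if i < n then cpoly (qs ! i) t / cpoly q0 t else 0) | t. cpoly q t = 0})"

datatype eqn = EqAY nat nat | EqId nat nat
datatype var = X nat | Y nat nat | Z eqn

text \<open>The affine matrix \<open>A(x) = A_0 + x_1 A_1 + \<dots> + x_n A_n\<close> at the \<open>x\<close>-part of a point \<open>w\<close>
  (\<open>x_{l+1}\<close> is the coordinate \<open>X l\<close>).\<close>
definition Amat :: "nat \<Rightarrow> (nat \<times> nat \<times> nat \<Rightarrow> complex) \<Rightarrow> (var \<Rightarrow> complex) \<Rightarrow> nat \<Rightarrow> nat \<Rightarrow> complex" where
  "Amat n A w i j = A (0,i,j) + (\<Sum>l<n. w (X l) * A (Suc l,i,j))"

definition idx :: "nat set \<Rightarrow> nat \<Rightarrow> nat" where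
  "idx \<iota> a = sorted_list_of_set \<iota> ! a"

text \<open>The polynomials \<open>f\<close>: entries of \<open>A(x)Y(y)\<close> and of \<open>Y_\<iota> - Id_{m-p}\<close>.\<close>
definition feqs :: "nat \<Rightarrow> nat \<Rightarrow> nat \<Rightarrow> eqn set" where
  "feqs m n p = {EqAY i j | i j. i < m \<and> j < m - p} \<union> {EqId a j | a j. a < m - p \<and> j < m - p}"

fun feq :: "nat \<Rightarrow> nat \<Rightarrow> (nat \<times> nat \<times> nat \<Rightarrow> complex) \<Rightarrow> nat set \<Rightarrow> eqn \<Rightarrow> (var \<Rightarrow> complex) \<Rightarrow> complex" where
  "feq m n A \<iota> (EqAY i j) w = (\<Sum>k<m. Amat n A w i k * w (Y k j))"
| "feq m n A \<iota> (EqId a j) w = w (Y (idx \<iota> a) j) - (if a = j then 1 else 0)"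

definition xy_vars :: "nat \<Rightarrow> nat \<Rightarrow> nat \<Rightarrow> var set" where
  "xy_vars m n p = {X l | l. l < n} \<union> {Y i j | i j. i < m \<and> j < m - p}"

definition lag_vars :: "nat \<Rightarrow> nat \<Rightarrow> nat \<Rightarrow> var set" where
  "lag_vars m n p = xy_vars m n p \<union> Z ` feqs m n p"

definition Vset :: "nat \<Rightarrow> nat \<Rightarrow> (nat \<times> nat \<times> nat \<Rightarrow> complex) \<Rightarrow> nat \<Rightarrow> nat set \<Rightarrow> (var \<Rightarrow> complex) set" where
  "Vset m n A p \<iota> = {w \<in> aff (xy_vars m n p). \<forall>e\<in>feqs m n p. feq m n A \<iota> e w = 0}"

definition pdiff :: "(('v \<Rightarrow> complex) \<Rightarrow> complex) \<Rightarrow> 'v \<Rightarrow> ('v \<Rightarrow> complex) \<Rightarrow> complex" where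
  "pdiff f v w = deriv (\<lambda>t. f (w(v := t))) (w v)"

definition Lc :: "nat \<Rightarrow> (nat \<Rightarrow> complex) \<Rightarrow> (var \<Rightarrow> complex) \<Rightarrow> complex" where
  "Lc n c w = (\<Sum>l<n. c l * w (X l))"

text \<open>The Lagrange system \<open>Lag(\<iota>)\<close>: \<open>f = 0\<close> and the entries of
  \<open>(z,1) [Jac f; Jac L_c]\<close> (Jacobians w.r.t. \<open>(x,y)\<close>).\<close>
definition Lag :: "nat \<Rightarrow> nat \<Rightarrow> (nat \<times> nat \<times> nat \<Rightarrow> complex) \<Rightarrow> (nat \<Rightarrow> complex) \<Rightarrow> nat \<Rightarrow> nat set
    \<Rightarrow> ((var \<Rightarrow> complex) \<Rightarrow> complex) set" where
  "Lag m n A c p \<iota> =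
     (\<lambda>e. feq m n A \<iota> e) ` feqs m n p \<union>
     (\<lambda>v. \<lambda>w. (\<Sum>e\<in>feqs m n p. w (Z e) * pdiff (feq m n A \<iota> e) v w) + pdiff (Lc n c) v w)
        ` xy_vars m n p"

definition ideal_gen :: "'v set \<Rightarrow> (('v \<Rightarrow> complex) \<Rightarrow> complex) set \<Rightarrow> (('v \<Rightarrow> complex) \<Rightarrow> complex) set" where
  "ideal_gen Vs G = {g. \<exists>h. (\<forall>q\<in>G. polyfun \<rat> Vs (h q)) \<and> (\<forall>w. g w = (\<Sum>q\<in>G. h q w * q w))}"

definition elim_ideal :: "nat \<Rightarrow> nat \<Rightarrow> (nat \<times> nat \<times> nat \<Rightarrow> complex) \<Rightarrow> (nat \<Rightarrow> complex) \<Rightarrow> nat \<Rightarrow> nat set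
    \<Rightarrow> ((var \<Rightarrow> complex) \<Rightarrow> complex) set" where
  "elim_ideal m n A c p \<iota> =
     {g \<in> ideal_gen (lag_vars m n p) (Lag m n A c p \<iota>). polyfun \<rat> {X l | l. l < n} g}"

definition embX :: "(nat \<Rightarrow> complex) \<Rightarrow> var \<Rightarrow> complex" where
  "embX x v = (case v of X l \<Rightarrow> x l | _ \<Rightarrow> 0)"

definition elim_zeros :: "nat \<Rightarrow> nat \<Rightarrow> (nat \<times> nat \<times> nat \<Rightarrow> complex) \<Rightarrow> (nat \<Rightarrow> complex) \<Rightarrow> nat \<Rightarrow> nat set
    \<Rightarrow> (nat \<Rightarrow> complex) set" where
  "elim_zeros m n A c p \<iota> = {x \<in> cvecs n. \<forall>g\<in>elim_ideal m n A c p \<iota>. g (embX x) = 0}"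

text \<open>An algebraic set \<open>V \<subseteq> aff Vs\<close> (\<open>Vs\<close> finite) is smooth and equidimensional iff there is a
  codimension \<open>d\<close> such that near every point \<open>x \<in> V\<close> (Euclidean topology), \<open>V\<close> is cut out by
  \<open>d\<close> polynomials vanishing on \<open>V\<close> with linearly independent gradients at \<open>x\<close>
  (i.e. \<open>V\<close> is a complex submanifold of pure codimension \<open>d\<close>).\<close>
definition smooth_equidim :: "'v set \<Rightarrow> ('v \<Rightarrow> complex) set \<Rightarrow> bool" where
  "smooth_equidim Vs V \<longleftrightarrow> (\<exists>d::nat. \<forall>x\<in>V. \<exists>\<epsilon>>0. \<exists>gs.
      length gs = d \<and>
      (\<forall>g\<in>set gs. polyfun UNIV Vs g \<and> (\<forall>y\<in>V. g y = 0)) \<and>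
      (\<forall>a::nat \<Rightarrow> complex. (\<forall>v\<in>Vs. (\<Sum>i<d. a i * pdiff (gs ! i) v x) = 0) \<longrightarrow> (\<forall>i<d. a i = 0)) \<and>
      (\<forall>y \<in> aff Vs. (\<forall>v\<in>Vs. cmod (y v - x v) < \<epsilon>) \<longrightarrow>
          (y \<in> V \<longleftrightarrow> (\<forall>g\<in>set gs. g y = 0))))"

definition index_sets :: "nat \<Rightarrow> nat \<Rightarrow> nat set set" where
  "index_sets m p = {\<iota>. \<iota> \<subseteq> {..<m} \<and> card \<iota> = m - p}"

text \<open>SolveSDP returns an error (\<open>None\<close>) iff at some stage \<open>p \<le> r\<close> some \<open>\<V>_{p,\<iota>}\<close> is not smooth
  equidimensional or some \<open>I_\<iota>\<close> is not zero-dimensional; otherwise it returns a rational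
  parametrization of the union of the zero sets of all \<open>I_\<iota>\<close>. Since the rational parametrization
  computed in each step is not unique, the set of all possible outputs is described.\<close>
definition SolveSDP :: "nat \<Rightarrow> nat \<Rightarrow> (nat \<times> nat \<times> nat \<Rightarrow> complex) \<Rightarrow> (nat \<Rightarrow> complex) \<Rightarrow> nat
    \<Rightarrow> ratparam option set" where
  "SolveSDP m n A c r =
    (if (\<exists>p\<le>r. \<exists>\<iota>\<in>index_sets m p.
           \<not> smooth_equidim (xy_vars m n p) (Vset m n A p \<iota>) \<or> infinite (elim_zeros m n A c p \<iota>))
     then {None}
     else Some ` {Q. is_rat_param n Q (\<Union>p\<in>{..r}. \<Union>\<iota>\<in>index_sets m p. elim_zeros m n A c p \<iota>)})"

definition Areal :: "nat \<Rightarrow> (nat \<times> nat \<times> nat \<Rightarrow> complex) \<Rightarrow> (nat \<Rightarrow> real) \<Rightarrow> nat \<Rightarrow> nat \<Rightarrow> real" where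
  "Areal n A x i j = Re (A (0,i,j)) + (\<Sum>l<n. x l * Re (A (Suc l,i,j)))"

definition psd :: "nat \<Rightarrow> (nat \<Rightarrow> nat \<Rightarrow> real) \<Rightarrow> bool" where
  "psd m M \<longleftrightarrow> (\<forall>v::nat \<Rightarrow> real. 0 \<le> (\<Sum>i<m. \<Sum>j<m. v i * M i j * v j))"

definition mat_rank :: "nat \<Rightarrow> (nat \<Rightarrow> nat \<Rightarrow> real) \<Rightarrow> nat" where
  "mat_rank m M = vec_space.rank m (Matrix.mat m m (\<lambda>(i,j). M i j))"

definition feasible :: "nat \<Rightarrow> nat \<Rightarrow> (nat \<times> nat \<times> nat \<Rightarrow> complex) \<Rightarrow> nat \<Rightarrow> (nat \<Rightarrow> real) \<Rightarrow> bool" where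
  "feasible m n A r x \<longleftrightarrow> (\<forall>i\<ge>n. x i = 0) \<and> psd m (Areal n A x) \<and> mat_rank m (Areal n A x) \<le> r"

definition minimizers :: "nat \<Rightarrow> nat \<Rightarrow> (nat \<times> nat \<times> nat \<Rightarrow> complex) \<Rightarrow> (nat \<Rightarrow> complex) \<Rightarrow> nat \<Rightarrow> (nat \<Rightarrow> real) set" where
  "minimizers m n A c r = {x. feasible m n A r x \<and>
     (\<forall>x'. feasible m n A r x' \<longrightarrow> (\<Sum>l<n. Re (c l) * x l) \<le> (\<Sum>l<n. Re (c l) * x' l))}"

end

theory Submission
  imports Defs "HOL-Computational_Algebra.Fundamental_Theorem_Algebra"
    "HOL-Computational_Algebra.Field_as_Ring"
begin

text \<open>
  A zero of the Lagrange system yields a symmetric matrix \<open>M\<close> with \<open>A(x) M = 0\<close> and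
  \<open>\<langle>A\<^sub>l, M\<rangle> = c\<^sub>l\<close> for all \<open>l\<close>; the gradients of a non-redundant subset of the equations defining
  \<open>\<V>\<^sub>p\<^sub>,\<^sub>\<iota>\<close> are independent unless some \<open>M \<noteq> 0\<close> satisfies these conditions with \<open>c = 0\<close>.
  The pairs \<open>(S, M)\<close> of symmetric matrices with \<open>S M = 0\<close> are covered by finitely many polynomial
  charts whose number of parameters is the dimension of the space of symmetric matrices. Hence the
  pencils admitting such an \<open>M \<noteq> 0\<close> with \<open>c = 0\<close>, and the triples \<open>(x\<^sub>l, c, A)\<close> coming from solutions,
  are images of affine spaces of dimension one less than that of the target, and \<open>D\<close> polynomials in
  fewer than \<open>D\<close> variables are algebraically dependent. So for generic \<open>A\<close> and \<open>c\<close> the sets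
  \<open>\<V>\<^sub>p\<^sub>,\<^sub>\<iota>\<close> are smooth and every coordinate \<open>x\<^sub>l\<close> takes finitely many values on the Lagrange system.
  By the Nullstellensatz the elimination ideals then have finitely many zeros, which are closed under
  conjugation over \<open>\<rat>\<close> and therefore parametrizable by primitive elements. A minimizer \<open>x\<close> with
  \<open>A(x)\<close> of rank \<open>p\<close> is a local minimizer of the objective on the real points of \<open>\<V>\<^sub>p\<^sub>,\<^sub>\<iota>\<close> for some \<open>\<iota>\<close>,
  so it satisfies the Lagrange system.
\<close>

subsection \<open>Polynomial functions\<close>

text \<open>Write N = m(m+1)/2. The single dimension of slack behind both genericity claims comes
  from an exact count. A pair (S, M) takes N parameters, x takes n, and \<open>A_1, ..., A_n\<close>
  take nN; \<open>A_0\<close> is then forced by S = A(x). That is (n+1)N + n in all. Asking for c =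
  0 removes n and scaling M one more, leaving (n+1)N - 1 against the (n+1)N coordinates of a pencil.
  Recording c and one coordinate of x gives (n+1)N + n + 1 target coordinates against (n+1)N + n
  parameters. Only a nonzero polynomial relation is drawn from this, so algebraic dependence stands
  in for dimension theory and Sard's theorem. Symmetry of A(x) makes the Lagrange equations
  redundant as soon as m - p >= 2. The multipliers z then fill fibres of positive dimension, so
  finiteness can hold only for x and is obtained one coordinate at a time; passing from z to the
  symmetric M forgets this ambiguity. A second obstacle is rationality: the elimination ideals have
  coefficients in Q, while the Nullstellensatz argument relies on C being uncountable.\<close>

lemma polyfun_mono:
  assumes "polyfun K Vs f" "K \<subseteq> K'" "Vs \<subseteq> Vs'"
  shows "polyfun K' Vs' f"
  using assms by (induction rule: polyfun.induct) (auto intro: polyfun.intros)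

lemma polyfun_cong_vars:
  assumes "polyfun K Vs f" "\<And>v. v \<in> Vs \<Longrightarrow> w v = w' v"
  shows "f w = f w'"
  using assms by (induction rule: polyfun.induct) auto

lemma polyfun_compose:
  assumes "polyfun K Is P" "\<And>i. i \<in> Is \<Longrightarrow> polyfun K Vs (g i)"
  shows "polyfun K Vs (\<lambda>w. P (\<lambda>i. g i w))"
  using assms by (induction rule: polyfun.induct) (auto intro: polyfun.intros)

lemma polyfun_sum:
  assumes "0 \<in> K" "\<And>i. i \<in> S \<Longrightarrow> polyfun K Vs (f i)"
  shows "polyfun K Vs (\<lambda>w. \<Sum>i\<in>S. f i w)"
proof (cases "finite S")
  case True
  then show ?thesis using assms(2)
    by (induction S) (auto intro: polyfun.intros assms(1))
qed (auto intro: polyfun.intros assms(1))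

lemma polyfun_prod:
  assumes "1 \<in> K" "\<And>i. i \<in> S \<Longrightarrow> polyfun K Vs (f i)"
  shows "polyfun K Vs (\<lambda>w. \<Prod>i\<in>S. f i w)"
proof (cases "finite S")
  case True
  then show ?thesis using assms(2)
    by (induction S) (auto intro: polyfun.intros assms(1))
qed (auto intro: polyfun.intros assms(1))

lemma polyfun_power:
  assumes "1 \<in> K" "polyfun K Vs f"
  shows "polyfun K Vs (\<lambda>w. f w ^ k)"
  by (induction k) (auto intro: polyfun.intros assms)

lemma polyfun_uminus:
  assumes "-1 \<in> K" "polyfun K Vs f"
  shows "polyfun K Vs (\<lambda>w. - f w)"
  using pf_mult[OF pf_const[OF assms(1)] assms(2)] by simp

lemma polyfun_diff:
  assumes "-1 \<in> K" "polyfun K Vs f" "polyfun K Vs g"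
  shows "polyfun K Vs (\<lambda>w. f w - g w)"
  using pf_add[OF assms(2) polyfun_uminus[OF assms(1,3)]] by simp

lemma polyfun_if:
  assumes "b \<Longrightarrow> polyfun K Vs f" "\<not> b \<Longrightarrow> polyfun K Vs g"
  shows "polyfun K Vs (\<lambda>w. if b then f w else g w)"
  using assms by (cases b) simp_all

lemmas polyfun_intros = polyfun.intros polyfun_sum polyfun_prod polyfun_power polyfun_uminus
  polyfun_diff polyfun_if

lemma polyfun_Rats_value:
  assumes "polyfun \<rat> Vs f" "\<And>v. v \<in> Vs \<Longrightarrow> w v \<in> \<rat>"
  shows "f w \<in> \<rat>"
  using assms by (induction rule: polyfun.induct) auto

text \<open>Restriction to a line reduces questions about nonzero polynomials in many variables to
  counting the roots of one univariate polynomial.\<close>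

lemma polyfun_line:
  assumes "polyfun K Vs f"
  shows "\<exists>p. \<forall>t. f (\<lambda>v. a v + t * b v) = poly p t"
  using assms
proof (induction rule: polyfun.induct)
  case (pf_const c)
  then show ?case by (intro exI[of _ "[:c:]"]) simp
next
  case (pf_var v)
  then show ?case by (intro exI[of _ "[:a v, b v:]"]) simp
next
  case (pf_add f g)
  then obtain p q where "\<forall>t. f (\<lambda>v. a v + t * b v) = poly p t" "\<forall>t. g (\<lambda>v. a v + t * b v) = poly q t"
    by auto
  then show ?case by (intro exI[of _ "p + q"]) simp
next
  case (pf_mult f g)
  then obtain p q where "\<forall>t. f (\<lambda>v. a v + t * b v) = poly p t" "\<forall>t. g (\<lambda>v. a v + t * b v) = poly q t"
    by auto
  then show ?case by (intro exI[of _ "p * q"]) simp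
qed

lemma polyfun_univariate:
  assumes "polyfun K Vs f"
  shows "\<exists>p. \<forall>t. f (w(v := t)) = poly p t"
proof -
  obtain p where p: "\<And>t. f (\<lambda>u. (w(v := 0)) u + t * (if u = v then 1 else 0)) = poly p t"
    using polyfun_line[OF assms, of "w(v := 0)" "\<lambda>u. if u = v then 1 else 0"] by blast
  have "(\<lambda>u. (w(v := 0)) u + t * (if u = v then 1 else 0)) = w(v := t)" for t
    by auto
  with p show ?thesis by metis
qed

text \<open>This is the irreducibility of affine space. On the line joining a point good for
  \<open>F\<close> to a point good for \<open>f\<close>, each member restricts to a nonzero
  univariate polynomial, and finitely many roots are avoided together.\<close>

lemma polyfun_common_nonzero:
  assumes "finite F" "\<And>f. f \<in> F \<Longrightarrow> polyfun K Vs f" "\<And>f. f \<in> F \<Longrightarrow> \<exists>w. f w \<noteq> 0"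
  shows "\<exists>w. \<forall>f\<in>F. f w \<noteq> 0"
  using assms
proof (induction F)
  case (insert f F)
  obtain w1 where w1: "\<forall>g\<in>F. g w1 \<noteq> 0" using insert.IH insert.prems by auto
  obtain w2 where w2: "f w2 \<noteq> 0" using insert.prems(2)[of f] by auto
  have "\<forall>g\<in>insert f F. \<exists>p. \<forall>t. g (\<lambda>v. w1 v + t * (w2 v - w1 v)) = poly p t"
    using polyfun_line[OF insert.prems(1), of _ w1 "\<lambda>v. w2 v - w1 v"] by blast
  then obtain p where p: "\<And>g t. g \<in> insert f F \<Longrightarrow> g (\<lambda>v. w1 v + t * (w2 v - w1 v)) = poly (p g) t"
    by metis
  have nz: "p g \<noteq> 0" if "g \<in> insert f F" for g
  proof (cases "g = f")
    case True
    then show ?thesis using p[of f 1] w2 by auto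
  next
    case False
    then show ?thesis using p[of g 0] w1 that by auto
  qed
  have "finite (\<Union>g\<in>insert f F. {t. poly (p g) t = 0})"
    using insert.hyps nz poly_roots_finite by blast
  then obtain t where "t \<notin> (\<Union>g\<in>insert f F. {t. poly (p g) t = 0})"
    using ex_new_if_finite infinite_UNIV_char_0 by blast
  then have "\<forall>g\<in>insert f F. g (\<lambda>v. w1 v + t * (w2 v - w1 v)) \<noteq> 0"
    using p by auto
  then show ?case by blast
qed auto

text \<open>The set \<open>U\<close> in the induction collects the coordinates already freed from
  being rational. Freeing one more uses that a univariate polynomial with all rationals as roots is
  zero.\<close>

lemma polyfun_zero_if_zero_on_Rats:
  fixes f :: "('v \<Rightarrow> complex) \<Rightarrow> complex"
  assumes "polyfun K Vs f" "finite Vs" and zero: "\<And>w. (\<forall>v\<in>Vs. w v \<in> \<rat>) \<Longrightarrow> f w = 0"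
  shows "f w = 0"
proof -
  have "\<forall>w. (\<forall>v\<in>Vs - U. w v \<in> \<rat>) \<longrightarrow> f w = 0" if "finite U" for U
    using that
  proof (induction U)
    case empty
    then show ?case using zero by auto
  next
    case (insert u U)
    show ?case
    proof (intro allI impI)
      fix w :: "'v \<Rightarrow> complex" assume w: "\<forall>v\<in>Vs - insert u U. w v \<in> \<rat>"
      obtain p where p: "\<And>t. f (w(u := t)) = poly p t"
        using polyfun_univariate[OF assms(1)] by blast
      have "poly p t = 0" if "t \<in> \<rat>" for t
      proof -
        have "\<forall>v\<in>Vs - U. (w(u := t)) v \<in> \<rat>" using w that by auto
        then show ?thesis using insert.IH p by metis
      qed
      then have "\<rat> \<subseteq> {t. poly p t = 0}" by auto
      moreover have "infinite (\<rat> :: complex set)"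
        using finite_subset[OF Nats_subset_Rats] infinite_UNIV_nat
        by (metis Nats_infinite)
      ultimately have "p = 0" using poly_roots_finite finite_subset by blast
      then have "f (w(u := w u)) = 0" using p[of "w u"] by simp
      then show "f w = 0" by simp
    qed
  qed
  from this[OF assms(2)] show ?thesis by auto
qed

subsection \<open>Linear combinations and algebraic dependence\<close>

text \<open>Gaussian elimination: a pivot \<open>i0\<close> with nonzero entry in equation
  \<open>j\<close> removes that equation and one unknown at the same time, so the excess of unknowns
  survives.\<close>

lemma underdetermined_system:
  fixes a :: "'i \<Rightarrow> 'j \<Rightarrow> 'a::field"
  assumes "finite Js" "finite Is" "card Js < card Is"
  shows "\<exists>x. (\<exists>i\<in>Is. x i \<noteq> 0) \<and> (\<forall>j\<in>Js. (\<Sum>i\<in>Is. x i * a i j) = 0)"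
  using assms
proof (induction Js arbitrary: Is a)
  case empty
  then obtain i where "i \<in> Is" by (metis card.empty card_gt_0_iff ex_in_conv)
  then show ?case by (intro exI[of _ "\<lambda>_. 1"]) auto
next
  case (insert j Js)
  show ?case
  proof (cases "\<forall>i\<in>Is. a i j = 0")
    case True
    obtain x where "\<exists>i\<in>Is. x i \<noteq> 0" "\<forall>j\<in>Js. (\<Sum>i\<in>Is. x i * a i j) = 0"
      using insert.IH[of Is a] insert.prems insert.hyps by auto
    then show ?thesis using True by (intro exI[of _ x]) auto
  next
    case False
    then obtain i0 where i0: "i0 \<in> Is" "a i0 j \<noteq> 0" by auto
    define a' where "a' i k = a i k - a i j / a i0 j * a i0 k" for i k
    obtain x where x: "\<exists>i\<in>Is - {i0}. x i \<noteq> 0" "\<forall>k\<in>Js. (\<Sum>i\<in>Is - {i0}. x i * a' i k) = 0"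
      using insert.IH[of "Is - {i0}" a'] insert.prems insert.hyps i0 by (auto simp: less_diff_conv)
    \<comment> \<open>The value at the pivot is dictated by equation \<open>j\<close>; with it the
      other equations turn into those for \<open>a'\<close>.\<close>
    define s where "s = - (\<Sum>i\<in>Is - {i0}. x i * a i j) / a i0 j"
    define y where "y = x(i0 := s)"
    have sum_y: "(\<Sum>i\<in>Is. y i * a i k) = s * a i0 k + (\<Sum>i\<in>Is - {i0}. x i * a i k)" for k
      using insert.prems i0 by (subst sum.remove[of _ i0]) (auto simp: y_def intro!: sum.cong)
    have "(\<Sum>i\<in>Is. y i * a i k) = (\<Sum>i\<in>Is - {i0}. x i * a' i k)" for k
    proof -
      have "(\<Sum>i\<in>Is - {i0}. x i * a' i k) =
          (\<Sum>i\<in>Is - {i0}. x i * a i k) - (\<Sum>i\<in>Is - {i0}. x i * a i j) / a i0 j * a i0 k"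
        by (simp add: a'_def algebra_simps sum_subtractf sum_distrib_left sum_divide_distrib)
      then show ?thesis by (simp add: sum_y s_def)
    qed
    moreover have "(\<Sum>i\<in>Is. y i * a i j) = 0" using sum_y[of j] i0 by (simp add: s_def)
    moreover have "\<exists>i\<in>Is. y i \<noteq> 0" using x(1) by (auto simp: y_def)
    ultimately show ?thesis using x(2) by (intro exI[of _ y]) auto
  qed
qed

definition lin_comb :: "('p \<Rightarrow> complex) set \<Rightarrow> ('p \<Rightarrow> complex) \<Rightarrow> bool" where
  "lin_comb B f \<longleftrightarrow> (\<exists>a. \<forall>w. f w = (\<Sum>b\<in>B. a b * b w))"

lemma lin_comb_mem: "finite B \<Longrightarrow> b \<in> B \<Longrightarrow> lin_comb B b"
  unfolding lin_comb_def
  by (rule exI[of _ "\<lambda>b'. if b' = b then 1 else 0"]) (simp add: sum.remove[of B b])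

lemma lin_comb_add:
  assumes "lin_comb B f" "lin_comb B g" shows "lin_comb B (\<lambda>w. f w + g w)"
proof -
  from assms obtain a a' where "\<forall>w. f w = (\<Sum>b\<in>B. a b * b w)" "\<forall>w. g w = (\<Sum>b\<in>B. a' b * b w)"
    unfolding lin_comb_def by blast
  then show ?thesis unfolding lin_comb_def
    by (intro exI[of _ "\<lambda>b. a b + a' b"]) (simp add: algebra_simps sum.distrib)
qed

lemma lin_comb_scale:
  assumes "lin_comb B f" shows "lin_comb B (\<lambda>w. c * f w)"
proof -
  from assms obtain a where "\<forall>w. f w = (\<Sum>b\<in>B. a b * b w)" unfolding lin_comb_def by blast
  then show ?thesis unfolding lin_comb_def
    by (intro exI[of _ "\<lambda>b. c * a b"]) (simp add: algebra_simps sum_distrib_left)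
qed

lemma lin_comb_zero: "lin_comb B (\<lambda>w. 0)"
  unfolding lin_comb_def by (rule exI[of _ "\<lambda>_. 0"]) simp

lemma lin_comb_sum:
  assumes "\<And>i. i \<in> S \<Longrightarrow> lin_comb B (f i)" shows "lin_comb B (\<lambda>w. \<Sum>i\<in>S. f i w)"
proof (cases "finite S")
  case True
  then show ?thesis using assms by (induction S) (auto intro: lin_comb_zero lin_comb_add)
qed (auto intro: lin_comb_zero)

lemma lin_comb_mult:
  assumes "lin_comb B f" "lin_comb C g" "\<And>b c. b \<in> B \<Longrightarrow> c \<in> C \<Longrightarrow> lin_comb D (\<lambda>w. b w * c w)"
  shows "lin_comb D (\<lambda>w. f w * g w)"
proof -
  from assms obtain a a' where "\<forall>w. f w = (\<Sum>b\<in>B. a b * b w)" "\<forall>w. g w = (\<Sum>b\<in>C. a' b * b w)"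
    unfolding lin_comb_def by blast
  then have "f w * g w = (\<Sum>b\<in>B. \<Sum>c\<in>C. (a b * b w) * (a' c * c w))" for w
    by (simp only: sum_product)
  then have eq: "f w * g w = (\<Sum>b\<in>B. \<Sum>c\<in>C. (a b * a' c) * (b w * c w))" for w
    by (simp only: mult_ac)
  show ?thesis unfolding eq by (intro lin_comb_sum lin_comb_scale assms(3))
qed

section \<open>Monomials with bounded exponents\<close>

definition powprod :: "'v set \<Rightarrow> ('v \<Rightarrow> nat) \<Rightarrow> ('v \<Rightarrow> complex) \<Rightarrow> complex" where
  "powprod Vs \<alpha> w = (\<Prod>v\<in>Vs. w v ^ \<alpha> v)"

text \<open>The bound is on each exponent, not on the total degree: bounds then add under products,
  and the number of monomials is at most a pure power of \<open>Suc d\<close>.\<close>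

definition powprods :: "'v set \<Rightarrow> nat \<Rightarrow> (('v \<Rightarrow> complex) \<Rightarrow> complex) set" where
  "powprods Vs d = powprod Vs ` (Vs \<rightarrow>\<^sub>E {..d})"

lemma powprod_restrict: "powprod Vs (restrict \<alpha> Vs) = powprod Vs \<alpha>"
  by (auto simp: powprod_def fun_eq_iff)

lemma powprod_in_powprods: "(\<And>v. v \<in> Vs \<Longrightarrow> \<alpha> v \<le> d) \<Longrightarrow> powprod Vs \<alpha> \<in> powprods Vs d"
  unfolding powprods_def by (rule image_eqI[of _ _ "restrict \<alpha> Vs"]) (auto simp: powprod_restrict)

lemma powprods_cases:
  assumes "b \<in> powprods Vs d" obtains \<alpha> where "b = powprod Vs \<alpha>" "\<And>v. v \<in> Vs \<Longrightarrow> \<alpha> v \<le> d"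
  using assms unfolding powprods_def by (auto simp: PiE_iff)

lemma finite_powprods: "finite Vs \<Longrightarrow> finite (powprods Vs d)"
  unfolding powprods_def by (simp add: finite_PiE)

lemma card_powprods: "finite Vs \<Longrightarrow> card (powprods Vs d) \<le> Suc d ^ card Vs"
  unfolding powprods_def by (rule order_trans[OF card_image_le]) (simp_all add: finite_PiE card_PiE)

lemma polyfun_powprod: "polyfun \<rat> Vs (powprod Vs \<alpha>)"
  unfolding powprod_def by (intro polyfun_intros) auto

lemma powprod_add: "powprod Vs \<alpha> w * powprod Vs \<beta> w = powprod Vs (\<lambda>v. \<alpha> v + \<beta> v) w"
  by (simp add: powprod_def power_add prod.distrib)

lemma lin_comb_powprods_mono:
  assumes "finite Vs" "d \<le> e" "lin_comb (powprods Vs d) f"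
  shows "lin_comb (powprods Vs e) f"
proof -
  from assms(3) obtain a where f: "f = (\<lambda>w. \<Sum>b\<in>powprods Vs d. a b * b w)"
    unfolding lin_comb_def by blast
  show ?thesis unfolding f
  proof (intro lin_comb_sum lin_comb_scale lin_comb_mem finite_powprods assms)
    fix b assume "b \<in> powprods Vs d"
    then show "b \<in> powprods Vs e"
      by (elim powprods_cases) (use assms(2) in \<open>auto intro!: powprod_in_powprods intro: order_trans\<close>)
  qed
qed

lemma lin_comb_powprods_mult:
  assumes "finite Vs" "lin_comb (powprods Vs d) f" "lin_comb (powprods Vs e) g"
  shows "lin_comb (powprods Vs (d + e)) (\<lambda>w. f w * g w)"
proof (rule lin_comb_mult[OF assms(2,3)])
  fix b c assume b: "b \<in> powprods Vs d" and c: "c \<in> powprods Vs e"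
  obtain \<alpha> where \<alpha>: "b = powprod Vs \<alpha>" "\<And>v. v \<in> Vs \<Longrightarrow> \<alpha> v \<le> d" using b by (rule powprods_cases) auto
  obtain \<beta> where \<beta>: "c = powprod Vs \<beta>" "\<And>v. v \<in> Vs \<Longrightarrow> \<beta> v \<le> e" using c by (rule powprods_cases) auto
  have "(\<lambda>w. b w * c w) = powprod Vs (\<lambda>v. \<alpha> v + \<beta> v)" by (auto simp: \<alpha> \<beta> powprod_add)
  moreover have "lin_comb (powprods Vs (d + e)) (powprod Vs (\<lambda>v. \<alpha> v + \<beta> v))"
    by (intro lin_comb_mem finite_powprods assms powprod_in_powprods) (use \<alpha> \<beta> in \<open>auto intro: add_mono\<close>)
  ultimately show "lin_comb (powprods Vs (d + e)) (\<lambda>w. b w * c w)" by simp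
qed

lemma lin_comb_powprods_const: "finite Vs \<Longrightarrow> lin_comb (powprods Vs d) (\<lambda>w. c)"
proof -
  assume fin: "finite Vs"
  have "powprod Vs (\<lambda>_. 0) \<in> powprods Vs d" by (rule powprod_in_powprods) auto
  from lin_comb_scale[OF lin_comb_mem[OF finite_powprods[OF fin] this], of c]
  show ?thesis by (simp add: powprod_def)
qed

lemma polyfun_lin_comb_powprods:
  assumes "polyfun K Vs f" "finite Vs"
  shows "\<exists>d. lin_comb (powprods Vs d) f"
  using assms
proof (induction rule: polyfun.induct)
  case (pf_const a)
  then show ?case using lin_comb_powprods_const by blast
next
  case (pf_var v)
  have "powprod Vs (\<lambda>u. if u = v then 1 else 0) \<in> powprods Vs 1" by (rule powprod_in_powprods) auto
  moreover have "powprod Vs (\<lambda>u. if u = v then 1 else 0) = (\<lambda>w. w v)"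
    using pf_var by (auto simp: powprod_def fun_eq_iff prod.remove[of _ v])
  ultimately show ?case using lin_comb_mem finite_powprods pf_var by metis
next
  case (pf_add f g)
  then obtain d e where "lin_comb (powprods Vs d) f" "lin_comb (powprods Vs e) g" by auto
  then have "lin_comb (powprods Vs (max d e)) f" "lin_comb (powprods Vs (max d e)) g"
    using lin_comb_powprods_mono pf_add.prems by (metis max.cobounded1 max.cobounded2)+
  then show ?case using lin_comb_add by blast
next
  case (pf_mult f g)
  then show ?case using lin_comb_powprods_mult by blast
qed

lemma lin_comb_powprods_power:
  assumes "finite Vs" "lin_comb (powprods Vs d) f"
  shows "lin_comb (powprods Vs (d * k)) (\<lambda>w. f w ^ k)"
proof (induction k)
  case 0
  then show ?case using lin_comb_powprods_const[OF assms(1)] by simp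
next
  case (Suc k)
  then show ?case using lin_comb_powprods_mult[OF assms(1,2) Suc] by simp
qed

lemma lin_comb_powprods_prod:
  assumes "finite Vs" "finite Is" "\<And>i. i \<in> Is \<Longrightarrow> lin_comb (powprods Vs d) (f i)"
  shows "lin_comb (powprods Vs (card Is * d)) (\<lambda>w. \<Prod>i\<in>Is. f i w)"
  using assms(2,3)
proof (induction Is)
  case empty
  then show ?case using lin_comb_powprods_const[OF assms(1)] by simp
next
  case (insert i Is)
  then show ?case using lin_comb_powprods_mult[OF assms(1), of d "f i" "card Is * d"] by simp
qed

text \<open>Collecting by powers of \<open>v\<close> gives, for fixed other coordinates, a
  univariate polynomial that vanishes everywhere. Its coefficients vanish, and they are again
  combinations of monomials in fewer variables.\<close>

lemma powprods_independent:
  fixes x :: "('v \<Rightarrow> nat) \<Rightarrow> complex"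
  assumes "finite Vs" "\<And>w. (\<Sum>\<alpha>\<in>Vs \<rightarrow>\<^sub>E {..<N}. x \<alpha> * powprod Vs \<alpha> w) = 0" "\<alpha> \<in> Vs \<rightarrow>\<^sub>E {..<N}"
  shows "x \<alpha> = 0"
  using assms
proof (induction Vs arbitrary: x \<alpha>)
  case empty
  then show ?case by (auto simp: powprod_def)
next
  case (insert v Vs)
  have split: "(\<Sum>\<alpha>\<in>insert v Vs \<rightarrow>\<^sub>E {..<N}. x \<alpha> * powprod (insert v Vs) \<alpha> w) =
      (\<Sum>k<N. (\<Sum>\<alpha>\<in>Vs \<rightarrow>\<^sub>E {..<N}. x (\<alpha>(v := k)) * powprod Vs \<alpha> w) * w v ^ k)" for w
  proof -
    have powprod_upd: "powprod (insert v Vs) (\<alpha>(v := k)) w = w v ^ k * powprod Vs \<alpha> w" for \<alpha> k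
    proof -
      have "(\<Prod>u\<in>Vs. w u ^ (\<alpha>(v := k)) u) = (\<Prod>u\<in>Vs. w u ^ \<alpha> u)"
        by (rule prod.cong) (use insert.hyps in auto)
      then show ?thesis using insert.hyps by (simp add: powprod_def)
    qed
    have "(\<Sum>\<alpha>\<in>insert v Vs \<rightarrow>\<^sub>E {..<N}. x \<alpha> * powprod (insert v Vs) \<alpha> w) =
        (\<Sum>(k, \<alpha>)\<in>{..<N} \<times> (Vs \<rightarrow>\<^sub>E {..<N}). x (\<alpha>(v := k)) * powprod (insert v Vs) (\<alpha>(v := k)) w)"
      unfolding PiE_insert_eq using insert.hyps
      by (subst sum.reindex) (auto intro!: inj_combinator sum.cong)
    also have "\<dots> = (\<Sum>k<N. \<Sum>\<alpha>\<in>Vs \<rightarrow>\<^sub>E {..<N}. x (\<alpha>(v := k)) * powprod (insert v Vs) (\<alpha>(v := k)) w)"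
      by (simp add: sum.cartesian_product)
    finally show ?thesis by (simp add: powprod_upd sum_distrib_left sum_distrib_right algebra_simps)
  qed
  have coef: "(\<Sum>\<alpha>\<in>Vs \<rightarrow>\<^sub>E {..<N}. x (\<alpha>(v := k)) * powprod Vs \<alpha> w) = 0" if "k < N" for k w
  proof -
    define c where "c k = (\<Sum>\<alpha>\<in>Vs \<rightarrow>\<^sub>E {..<N}. x (\<alpha>(v := k)) * powprod Vs \<alpha> w)" for k
    have powprod_eq: "powprod Vs \<alpha> (w(v := t)) = powprod Vs \<alpha> w" for \<alpha> t
      using insert.hyps by (auto simp: powprod_def intro!: prod.cong)
    have "(\<Sum>k<N. c k * t ^ k) = 0" for t
      using insert.prems(1)[of "w(v := t)"]
      by (simp add: split powprod_eq powprod_eq[unfolded fun_upd_def] c_def)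
    then have "poly (\<Sum>k<N. monom (c k) k) t = 0" for t
      by (simp add: poly_sum poly_monom)
    then have "(\<Sum>k<N. monom (c k) k) = 0" using poly_all_0_iff_0 by blast
    then have "coeff (\<Sum>k<N. monom (c k) k) k = 0" by simp
    then show ?thesis using that by (simp add: coeff_sum c_def)
  qed
  have "x ((restrict \<alpha> Vs)(v := \<alpha> v)) = 0"
    by (rule insert.IH[of "\<lambda>\<beta>. x (\<beta>(v := \<alpha> v))"]) (use coef insert.prems(2) in auto)
  moreover have "(restrict \<alpha> Vs)(v := \<alpha> v) = \<alpha>"
    using insert.prems(2) by (auto simp: fun_eq_iff PiE_iff extensional_def)
  ultimately show ?case by simp
qed

text \<open>Counting: the monomials of degree less than \<open>N\<close> in each of the \<open>k\<close> functions number
  \<open>N ^ k\<close>, but they live in a space whose dimension is \<open>O(N ^ (k - 1))\<close>.\<close>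
theorem algebraic_dependence:
  assumes "finite Is" "finite Vs" "card Vs < card Is" "\<And>i. i \<in> Is \<Longrightarrow> polyfun UNIV Vs (g i)"
  shows "\<exists>P. polyfun UNIV Is P \<and> (\<exists>u. P u \<noteq> 0) \<and> (\<forall>w. P (\<lambda>i. g i w) = 0)"
proof -
  define k where "k = card Is"
  obtain d where d: "\<And>i. i \<in> Is \<Longrightarrow> lin_comb (powprods Vs d) (g i)"
  proof -
    obtain e where e: "\<And>i. i \<in> Is \<Longrightarrow> lin_comb (powprods Vs (e i)) (g i)"
      using polyfun_lin_comb_powprods[OF assms(4,2)] by metis
    have "lin_comb (powprods Vs (Max (e ` Is))) (g i)" if "i \<in> Is" for i
      by (rule lin_comb_powprods_mono[OF assms(2) _ e[OF that]]) (use assms(1) that in auto)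
    then show ?thesis using that by blast
  qed
  \<comment> \<open>The span \<open>B\<close> has at most (N(kd+1))^card Vs generators. Any N
    exceeding (kd+1)^card Vs makes this smaller than N^(card Vs + 1), which is at most N^k.\<close>
  define N where "N = Suc ((k * d + 1) ^ card Vs)"
  define E where "E = Is \<rightarrow>\<^sub>E {..<N}"
  define B where "B = powprods Vs (k * (d * N))"
  have comb: "lin_comb B (\<lambda>w. \<Prod>i\<in>Is. g i w ^ \<alpha> i)" if "\<alpha> \<in> E" for \<alpha>
    unfolding B_def k_def
  proof (rule lin_comb_powprods_prod[OF assms(2,1)])
    fix i assume i: "i \<in> Is"
    have "d * \<alpha> i \<le> d * N" using that i by (auto simp: E_def PiE_iff intro!: mult_left_mono less_imp_le)
    then show "lin_comb (powprods Vs (d * N)) (\<lambda>w. g i w ^ \<alpha> i)"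
      using lin_comb_powprods_mono[OF assms(2) _ lin_comb_powprods_power[OF assms(2) d[OF i]]] by blast
  qed
  then obtain a where a: "\<And>\<alpha> w. \<alpha> \<in> E \<Longrightarrow> (\<Prod>i\<in>Is. g i w ^ \<alpha> i) = (\<Sum>b\<in>B. a \<alpha> b * b w)"
    unfolding lin_comb_def by metis
  have "card B \<le> Suc (k * (d * N)) ^ card Vs" unfolding B_def by (rule card_powprods[OF assms(2)])
  also have "\<dots> \<le> (N * (k * d + 1)) ^ card Vs"
    by (rule power_mono) (auto simp: N_def algebra_simps)
  also have "\<dots> = N ^ card Vs * (k * d + 1) ^ card Vs" by (rule power_mult_distrib)
  also have "\<dots> < N ^ card Vs * N" by (auto simp: N_def)
  also have "\<dots> = N ^ Suc (card Vs)" by simp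
  also have "\<dots> \<le> N ^ k" by (rule power_increasing) (use assms(3) in \<open>auto simp: k_def N_def\<close>)
  also have "\<dots> = card E" using assms(1) by (simp add: E_def card_PiE k_def)
  finally have "card B < card E" .
  then obtain x where x: "\<exists>\<alpha>\<in>E. x \<alpha> \<noteq> 0" "\<forall>b\<in>B. (\<Sum>\<alpha>\<in>E. x \<alpha> * a \<alpha> b) = 0"
    using underdetermined_system[of B E a] finite_powprods[OF assms(2)] assms(1)
    by (auto simp: B_def E_def finite_PiE)
  define P where "P u = (\<Sum>\<alpha>\<in>E. x \<alpha> * powprod Is \<alpha> u)" for u
  have "polyfun UNIV Is P" unfolding P_def
    by (intro polyfun_intros polyfun_mono[OF polyfun_powprod]) auto
  moreover have "\<exists>u. P u \<noteq> 0"
    using powprods_independent[OF assms(1), of x N] x(1) unfolding P_def E_def by blast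
  moreover have "P (\<lambda>i. g i w) = 0" for w
  proof -
    have "P (\<lambda>i. g i w) = (\<Sum>\<alpha>\<in>E. x \<alpha> * (\<Sum>b\<in>B. a \<alpha> b * b w))"
      unfolding P_def powprod_def by (intro sum.cong) (auto simp: a)
    also have "\<dots> = (\<Sum>b\<in>B. (\<Sum>\<alpha>\<in>E. x \<alpha> * a \<alpha> b) * b w)"
      by (simp add: sum_distrib_left sum_distrib_right mult.assoc) (rule sum.swap)
    finally show ?thesis using x(2) by simp
  qed
  ultimately show ?thesis by blast
qed

subsection \<open>Nullstellensatz and elimination\<close>

text \<open>Only closure properties are recorded. That the members are polynomials is asked for
  separately, as in \<open>weak_Nullstellensatz\<close>, which keeps
  \<open>poly_ideal_adjoin\<close> free of side conditions on \<open>f\<close>.\<close>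

definition poly_ideal :: "'v set \<Rightarrow> (('v \<Rightarrow> complex) \<Rightarrow> complex) set \<Rightarrow> bool" where
  "poly_ideal Vs I \<longleftrightarrow> (\<lambda>w. 0) \<in> I \<and> (\<forall>f\<in>I. \<forall>g\<in>I. (\<lambda>w. f w + g w) \<in> I) \<and>
     (\<forall>f\<in>I. \<forall>h. polyfun UNIV Vs h \<longrightarrow> (\<lambda>w. h w * f w) \<in> I)"

lemma poly_ideal_zero: "poly_ideal Vs I \<Longrightarrow> (\<lambda>w. 0) \<in> I"
  and poly_ideal_add: "poly_ideal Vs I \<Longrightarrow> f \<in> I \<Longrightarrow> g \<in> I \<Longrightarrow> (\<lambda>w. f w + g w) \<in> I"
  and poly_ideal_mult: "poly_ideal Vs I \<Longrightarrow> f \<in> I \<Longrightarrow> polyfun UNIV Vs h \<Longrightarrow> (\<lambda>w. h w * f w) \<in> I"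
  unfolding poly_ideal_def by blast+

lemma poly_ideal_sum:
  assumes "poly_ideal Vs I" "\<And>i. i \<in> S \<Longrightarrow> f i \<in> I"
  shows "(\<lambda>w. \<Sum>i\<in>S. f i w) \<in> I"
proof (cases "finite S")
  case True
  then show ?thesis using assms(2)
    by (induction S) (auto intro: poly_ideal_zero[OF assms(1)] poly_ideal_add[OF assms(1)])
qed (auto intro: poly_ideal_zero[OF assms(1)])

definition adjoin :: "'v set \<Rightarrow> (('v \<Rightarrow> complex) \<Rightarrow> complex) set \<Rightarrow> (('v \<Rightarrow> complex) \<Rightarrow> complex)
    \<Rightarrow> (('v \<Rightarrow> complex) \<Rightarrow> complex) set" where
  "adjoin Vs I f = {g. \<exists>k\<in>I. \<exists>h. polyfun UNIV Vs h \<and> (\<forall>w. g w = k w + h w * f w)}"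

lemma poly_ideal_adjoin:
  assumes "poly_ideal Vs I"
  shows "poly_ideal Vs (adjoin Vs I f)"
  unfolding poly_ideal_def
proof (intro conjI ballI allI impI)
  show "(\<lambda>w. 0) \<in> adjoin Vs I f"
    unfolding adjoin_def using poly_ideal_zero[OF assms]
    by (auto intro!: bexI[of _ "\<lambda>w. 0"] exI[of _ "\<lambda>w. 0"] polyfun.intros)
next
  fix g g' assume "g \<in> adjoin Vs I f" "g' \<in> adjoin Vs I f"
  then obtain k h k' h' where "k \<in> I" "polyfun UNIV Vs h" "\<forall>w. g w = k w + h w * f w"
      "k' \<in> I" "polyfun UNIV Vs h'" "\<forall>w. g' w = k' w + h' w * f w"
    unfolding adjoin_def by blast
  then show "(\<lambda>w. g w + g' w) \<in> adjoin Vs I f"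
    unfolding adjoin_def
    by (auto intro!: bexI[of _ "\<lambda>w. k w + k' w"] exI[of _ "\<lambda>w. h w + h' w"] polyfun.intros
        poly_ideal_add[OF assms] simp: algebra_simps)
next
  fix g p assume "g \<in> adjoin Vs I f" and p: "polyfun UNIV Vs p"
  then obtain k h where "k \<in> I" "polyfun UNIV Vs h" "\<forall>w. g w = k w + h w * f w"
    unfolding adjoin_def by blast
  then show "(\<lambda>w. p w * g w) \<in> adjoin Vs I f"
    unfolding adjoin_def using p
    by (auto intro!: bexI[of _ "\<lambda>w. p w * k w"] exI[of _ "\<lambda>w. p w * h w"] polyfun.intros
        poly_ideal_mult[OF assms] simp: algebra_simps)
qed

lemma adjoin_superset: "I \<subseteq> adjoin Vs I f"
  unfolding adjoin_def by (auto intro!: bexI exI[of _ "\<lambda>w. 0"] polyfun.intros)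

lemma adjoin_self: "poly_ideal Vs I \<Longrightarrow> f \<in> adjoin Vs I f"
  unfolding adjoin_def using poly_ideal_zero
  by (auto intro!: bexI[of _ "\<lambda>w. 0"] exI[of _ "\<lambda>w. 1"] polyfun.intros)

lemma polyfun_poly: "polyfun UNIV Vs f \<Longrightarrow> polyfun UNIV Vs (\<lambda>w. poly p (f w))"
  by (induction p) (auto intro!: polyfun.intros)

text \<open>The inverses of \<open>w v - a\<close> modulo \<open>I\<close>, for uncountably many \<open>a\<close>, lie in a vector space of
  countable dimension, so finitely many of them are linearly dependent.\<close>
lemma univariate_mem_ideal:
  assumes Vs: "finite Vs" "v \<in> Vs" and I: "poly_ideal Vs I" and "countable F"
    and inv: "\<And>a. a \<notin> F \<Longrightarrow> (\<lambda>w. 1) \<in> adjoin Vs I (\<lambda>w. w v - a)"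
  shows "\<exists>r. r \<noteq> 0 \<and> (\<lambda>w. poly r (w v)) \<in> I"
proof -
  have "\<forall>a. a \<notin> F \<longrightarrow> (\<exists>h k. k \<in> I \<and> polyfun UNIV Vs h \<and> (\<forall>w. 1 = k w + h w * (w v - a)))"
    using inv unfolding adjoin_def by blast
  then obtain h k where hk: "\<And>a. a \<notin> F \<Longrightarrow> k a \<in> I" "\<And>a. a \<notin> F \<Longrightarrow> polyfun UNIV Vs (h a)"
      "\<And>a w. a \<notin> F \<Longrightarrow> 1 = k a w + h a w * (w v - a)"
    by metis
  \<comment> \<open>\<open>T d\<close> groups the values \<open>a\<close> by the exponent bound of
    the inverse \<open>h a\<close>. Countably many groups and the countable \<open>F\<close> cover
    an uncountable set, so one group is infinite and has more members than its span has
    generators.\<close>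
  define T where "T d = {a. a \<notin> F \<and> lin_comb (powprods Vs d) (h a)}" for d
  have "UNIV = F \<union> (\<Union>d. T d)"
    using polyfun_lin_comb_powprods[OF hk(2) Vs(1)] unfolding T_def by blast
  then have unc: "uncountable (F \<union> (\<Union>d. T d))" using uncountable_UNIV_complex by simp
  have "\<exists>d. infinite (T d)"
  proof (rule ccontr)
    assume "\<nexists>d. infinite (T d)"
    then have "countable (\<Union>d. T d)" by (intro countable_UN countableI_type countable_finite) auto
    then show False using unc assms(4) by auto
  qed
  then obtain d where "infinite (T d)" ..
  then obtain S where S: "S \<subseteq> T d" "finite S" "card S = Suc (card (powprods Vs d))"
    using infinite_arbitrarily_large by blast
  have SF: "a \<notin> F" if "a \<in> S" for a using S(1) that unfolding T_def by blast
  have "\<forall>a\<in>S. \<exists>c. \<forall>w. h a w = (\<Sum>b\<in>powprods Vs d. c b * b w)"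
    using S(1) unfolding T_def lin_comb_def by blast
  then obtain c where c: "\<And>a w. a \<in> S \<Longrightarrow> h a w = (\<Sum>b\<in>powprods Vs d. c a b * b w)" by metis
  obtain x where x: "\<exists>a\<in>S. x a \<noteq> 0" "\<forall>b\<in>powprods Vs d. (\<Sum>a\<in>S. x a * c a b) = 0"
    using underdetermined_system[of "powprods Vs d" S c] S finite_powprods[OF Vs(1)] by auto
  have dep: "(\<Sum>a\<in>S. x a * h a w) = 0" for w
  proof -
    have "(\<Sum>a\<in>S. x a * h a w) = (\<Sum>a\<in>S. \<Sum>b\<in>powprods Vs d. x a * c a b * b w)"
      by (auto intro!: sum.cong simp: c sum_distrib_left mult.assoc)
    also have "\<dots> = (\<Sum>b\<in>powprods Vs d. (\<Sum>a\<in>S. x a * c a b) * b w)"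
      by (subst sum.swap) (simp add: sum_distrib_right)
    finally show ?thesis using x(2) by simp
  qed
  \<comment> \<open>Multiplying the relation among the inverses by the product of all factors
    \<open>w v - a\<close> clears them modulo \<open>I\<close> and leaves this polynomial. It is
    nonzero because at a point \<open>a\<close> of \<open>S\<close> only the summand of
    \<open>a\<close> survives.\<close>
  define r where "r = (\<Sum>a\<in>S. Polynomial.smult (x a) (\<Prod>a'\<in>S - {a}. [:- a', 1:]))"
  have poly_r: "poly r t = (\<Sum>a\<in>S. x a * (\<Prod>a'\<in>S - {a}. t - a'))" for t
    by (simp add: r_def poly_sum poly_prod)
  have "r \<noteq> 0"
  proof -
    obtain a where a: "a \<in> S" "x a \<noteq> 0" using x(1) by auto
    have "poly r a = x a * (\<Prod>a'\<in>S - {a}. a - a')"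
      unfolding poly_r using S(2) a(1) by (subst sum.remove[of _ a]) (auto intro!: sum.neutral)
    moreover have "(\<Prod>a'\<in>S - {a}. a - a') \<noteq> 0" using S(2) by auto
    ultimately show ?thesis using a by auto
  qed
  moreover have "(\<lambda>w. poly r (w v)) \<in> I"
  proof -
    have tm: "x a * (\<Prod>a'\<in>S - {a}. w v - a') =
        (x a * (\<Prod>a'\<in>S - {a}. w v - a')) * k a w + (\<Prod>a'\<in>S. w v - a') * (x a * h a w)"
      if "a \<in> S" for a w
    proof -
      have "(\<Prod>a'\<in>S. w v - a') = (w v - a) * (\<Prod>a'\<in>S - {a}. w v - a')"
        using S(2) that by (rule prod.remove)
      then have "x a * (\<Prod>a'\<in>S - {a}. w v - a') * k a w + (\<Prod>a'\<in>S. w v - a') * (x a * h a w)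
          = x a * (\<Prod>a'\<in>S - {a}. w v - a') * (k a w + h a w * (w v - a))"
        by (simp only:) (simp only: distrib_left mult_ac)
      then show ?thesis using hk(3)[OF SF[OF that], of w] by simp
    qed
    have "poly r (w v) = (\<Sum>a\<in>S. (x a * (\<Prod>a'\<in>S - {a}. w v - a')) * k a w)" for w
    proof -
      have "poly r (w v) = (\<Sum>a\<in>S. (x a * (\<Prod>a'\<in>S - {a}. w v - a')) * k a w) +
          (\<Prod>a'\<in>S. w v - a') * (\<Sum>a\<in>S. x a * h a w)"
        unfolding poly_r sum_distrib_left sum.distrib[symmetric] by (rule sum.cong) (use tm in auto)
      then show ?thesis by (simp add: dep)
    qed
    moreover have "(\<lambda>w. \<Sum>a\<in>S. (x a * (\<Prod>a'\<in>S - {a}. w v - a')) * k a w) \<in> I"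
      by (intro poly_ideal_sum[OF I] poly_ideal_mult[OF I hk(1)] polyfun_intros SF Vs) auto
    ultimately show ?thesis by simp
  qed
  ultimately show ?thesis by blast
qed

text \<open>Let r = (X - a) r'. From 1 = k + h (w v - a) with k in \<open>I\<close> one gets r' = r'
  k + h r, again in \<open>I\<close>. So linear factors are stripped off until a nonzero constant is
  left.\<close>

lemma one_mem_ideal_if_univariate_mem:
  assumes Vs: "v \<in> Vs" and I: "poly_ideal Vs I"
    and inv: "\<And>a. (\<lambda>w. 1) \<in> adjoin Vs I (\<lambda>w. w v - a)"
    and r: "r \<noteq> 0" "(\<lambda>w. poly r (w v)) \<in> I"
  shows "(\<lambda>w. 1) \<in> I"
  using r
proof (induction "degree r" arbitrary: r)
  case 0
  then obtain c where c: "r = [:c:]" by (metis degree_eq_zeroE)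
  have "(\<lambda>w. inverse c * poly r (w v)) \<in> I"
    by (rule poly_ideal_mult[OF I 0(3)]) (auto intro: polyfun.intros)
  then show ?case using 0 c by simp
next
  case (Suc d)
  then have "\<not> constant (poly r)" by (simp add: constant_degree)
  then obtain a where "poly r a = 0" using fundamental_theorem_of_algebra by blast
  then obtain r' where r': "r = [:- a, 1:] * r'" by (auto simp: poly_eq_0_iff_dvd elim: dvdE)
  have nz: "r' \<noteq> 0" using Suc.prems(1) r' by auto
  have "degree r = degree [:- a, 1:] + degree r'"
    unfolding r' by (rule degree_mult_eq) (use nz in auto)
  then have deg: "degree r' = d" using Suc.hyps(2) by simp
  obtain k h where kh: "k \<in> I" "polyfun UNIV Vs h" "\<And>w. 1 = k w + h w * (w v - a)"
    using inv[of a] unfolding adjoin_def by blast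
  have "poly r' (w v) = poly r' (w v) * k w + h w * poly r (w v)" for w
  proof -
    have "poly r' (w v) * k w + h w * poly r (w v) = poly r' (w v) * (k w + h w * (w v - a))"
      by (simp add: r' algebra_simps)
    then show ?thesis using kh(3)[of w] by simp
  qed
  moreover have "(\<lambda>w. poly r' (w v) * k w + h w * poly r (w v)) \<in> I"
    by (intro poly_ideal_add[OF I] poly_ideal_mult[OF I] kh Suc.prems polyfun_poly pf_var Vs)
  ultimately have "(\<lambda>w. poly r' (w v)) \<in> I" by simp
  then show ?case using Suc.hyps(1)[of r'] deg nz by blast
qed

text \<open>The ideal is enlarged by \<open>w v - b\<close> for one variable at a time, staying
  proper. If every \<open>b\<close> failed, \<open>univariate_mem_ideal\<close> would supply a
  nonzero polynomial in the single variable \<open>v\<close>, and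
  \<open>one_mem_ideal_if_univariate_mem\<close> would put 1 into the ideal.\<close>

theorem weak_Nullstellensatz:
  assumes Vs: "finite Vs" and I: "poly_ideal Vs I" "(\<lambda>w. 1) \<notin> I"
    and poly: "\<And>f. f \<in> I \<Longrightarrow> polyfun UNIV Vs f"
  shows "\<exists>w. \<forall>f\<in>I. f w = 0"
proof -
  have "\<exists>J a. poly_ideal Vs J \<and> I \<subseteq> J \<and> (\<lambda>w. 1) \<notin> J \<and> (\<forall>v\<in>U. (\<lambda>w. w v - a v) \<in> J)"
    if "finite U" "U \<subseteq> Vs" for U
    using that
  proof (induction U)
    case empty
    then show ?case using I by (intro exI[of _ I]) auto
  next
    case (insert v U)
    then obtain J a where J: "poly_ideal Vs J" "I \<subseteq> J" "(\<lambda>w. 1) \<notin> J" "\<forall>v\<in>U. (\<lambda>w. w v - a v) \<in> J"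
      by auto
    obtain b where b: "(\<lambda>w. 1) \<notin> adjoin Vs J (\<lambda>w. w v - b)"
    proof (rule ccontr)
      assume "\<not> thesis"
      then have inv: "\<And>b. (\<lambda>w. 1) \<in> adjoin Vs J (\<lambda>w. w v - b)" using that by blast
      have "v \<in> Vs" using insert.prems by simp
      then have "\<exists>r. r \<noteq> 0 \<and> (\<lambda>w. poly r (w v)) \<in> J"
        by (intro univariate_mem_ideal[OF Vs _ J(1), of _ "{}"] inv) auto
      then show False using one_mem_ideal_if_univariate_mem[OF \<open>v \<in> Vs\<close> J(1) inv] J(3) by blast
    qed
    have "\<forall>u\<in>insert v U. (\<lambda>w. w u - (a(v := b)) u) \<in> adjoin Vs J (\<lambda>w. w v - b)"
      using J(4) adjoin_superset[of J Vs] adjoin_self[OF J(1)] insert.hyps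
      by (auto simp: subset_iff)
    then show ?case
      using poly_ideal_adjoin[OF J(1)] b J(2) adjoin_superset[of J Vs]
      by (intro exI[of _ "adjoin Vs J (\<lambda>w. w v - b)"] exI[of _ "a(v := b)"]) blast
  qed
  then obtain J a where J: "poly_ideal Vs J" "I \<subseteq> J" "(\<lambda>w. 1) \<notin> J" "\<forall>v\<in>Vs. (\<lambda>w. w v - a v) \<in> J"
    using Vs by blast
  \<comment> \<open>Modulo \<open>J\<close> each variable is the constant \<open>a v\<close>, so
    each polynomial is congruent to its value at \<open>a\<close>; a nonzero value of a member of
    \<open>I\<close> would be a unit in \<open>J\<close>.\<close>
  have diff: "(\<lambda>w. f w - f a) \<in> J" if "polyfun UNIV Vs f" for f
    using that
  proof (induction rule: polyfun.induct)
    case (pf_const c)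
    then show ?case using poly_ideal_zero[OF J(1)] by simp
  next
    case (pf_var v)
    then show ?case using J(4) by blast
  next
    case (pf_add f g)
    from poly_ideal_add[OF J(1) pf_add.IH] show ?case by (simp add: algebra_simps)
  next
    case (pf_mult f g)
    have "(\<lambda>w. g w * (f w - f a) + f a * (g w - g a)) \<in> J"
      by (intro poly_ideal_add[OF J(1)] poly_ideal_mult[OF J(1)] pf_mult pf_const) auto
    then show ?case by (simp add: algebra_simps)
  qed
  have "f a = 0" if f: "f \<in> I" for f
  proof (rule ccontr)
    assume nz: "f a \<noteq> 0"
    have "(\<lambda>w. inverse (f a) * f w + (- inverse (f a)) * (f w - f a)) \<in> J"
      by (intro poly_ideal_add[OF J(1)] poly_ideal_mult[OF J(1)] diff poly f pf_const)
        (use f J(2) in auto)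
    then show False using nz J(3) by (simp add: algebra_simps)
  qed
  then show ?thesis by blast
qed

section \<open>Elimination with rational coefficients\<close>

lemma adjoin_polyfun:
  assumes "\<And>g. g \<in> I \<Longrightarrow> polyfun UNIV Vs g" "polyfun UNIV Vs f" "g \<in> adjoin Vs I f"
  shows "polyfun UNIV Vs g"
proof -
  obtain k h where "k \<in> I" "polyfun UNIV Vs h" "g = (\<lambda>w. k w + h w * f w)"
    using assms(3) unfolding adjoin_def by blast
  then show ?thesis using assms by (auto intro!: polyfun.intros)
qed

text \<open>A \<open>\<rat>\<close>-linear retraction \<open>\<complex> \<rightarrow> \<rat>\<close>, applied to coefficients, brings certificates of ideal
  membership down to the rationals.\<close>
lemma rational_retraction:
  "\<exists>\<pi> :: complex \<Rightarrow> rat. (\<forall>x y. \<pi> (x + y) = \<pi> x + \<pi> y) \<and> (\<forall>q x. \<pi> (of_rat q * x) = q * \<pi> x) \<and> \<pi> 1 = 1"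
proof -
  interpret vs: vector_space_pair "\<lambda>(q::rat) (x::complex). of_rat q * x" "\<lambda>(q::rat) (x::rat). q * x"
    by unfold_locales (auto simp: algebra_simps of_rat_add of_rat_mult)
  have "vs.vs1.independent {1::complex}"
    by simp
  then obtain \<pi> where "Vector_Spaces.linear (\<lambda>(q::rat) (x::complex). of_rat q * x) (\<lambda>(q::rat) (x::rat). q * x) \<pi>"
      "\<forall>x\<in>{1}. \<pi> x = 1"
    using vs.linear_independent_extend[of "{1}" "\<lambda>_. 1"] by blast
  then show ?thesis
    by (auto intro!: exI[of _ \<pi>] dest: vs.linear_add vs.linear_scale)
qed

lemma retraction_sum:
  assumes "\<forall>x y. \<pi> (x + y) = \<pi> x + (\<pi> y :: rat)"
  shows "\<pi> (\<Sum>i\<in>S. f i :: complex) = (\<Sum>i\<in>S. \<pi> (f i))"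
proof -
  have "\<pi> 0 = 0" using assms by (metis add.right_neutral add_left_cancel)
  then show ?thesis using assms by (induction S rule: infinite_finite_induct) auto
qed

text \<open>\<open>\<pi>\<close> acts on the coefficients of \<open>h\<close>. At a rational point
  the monomials are rational scalars, which pass through the Q-linear map, so the two sides agree
  there; elsewhere nothing is claimed.\<close>

lemma polyfun_retraction:
  assumes Vs: "finite Vs" and h: "polyfun UNIV Vs h"
    and \<pi>: "\<forall>x y. \<pi> (x + y) = \<pi> x + (\<pi> y :: rat)" "\<forall>q x. \<pi> (of_rat q * x) = q * \<pi> x"
  shows "\<exists>h'. polyfun \<rat> Vs h' \<and> (\<forall>w. (\<forall>v\<in>Vs. w v \<in> \<rat>) \<longrightarrow> h' w = of_rat (\<pi> (h w)))"
proof -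
  obtain d a where a: "\<And>w. h w = (\<Sum>b\<in>powprods Vs d. a b * b w)"
    using polyfun_lin_comb_powprods[OF h Vs] unfolding lin_comb_def by blast
  define h' where "h' w = (\<Sum>b\<in>powprods Vs d. of_rat (\<pi> (a b)) * b w)" for w :: "'a \<Rightarrow> complex"
  have pf: "polyfun \<rat> Vs b" if "b \<in> powprods Vs d" for b
    using that by (auto elim!: powprods_cases simp: polyfun_powprod)
  have "polyfun \<rat> Vs h'" unfolding h'_def by (intro polyfun_intros pf) auto
  moreover have "h' w = of_rat (\<pi> (h w))" if w: "\<forall>v\<in>Vs. w v \<in> \<rat>" for w
  proof -
    have "\<pi> (a b * b w) = \<pi> (a b) * (THE q. of_rat q = b w) \<and> of_rat (THE q. of_rat q = b w) = b w"
      if b: "b \<in> powprods Vs d" for b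
    proof -
      have "b w \<in> \<rat>" using polyfun_Rats_value[OF pf[OF b]] w by blast
      then obtain q where q: "b w = of_rat q" by (auto elim: Rats_cases)
      then have "(THE q. of_rat q = b w) = q" by auto
      then show ?thesis using q \<pi>(2) by (metis mult.commute)
    qed
    then show ?thesis
      by (simp add: h'_def a retraction_sum[OF \<pi>(1)] of_rat_sum of_rat_mult)
  qed
  ultimately show ?thesis by blast
qed

text \<open>For \<open>a\<close> outside \<open>F\<close> the equations together with
  \<open>w v = a\<close> have no solution, so \<open>w v - a\<close> is invertible modulo the ideal
  and \<open>univariate_mem_ideal\<close> applies. The complex certificate obtained this way is then
  retracted to rational coefficients.\<close>

theorem elimination_finite_projection:
  assumes Vs: "finite Vs" "v \<in> Vs" and G: "finite G" "\<And>q. q \<in> G \<Longrightarrow> polyfun \<rat> Vs q"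
    and F: "finite F" "\<And>w. (\<forall>q\<in>G. q w = 0) \<Longrightarrow> w v \<in> F"
  shows "\<exists>r. r \<noteq> 0 \<and> (\<lambda>w. cpoly r (w v)) \<in> ideal_gen Vs G"
proof -
  define I where "I = {g. \<exists>h. (\<forall>q\<in>G. polyfun UNIV Vs (h q)) \<and> (\<forall>w. g w = (\<Sum>q\<in>G. h q w * q w))}"
  have I: "poly_ideal Vs I"
    unfolding poly_ideal_def
  proof (intro conjI ballI allI impI)
    show "(\<lambda>w. 0) \<in> I" unfolding I_def
      by (auto intro!: exI[of _ "\<lambda>_ _. 0"] polyfun.intros)
  next
    fix f g assume "f \<in> I" "g \<in> I"
    then obtain h h' where "\<forall>q\<in>G. polyfun UNIV Vs (h q)" "\<forall>w. f w = (\<Sum>q\<in>G. h q w * q w)"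
      "\<forall>q\<in>G. polyfun UNIV Vs (h' q)" "\<forall>w. g w = (\<Sum>q\<in>G. h' q w * q w)"
      unfolding I_def by blast
    then show "(\<lambda>w. f w + g w) \<in> I" unfolding I_def
      by (auto intro!: exI[of _ "\<lambda>q w. h q w + h' q w"] polyfun.intros simp: algebra_simps sum.distrib)
  next
    fix f p assume "f \<in> I" and p: "polyfun UNIV Vs p"
    then obtain h where "\<forall>q\<in>G. polyfun UNIV Vs (h q)" "\<forall>w. f w = (\<Sum>q\<in>G. h q w * q w)"
      unfolding I_def by blast
    then show "(\<lambda>w. p w * f w) \<in> I" unfolding I_def using p
      by (auto intro!: exI[of _ "\<lambda>q w. p w * h q w"] polyfun.intros simp: sum_distrib_left mult.assoc)
  qed
  have GI: "q \<in> I" if "q \<in> G" for q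
    unfolding I_def using that G(1)
    by (auto intro!: exI[of _ "\<lambda>q' w. if q' = q then 1 else 0"] polyfun_intros
        simp: sum.remove[of G q])
  have pfI: "polyfun UNIV Vs f" if f: "f \<in> I" for f
  proof -
    obtain h where h: "\<forall>q\<in>G. polyfun UNIV Vs (h q)" "f = (\<lambda>w. \<Sum>q\<in>G. h q w * q w)"
      using f unfolding I_def fun_eq_iff by blast
    show ?thesis unfolding h(2) using h(1) polyfun_mono[OF G(2)] by (intro polyfun_intros) auto
  qed
  have "(\<lambda>w. 1) \<in> adjoin Vs I (\<lambda>w. w v - a)" if a: "a \<notin> F" for a
  proof (rule ccontr)
    assume "(\<lambda>w. 1) \<notin> adjoin Vs I (\<lambda>w. w v - a)"
    moreover have "polyfun UNIV Vs (\<lambda>w. w v - a)" by (intro polyfun_intros Vs(2)) auto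
    then have "polyfun UNIV Vs g" if "g \<in> adjoin Vs I (\<lambda>w. w v - a)" for g
      using adjoin_polyfun[OF pfI _ that] by blast
    ultimately have "\<exists>w. \<forall>f\<in>adjoin Vs I (\<lambda>w. w v - a). f w = 0"
      using weak_Nullstellensatz[OF Vs(1) poly_ideal_adjoin[OF I]] by blast
    then obtain w where w: "\<forall>f\<in>adjoin Vs I (\<lambda>w. w v - a). f w = 0" by blast
    have "\<forall>q\<in>G. q w = 0" using w GI adjoin_superset[of I Vs] by blast
    moreover have "w v = a" using w adjoin_self[OF I, of "\<lambda>w. w v - a"] by auto
    ultimately show False using F(2) a by blast
  qed
  then obtain r0 where r0: "r0 \<noteq> 0" "(\<lambda>w. poly r0 (w v)) \<in> I"
    using univariate_mem_ideal[OF Vs I countable_finite[OF F(1)]] by blast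
  \<comment> \<open>Made monic, since \<open>\<pi> 1 = 1\<close> is what keeps the leading
    coefficient from being sent to zero.\<close>
  define r1 where "r1 = Polynomial.smult (inverse (lead_coeff r0)) r0"
  have r1: "lead_coeff r1 = 1" using r0(1) by (simp add: r1_def)
  have "(\<lambda>w. inverse (lead_coeff r0) * poly r0 (w v)) \<in> I"
    by (rule poly_ideal_mult[OF I r0(2)]) (auto intro: polyfun.intros)
  then have "(\<lambda>w. poly r1 (w v)) \<in> I" by (simp add: r1_def)
  then obtain h where h: "\<forall>q\<in>G. polyfun UNIV Vs (h q)" "\<And>w. poly r1 (w v) = (\<Sum>q\<in>G. h q w * q w)"
    unfolding I_def by blast
  obtain \<pi> :: "complex \<Rightarrow> rat" where \<pi>: "\<forall>x y. \<pi> (x + y) = \<pi> x + \<pi> y"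
    "\<forall>q x. \<pi> (of_rat q * x) = q * \<pi> x" "\<pi> 1 = 1"
    using rational_retraction by blast
  have \<pi>0: "\<pi> 0 = 0" using \<pi>(1) by (metis add.right_neutral add_left_cancel)
  define r where "r = map_poly \<pi> r1"
  have "coeff r (degree r1) = 1" using r1 by (simp add: r_def coeff_map_poly \<pi>0 \<pi>(3))
  then have "r \<noteq> 0" by auto
  have "\<forall>q\<in>G. \<exists>h'. polyfun \<rat> Vs h' \<and> (\<forall>w. (\<forall>v\<in>Vs. w v \<in> \<rat>) \<longrightarrow> h' w = of_rat (\<pi> (h q w)))"
    using polyfun_retraction[OF Vs(1) _ \<pi>(1,2)] h(1) by blast
  then obtain h' where h': "\<And>q. q \<in> G \<Longrightarrow> polyfun \<rat> Vs (h' q)"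
    "\<And>q w. q \<in> G \<Longrightarrow> \<forall>v\<in>Vs. w v \<in> \<rat> \<Longrightarrow> h' q w = of_rat (\<pi> (h q w))" by metis
  have cp: "cpoly r t = (\<Sum>i\<le>degree r1. of_rat (\<pi> (coeff r1 i)) * t ^ i)" for t
  proof -
    have deg: "degree (map_poly complex_of_rat r) \<le> degree r1"
      by (rule degree_le) (simp add: r_def coeff_map_poly \<pi>0 coeff_eq_0)
    have "cpoly r t = (\<Sum>i\<le>degree r1. coeff (map_poly of_rat r) i * t ^ i)"
      unfolding cpoly_def poly_altdef
      by (rule sum.mono_neutral_left)
        (use deg in \<open>auto simp: coeff_eq_0\<close>)
    then show ?thesis by (simp add: r_def coeff_map_poly \<pi>0)
  qed
  have pfr: "polyfun \<rat> Vs (\<lambda>w. cpoly r (w v))"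
    unfolding cp by (intro polyfun_intros Vs) auto
  \<comment> \<open>Both sides are polynomials, so the identity only has to be checked at rational
    points, where \<open>\<pi>\<close> can be applied to the complex certificate term by
    term.\<close>
  have "cpoly r (w v) - (\<Sum>q\<in>G. h' q w * q w) = 0" for w
  proof (rule polyfun_zero_if_zero_on_Rats[where f = "\<lambda>w. cpoly r (w v) - (\<Sum>q\<in>G. h' q w * q w)", OF _ Vs(1)])
    show "polyfun \<rat> Vs (\<lambda>w. cpoly r (w v) - (\<Sum>q\<in>G. h' q w * q w))"
      using pfr h'(1) G(2) by (intro polyfun_intros) auto
  next
    fix w :: "'a \<Rightarrow> complex" assume w: "\<forall>v\<in>Vs. w v \<in> \<rat>"
    obtain t where t: "w v = of_rat t" using w Vs(2) by (meson Rats_cases)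
    have "\<forall>q\<in>G. \<exists>s. q w = of_rat s" using polyfun_Rats_value[OF G(2)] w by (meson Rats_cases)
    then obtain s where s: "\<And>q. q \<in> G \<Longrightarrow> q w = of_rat (s q)" by metis
    have "cpoly r (w v) = of_rat (\<pi> (poly r1 (w v)))"
    proof -
      have "\<pi> (coeff r1 i * w v ^ i) = \<pi> (coeff r1 i) * t ^ i" for i
        using \<pi>(2) unfolding t of_rat_power[symmetric] by (simp add: mult.commute)
      then have "\<pi> (poly r1 (w v)) = (\<Sum>i\<le>degree r1. \<pi> (coeff r1 i) * t ^ i)"
        by (simp add: poly_altdef retraction_sum[OF \<pi>(1)])
      then show ?thesis by (simp add: cp t of_rat_sum of_rat_mult of_rat_power)
    qed
    also have "\<dots> = (\<Sum>q\<in>G. of_rat (\<pi> (h q w * q w)))"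
      by (simp add: h(2) retraction_sum[OF \<pi>(1)] of_rat_sum)
    also have "\<dots> = (\<Sum>q\<in>G. h' q w * q w)"
    proof (rule sum.cong[OF refl])
      fix q assume q: "q \<in> G"
      have "\<pi> (h q w * q w) = s q * \<pi> (h q w)" using s[OF q] \<pi>(2) by (metis mult.commute)
      then show "of_rat (\<pi> (h q w * q w)) = h' q w * q w"
        using h'(2)[OF q w] s[OF q] by (simp add: of_rat_mult)
    qed
    finally show "cpoly r (w v) - (\<Sum>q\<in>G. h' q w * q w) = 0" by simp
  qed
  then have "(\<lambda>w. cpoly r (w v)) \<in> ideal_gen Vs G"
    unfolding ideal_gen_def using h'(1) by auto
  with \<open>r \<noteq> 0\<close> show ?thesis by blast
qed

subsection \<open>Rational parametrizations of finite sets defined over the rationals\<close>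

lemma map_poly_pCons_of_rat: "map_poly of_rat (pCons a p) = pCons (of_rat a) (map_poly of_rat p)"
  by (simp add: map_poly_pCons)

lemma cpoly_pCons: "cpoly (pCons a p) t = of_rat a + t * cpoly p t"
  by (simp add: cpoly_def map_poly_pCons)

lemma cpoly_0: "cpoly 0 t = 0"
  by (simp add: cpoly_def)

lemma cpoly_add: "cpoly (p + q) t = cpoly p t + cpoly q t"
  by (induction p q rule: poly_induct2) (auto simp: cpoly_0 cpoly_pCons of_rat_add algebra_simps)

lemma cpoly_smult: "cpoly (Polynomial.smult a p) t = of_rat a * cpoly p t"
  by (induction p) (auto simp: cpoly_0 cpoly_pCons of_rat_mult algebra_simps)

lemma cpoly_simps:
  "cpoly 0 t = 0" "cpoly 1 t = 1" "cpoly (p + q) t = cpoly p t + cpoly q t"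
  "cpoly (p * q) t = cpoly p t * cpoly q t" "cpoly [:r:] t = of_rat r"
  "cpoly (p - q) t = cpoly p t - cpoly q t"
proof -
  show 0: "cpoly 0 t = 0" by (rule cpoly_0)
  show "cpoly 1 t = 1" by (simp add: cpoly_def map_poly_1')
  show "cpoly (p + q) t = cpoly p t + cpoly q t" by (rule cpoly_add)
  show "cpoly [:r:] t = of_rat r" by (simp add: cpoly_pCons 0)
  show "cpoly (p * q) t = cpoly p t * cpoly q t"
    by (induction p) (auto simp: 0 cpoly_pCons cpoly_add cpoly_smult algebra_simps)
  show "cpoly (p - q) t = cpoly p t - cpoly q t"
    using cpoly_add[of "p - q" q t] by simp
qed

lemma cpoly_pcompose: "cpoly (pcompose p q) t = cpoly p (cpoly q t)"
  by (induction p) (auto simp: cpoly_simps pcompose_pCons cpoly_pCons)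

lemma finite_cpoly_roots: "p \<noteq> 0 \<Longrightarrow> finite {t. cpoly p t = 0}"
  unfolding cpoly_def by (rule poly_roots_finite) (simp add: map_poly_eq_0_iff)

lemma polyfun_Rats_cpoly:
  assumes "polyfun \<rat> Vs f"
  shows "\<exists>q. \<forall>t. f (\<lambda>v. cpoly (h v) t) = cpoly q t"
  using assms
proof (induction rule: polyfun.induct)
  case (pf_const a)
  then obtain r where "a = of_rat r" by (auto elim: Rats_cases)
  then show ?case by (intro exI[of _ "[:r:]"]) (simp add: cpoly_simps)
next
  case (pf_add f g)
  then show ?case by (metis cpoly_simps(3))
next
  case (pf_mult f g)
  then show ?case by (metis cpoly_simps(4))
qed blast

section \<open>Simple algebraic extensions of the rationals\<close>

definition algebraic_Q :: "complex \<Rightarrow> bool" where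
  "algebraic_Q t \<longleftrightarrow> (\<exists>p. p \<noteq> 0 \<and> cpoly p t = 0)"

text \<open>This is the ring Q[t]. For algebraic \<open>t\<close> it is the field Q(t), by
  \<open>Q_adj_inverse\<close>, which is why parametrizations with denominator 1 suffice.\<close>

definition Q_adj :: "complex \<Rightarrow> complex set" where
  "Q_adj t = range (\<lambda>p. cpoly p t)"

lemma Q_adj_closed:
  "of_rat r \<in> Q_adj t" "t \<in> Q_adj t"
  "a \<in> Q_adj t \<Longrightarrow> b \<in> Q_adj t \<Longrightarrow> a + b \<in> Q_adj t"
  "a \<in> Q_adj t \<Longrightarrow> b \<in> Q_adj t \<Longrightarrow> a - b \<in> Q_adj t"
  "a \<in> Q_adj t \<Longrightarrow> b \<in> Q_adj t \<Longrightarrow> a * b \<in> Q_adj t"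
proof -
  show "of_rat r \<in> Q_adj t" unfolding Q_adj_def by (metis cpoly_simps(5) rangeI)
  have "cpoly [:0, 1:] t = t" by (simp add: cpoly_simps cpoly_pCons)
  then show "t \<in> Q_adj t" unfolding Q_adj_def by (metis rangeI)
qed (auto simp: Q_adj_def cpoly_simps[symmetric])

lemma Q_adj_trans: "s \<in> Q_adj t \<Longrightarrow> Q_adj s \<subseteq> Q_adj t"
  by (auto simp: Q_adj_def cpoly_pcompose[symmetric])

lemma minimal_poly:
  assumes "algebraic_Q t"
  obtains q where "q \<noteq> 0" "cpoly q t = 0" "\<And>p. cpoly p t = 0 \<Longrightarrow> q dvd p"
proof -
  define P where "P p \<longleftrightarrow> p \<noteq> 0 \<and> cpoly p t = 0" for p
  obtain q where q: "P q" "\<And>p. P p \<Longrightarrow> degree q \<le> degree p"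
    using assms ex_has_least_nat[of P _ degree] unfolding algebraic_Q_def P_def by blast
  have "q dvd p" if "cpoly p t = 0" for p
  proof (rule ccontr)
    assume "\<not> q dvd p"
    then have nz: "p mod q \<noteq> 0" by (simp add: dvd_eq_mod_eq_0)
    have "cpoly (q * (p div q) + p mod q) t = 0" using that by simp
    then have "cpoly (p mod q) t = 0" using q(1) unfolding cpoly_simps P_def by simp
    then have "degree q \<le> degree (p mod q)" using q(2) nz by (simp add: P_def)
    moreover have "degree (p mod q) < degree q"
      using nz q(1) degree_mod_less[of q p] by (auto simp: P_def)
    ultimately show False by simp
  qed
  then show ?thesis using q(1) that unfolding P_def by blast
qed

text \<open>Write the element as p(t) and let q be minimal for \<open>t\<close>. The gcd of p and q
  does not vanish at \<open>t\<close>, so its cofactor in q does and is divisible by q. Hence the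
  gcd is a unit, and Bezout gives the inverse.\<close>

lemma Q_adj_inverse:
  assumes "algebraic_Q t" "a \<in> Q_adj t"
  shows "inverse a \<in> Q_adj t"
proof (cases "a = 0")
  case True
  then show ?thesis using Q_adj_closed(1)[of 0] by simp
next
  case False
  obtain q where q: "q \<noteq> 0" "cpoly q t = 0" "\<And>p. cpoly p t = 0 \<Longrightarrow> q dvd p"
    using minimal_poly[OF assms(1)] by blast
  obtain p where p: "a = cpoly p t" using assms(2) by (auto simp: Q_adj_def)
  obtain g where g: "g = gcd p q" by blast
  obtain q' where q': "q = g * q'" using g by (metis dvdE gcd_dvd2)
  have ga: "cpoly g t \<noteq> 0"
    using g False p by (metis cpoly_simps(4) dvdE gcd_dvd1 mult_zero_left)
  then have "cpoly q' t = 0" using q(2) q' by (simp add: cpoly_simps)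
  then have "q dvd q'" by (rule q(3))
  then have "g dvd 1" using q(1) q' by (metis dvd_mult_cancel_left mult.commute mult_cancel_right2 mult_dvd_mono dvd_refl mult_1)
  then have "gcd p q = 1" using g by simp
  then obtain u v where "u * p + v * q = 1" using bezout_coefficients_fst_snd[of p q] by metis
  then have "cpoly (u * p + v * q) t = 1" by (simp add: cpoly_simps)
  then have "cpoly u t * a = 1" using q(2) p by (simp add: cpoly_simps)
  then have "inverse a = cpoly u t" by (metis inverse_unique mult.commute)
  then show ?thesis by (auto simp: Q_adj_def)
qed

lemma cpoly_pderiv: "cpoly (pderiv q) t = poly (pderiv (map_poly of_rat q)) t"
proof -
  have "map_poly of_rat (pderiv q) = pderiv (map_poly (of_rat :: rat \<Rightarrow> complex) q)"
    by (rule poly_eqI) (simp add: coeff_pderiv coeff_map_poly of_rat_mult of_rat_add)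
  then show ?thesis by (simp add: cpoly_def)
qed

text \<open>With \<open>t = a + c b\<close> generic, the minimal polynomial of \<open>b\<close> over \<open>\<rat>(t)\<close> divides both \<open>g\<close> and
  \<open>f(t - c x)\<close>, whose only common root \<open>b\<close> is simple.\<close>
lemma primitive_element_two:
  assumes "algebraic_Q a" "algebraic_Q b"
  shows "\<exists>t. algebraic_Q t \<and> a \<in> Q_adj t \<and> b \<in> Q_adj t"
proof -
  obtain f where f: "f \<noteq> 0" "cpoly f a = 0" using assms(1) by (auto simp: algebraic_Q_def)
  obtain g where g: "g \<noteq> 0" "cpoly g b = 0" "\<And>p. cpoly p b = 0 \<Longrightarrow> g dvd p"
    using minimal_poly[OF assms(2)] by blast
  have deg_g: "degree g > 0"
    using g(1,2) by (cases "degree g") (auto elim!: degree_eq_zeroE simp: cpoly_simps)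
  have simple: "cpoly (pderiv g) b \<noteq> 0"
  proof
    assume "cpoly (pderiv g) b = 0"
    then have "g dvd pderiv g" by (rule g(3))
    moreover have "pderiv g \<noteq> 0" using deg_g by (simp add: pderiv_eq_0_iff)
    ultimately have "degree g \<le> degree (pderiv g)" by (simp add: dvd_imp_degree_le)
    then show False using deg_g by (simp add: degree_pderiv)
  qed
  \<comment> \<open>These are the values r with a' + r b' = a + r b for some other roots a', b'.
    Pairs with b' = b contribute 0 through division by zero, which excludes only one more
    value.\<close>
  define bad where "bad = (\<lambda>(a', b'). (a - a') / (b' - b)) ` ({a'. cpoly f a' = 0} \<times> {b'. cpoly g b' = 0})"
  have "finite bad" unfolding bad_def using finite_cpoly_roots f g by blast
  moreover have "infinite (range (of_rat :: rat \<Rightarrow> complex))"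
    by (simp add: finite_image_iff inj_on_def infinite_UNIV_char_0)
  ultimately obtain r :: rat where r: "of_rat r \<notin> bad"
    by (metis finite_subset rangeE subsetI)
  define t where "t = a + of_rat r * b"
  define fs where "fs = pcompose (map_poly of_rat f) [:t, - of_rat r:]"
  define gc where "gc = map_poly (of_rat :: rat \<Rightarrow> complex) g"
  have common: "b' = b" if "poly fs b' = 0" "poly gc b' = 0" for b'
  proof (rule ccontr)
    assume "b' \<noteq> b"
    define a' where "a' = t - of_rat r * b'"
    have "cpoly f a' = 0" using that(1) by (simp add: fs_def poly_pcompose cpoly_def a'_def mult.commute)
    moreover have "cpoly g b' = 0" using that(2) by (simp add: gc_def cpoly_def)
    moreover have "of_rat r = (a - a') / (b' - b)"
      using \<open>b' \<noteq> b\<close> by (simp add: a'_def t_def field_simps)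
    ultimately have "of_rat r \<in> bad" unfolding bad_def by force
    then show False using r by simp
  qed
  have alg_t: "algebraic_Q t"
  proof -
    \<comment> \<open>Algebraicity of \<open>t\<close> comes from elimination: the third coordinate
      takes only finitely many values on the zeros of \<open>G\<close>, so it satisfies a rational
      polynomial.\<close>
    define G where "G = {\<lambda>w :: nat \<Rightarrow> complex. cpoly f (w 0), \<lambda>w. cpoly g (w 1), \<lambda>w. w 2 - (w 0 + of_rat r * w 1)}"
    have pf: "polyfun \<rat> {0, 1, 2} (\<lambda>w. cpoly p (w v))" if "v \<in> {0, 1, 2}" for p and v :: nat
      using that by (induction p) (auto simp: cpoly_simps cpoly_pCons intro!: polyfun_intros)
    have "\<exists>r'. r' \<noteq> 0 \<and> (\<lambda>w. cpoly r' (w 2)) \<in> ideal_gen {0, 1, 2} G"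
    proof (rule elimination_finite_projection)
      show "polyfun \<rat> {0, 1, 2} q" if "q \<in> G" for q
        using that pf[of 0 f] pf[of 1 g] unfolding G_def by (auto intro!: polyfun_intros)
      show "finite ((\<lambda>(x, y). x + of_rat r * y) ` ({x. cpoly f x = 0} \<times> {y. cpoly g y = 0}))"
        using finite_cpoly_roots f g by blast
      show "w 2 \<in> (\<lambda>(x, y). x + of_rat r * y) ` ({x. cpoly f x = 0} \<times> {y. cpoly g y = 0})"
        if "\<forall>q\<in>G. q w = 0" for w
        using that unfolding G_def by auto
    qed (auto simp: G_def)
    then obtain r' h where r': "r' \<noteq> 0" "\<And>w. cpoly r' (w 2) = (\<Sum>q\<in>G. h q w * q w)"
      unfolding ideal_gen_def by blast
    define w0 :: "nat \<Rightarrow> complex" where "w0 = (\<lambda>_. 0)(0 := a, 1 := b, 2 := t)"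
    have "q w0 = 0" if "q \<in> G" for q
      using that f(2) g(2) unfolding G_def w0_def by (auto simp: t_def)
    then have "cpoly r' (w0 2) = 0" unfolding r'(2) by simp
    then show ?thesis using r'(1) by (auto simp: algebraic_Q_def w0_def)
  qed
  \<comment> \<open>\<open>K\<close> is the polynomial ring over the field Q(t), seen inside the
    complex polynomials.\<close>
  define K where "K = {p. \<forall>i. coeff p i \<in> Q_adj t}"
  have Q0: "0 \<in> Q_adj t" and Q1: "1 \<in> Q_adj t" using Q_adj_closed(1)[of 0] Q_adj_closed(1)[of 1] by auto
  have Qsum: "(\<Sum>i\<in>S. h i) \<in> Q_adj t" if "\<And>i. i \<in> S \<Longrightarrow> h i \<in> Q_adj t" for h and S :: "nat set"
    using that by (induction S rule: infinite_finite_induct) (auto simp: Q0 Q_adj_closed)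
  have K_mult: "p * q \<in> K" if "p \<in> K" "q \<in> K" for p q
    using that by (auto simp: K_def coeff_mult intro!: Qsum Q_adj_closed)
  have K_diff: "p - q \<in> K" and K_add: "p + q \<in> K" if "p \<in> K" "q \<in> K" for p q
    using that by (auto simp: K_def intro: Q_adj_closed)
  have K_const: "[:c:] \<in> K" if "c \<in> Q_adj t" for c
    using that by (auto simp: K_def coeff_pCons Q0 split: nat.split)
  have K_pc: "pCons c p \<in> K" if "c \<in> Q_adj t" "p \<in> K" for c p
    using that by (auto simp: K_def coeff_pCons split: nat.split)
  have K_0: "0 \<in> K" by (simp add: K_def Q0)
  have gcK: "gc \<in> K" by (auto simp: K_def gc_def coeff_map_poly Q_adj_closed)
  have neg: "- of_rat r \<in> Q_adj t" using Q_adj_closed(1)[of "- r"] by (simp add: of_rat_minus)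
  have fsK: "fs \<in> K"
  proof -
    have "pcompose (map_poly of_rat p) [:t, - of_rat r:] \<in> K" for p
    proof (induction p)
      case (pCons c p)
      then show ?case
        by (simp only: map_poly_pCons_of_rat pcompose_pCons)
          (intro K_add K_mult K_const K_pc Q_adj_closed(1,2) neg K_0 pCons.IH)
    qed (simp add: K_0)
    then show ?thesis by (simp add: fs_def)
  qed
  have fsb: "poly fs b = 0" using f(2) by (simp add: fs_def poly_pcompose cpoly_def t_def mult.commute)
  have gcb: "poly gc b = 0" using g(2) by (simp add: gc_def cpoly_def)
  have gc0: "gc \<noteq> 0" using g(1) by (simp add: gc_def map_poly_eq_0_iff)
  define P where "P p \<longleftrightarrow> p \<noteq> 0 \<and> p \<in> K \<and> poly p b = 0" for p
  have "P gc" using gc0 gcK gcb by (simp add: P_def)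
  then obtain h0 where h0: "P h0" "\<And>p. P p \<Longrightarrow> degree h0 \<le> degree p"
    using ex_has_least_nat[of P gc degree] by blast
  \<comment> \<open>Least degree in \<open>K\<close> among the nonzero polynomials vanishing at
    \<open>b\<close>, made monic: the minimal polynomial of \<open>b\<close> over Q(t). Once it is
    known to be X - b, its constant coefficient puts \<open>b\<close> into Q(t).\<close>
  define h where "h = Polynomial.smult (inverse (lead_coeff h0)) h0"
  have h: "P h" "lead_coeff h = 1" "\<And>p. P p \<Longrightarrow> degree h \<le> degree p"
    using h0 Q_adj_inverse[OF alg_t] by (auto simp: h_def P_def K_def intro!: Q_adj_closed)
  have dvd: "h dvd p" if "p \<in> K" "poly p b = 0" for p
    using that
  proof (induction "degree p" arbitrary: p rule: less_induct)
    case less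
    show ?case
    proof (cases "p = 0 \<or> degree p = 0")
      case True
      then have "p = 0" using less.prems by (auto elim!: degree_eq_zeroE)
      then show ?thesis by simp
    next
      case False
      then have "P p" using less.prems by (simp add: P_def)
      then have le: "degree h \<le> degree p" by (rule h(3))
      define p' where "p' = p - monom (lead_coeff p) (degree p - degree h) * h"
      have mK: "monom (lead_coeff p) (degree p - degree h) \<in> K"
        using less.prems by (auto simp: K_def Q0)
      have "p' \<in> K" unfolding p'_def using K_diff K_mult mK h(1) less.prems by (simp add: P_def)
      moreover have "poly p' b = 0" using h(1) less.prems by (simp add: p'_def P_def)
      moreover have "p' = 0 \<or> degree p' < degree p"
      proof -
        have dm: "degree (monom (lead_coeff p) (degree p - degree h) * h) = degree p"
          using False h(1) le by (simp add: degree_mult_eq P_def degree_monom_eq monom_eq_0_iff)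
        have lm: "lead_coeff (monom (lead_coeff p) (degree p - degree h) * h) = lead_coeff p"
          using h(2) by (simp only: lead_coeff_mult lead_coeff_monom) simp
        have "coeff p' (degree p) = 0" using lm dm by (simp add: p'_def)
        moreover have "degree p' \<le> degree p" unfolding p'_def by (rule degree_diff_le) (use dm in auto)
        ultimately show ?thesis
          by (metis coeff_0_degree_minus_1 degree_0 le_neq_implies_less leading_coeff_0_iff)
      qed
      ultimately have "h dvd p'" using less.hyps by auto
      then show ?thesis unfolding p'_def by (metis dvd_diff_commute dvd_triv_right dvd_diff diff_add_cancel dvd_add)
    qed
  qed
  have "degree h > 0"
    using h(1) by (cases "degree h") (auto elim!: degree_eq_zeroE simp: P_def)
  obtain h1 where h1: "h = [:- b, 1:] * h1" using h(1) by (auto simp: P_def poly_eq_0_iff_dvd elim: dvdE)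
  \<comment> \<open>A root of \<open>h1\<close> is a common root of \<open>fs\<close> and
    \<open>gc\<close>, hence \<open>b\<close> itself. But then \<open>b\<close> is a double root of
    \<open>gc\<close>, against the separability of the minimal polynomial \<open>g\<close>.\<close>
  have "degree h1 = 0"
  proof (rule ccontr)
    assume "degree h1 \<noteq> 0"
    then obtain b' where b': "poly h1 b' = 0"
      using fundamental_theorem_of_algebra[of h1] constant_degree[of h1] by auto
    then have "poly h b' = 0" by (simp add: h1)
    then have "poly fs b' = 0" "poly gc b' = 0"
      using dvd[OF fsK fsb] dvd[OF gcK gcb] by (auto elim!: dvdE)
    then have "b' = b" by (rule common)
    then have "[:- b, 1:] dvd h1" using b' by (simp add: poly_eq_0_iff_dvd)
    then obtain h2 where "h1 = [:- b, 1:] * h2" by (rule dvdE)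
    moreover obtain g2 where "gc = h * g2" using dvd[OF gcK gcb] by (auto elim: dvdE)
    ultimately have "gc = [:- b, 1:] * ([:- b, 1:] * (h2 * g2))" using h1 by (simp only: mult.assoc)
    then have "poly (pderiv gc) b = 0" by (simp only: pderiv_mult) simp
    then show False using simple by (simp add: cpoly_pderiv gc_def)
  qed
  then obtain c where "h1 = [:c:]" by (auto elim: degree_eq_zeroE)
  then have "h = [:- b, 1:]" using h(2) h1 by (cases "c = 0") auto
  then have "coeff h 0 = - b" by simp
  then have "0 - - b \<in> Q_adj t" using h(1) Q0 Q_adj_closed(4) unfolding P_def K_def by (metis mem_Collect_eq)
  then have b: "b \<in> Q_adj t" by simp
  have "t - of_rat r * b \<in> Q_adj t" by (intro Q_adj_closed b)
  then have "a \<in> Q_adj t" by (simp add: t_def)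
  then show ?thesis using b alg_t by blast
qed

lemma primitive_element:
  assumes "\<And>i. i < (n::nat) \<Longrightarrow> algebraic_Q (x i)"
  shows "\<exists>t. algebraic_Q t \<and> (\<forall>i<n. x i \<in> Q_adj t)"
  using assms
proof (induction n)
  case 0
  have "cpoly [:0, 1:] 0 = 0" by (simp add: cpoly_simps cpoly_pCons)
  then show ?case by (auto simp: algebraic_Q_def intro!: exI[of _ 0] exI[of _ "[:0, 1:]"])
next
  case (Suc n)
  then obtain t where t: "algebraic_Q t" "\<forall>i<n. x i \<in> Q_adj t" by auto
  obtain s where s: "algebraic_Q s" "t \<in> Q_adj s" "x n \<in> Q_adj s"
    using primitive_element_two[OF t(1), of "x n"] Suc.prems by blast
  have "\<forall>i<Suc n. x i \<in> Q_adj s"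
    using t(2) s(3) Q_adj_trans[OF s(2)] by (auto simp: less_Suc_eq)
  then show ?case using s(1) by blast
qed

section \<open>Parametrized sets and their unions\<close>

definition param_set :: "nat \<Rightarrow> rat poly \<Rightarrow> (nat \<Rightarrow> rat poly) \<Rightarrow> (nat \<Rightarrow> complex) set" where
  "param_set n q h = {(\<lambda>i. if i < n then cpoly (h i) t else 0) | t. cpoly q t = 0}"

lemma is_rat_param_param_set:
  "is_rat_param n (q, 1, map h [0..<n]) (param_set n q h)"
  by (auto simp: is_rat_param_def param_set_def cpoly_simps fun_eq_iff intro!: exI)

text \<open>A shift of the parameter makes the two defining polynomials coprime, and the coordinate
  polynomials are glued by the Chinese remainder theorem.\<close>
lemma param_set_union:
  assumes "q1 \<noteq> 0" "q2 \<noteq> 0"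
  shows "\<exists>q h. q \<noteq> 0 \<and> param_set n q h = param_set n q1 h1 \<union> param_set n q2 h2"
proof -
  \<comment> \<open>Only a shift by a difference of roots would give the two polynomials a common
    root; every other rational shift works.\<close>
  define bad where "bad = (\<lambda>(s, t). t - s) ` ({s. cpoly q1 s = 0} \<times> {t. cpoly q2 t = 0})"
  have "finite bad" unfolding bad_def using finite_cpoly_roots assms by blast
  moreover have "infinite (range (of_rat :: rat \<Rightarrow> complex))"
    by (simp add: finite_image_iff inj_on_def infinite_UNIV_char_0)
  ultimately obtain r :: rat where r: "of_rat r \<notin> bad"
    by (metis finite_subset rangeE subsetI)
  define sh where "sh = [:r, 1:]"
  have sh: "cpoly sh t = of_rat r + t" for t by (simp add: sh_def cpoly_simps cpoly_pCons)
  define q2' where "q2' = pcompose q2 sh"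
  define h2' where "h2' i = pcompose (h2 i) sh" for i
  have q2': "q2' \<noteq> 0"
    using assms(2) by (simp add: q2'_def sh_def pcompose_eq_0_iff)
  have disj: "\<not> (cpoly q1 t = 0 \<and> cpoly q2' t = 0)" for t
  proof
    assume "cpoly q1 t = 0 \<and> cpoly q2' t = 0"
    then have "cpoly q1 t = 0" "cpoly q2 (of_rat r + t) = 0" by (auto simp: q2'_def cpoly_pcompose sh)
    then have "of_rat r + t - t \<in> bad" unfolding bad_def by (intro image_eqI[of _ _ "(t, of_rat r + t)"]) auto
    then show False using r by simp
  qed
  have "coprime q1 q2'"
  proof (rule ccontr)
    assume "\<not> coprime q1 q2'"
    then have nu: "\<not> is_unit (gcd q1 q2')" using gcd_eq_1_imp_coprime[of q1 q2'] by auto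
    have "gcd q1 q2' \<noteq> 0" using assms by simp
    with nu have "degree (gcd q1 q2') \<noteq> 0" using is_unit_iff_degree by blast
    then have "degree (map_poly complex_of_rat (gcd q1 q2')) \<noteq> 0"
      by (simp add: degree_map_poly)
    then obtain t where "cpoly (gcd q1 q2') t = 0"
      unfolding cpoly_def
      using fundamental_theorem_of_algebra[of "map_poly complex_of_rat (gcd q1 q2')"]
        constant_degree[of "map_poly complex_of_rat (gcd q1 q2')"] by auto
    moreover obtain a b where "q1 = gcd q1 q2' * a" "q2' = gcd q1 q2' * b"
      by (meson dvdE gcd_dvd1 gcd_dvd2)
    ultimately have "cpoly q1 t = 0 \<and> cpoly q2' t = 0" by (metis cpoly_simps(4) mult_zero_left)
    then show False using disj by blast
  qed
  then obtain u v where uv: "u * q1 + v * q2' = 1"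
    using bezout_coefficients_fst_snd[of q1 q2'] coprime_imp_gcd_eq_1 by metis
  have uvc: "cpoly u t * cpoly q1 t + cpoly v t * cpoly q2' t = 1" for t
    using arg_cong[OF uv, of "\<lambda>p. cpoly p t"] by (simp add: cpoly_simps)
  \<comment> \<open>By Bezout \<open>v * q2'\<close> is 1 on the roots of \<open>q1\<close> and 0 on
    those of \<open>q2'\<close>, and \<open>u * q1\<close> the other way round.\<close>
  define h where "h i = h2' i * (u * q1) + h1 i * (v * q2')" for i
  have h1: "cpoly (h i) t = cpoly (h1 i) t" if "cpoly q1 t = 0" for i t
    using uvc[of t] that by (simp add: h_def cpoly_simps)
  have h2: "cpoly (h i) t = cpoly (h2' i) t" if "cpoly q2' t = 0" for i t
    using uvc[of t] that by (simp add: h_def cpoly_simps)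
  have eq2: "param_set n q2' h2' = param_set n q2 h2"
  proof
    show "param_set n q2' h2' \<subseteq> param_set n q2 h2"
      by (auto simp: param_set_def q2'_def h2'_def cpoly_pcompose sh cong: if_cong)
    show "param_set n q2 h2 \<subseteq> param_set n q2' h2'"
    proof
      fix y assume "y \<in> param_set n q2 h2"
      then obtain t where "cpoly q2 t = 0" "y = (\<lambda>i. if i < n then cpoly (h2 i) t else 0)"
        by (auto simp: param_set_def)
      then show "y \<in> param_set n q2' h2'"
        by (auto simp: param_set_def q2'_def h2'_def cpoly_pcompose sh cong: if_cong intro!: exI[of _ "t - of_rat r"])
    qed
  qed
  have cong: "(\<lambda>i. if i < n then cpoly (h i) t else 0) = (\<lambda>i. if i < n then cpoly (h1 i) t else 0)"
    if "cpoly q1 t = 0" for t using h1[OF that] by auto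
  have cong2: "(\<lambda>i. if i < n then cpoly (h i) t else 0) = (\<lambda>i. if i < n then cpoly (h2' i) t else 0)"
    if "cpoly q2' t = 0" for t using h2[OF that] by auto
  have ps: "param_set n q h = (\<lambda>t i. if i < n then cpoly (h i) t else 0) ` {t. cpoly q t = 0}" for q h
    by (auto simp: param_set_def)
  have "{t. cpoly (q1 * q2') t = 0} = {t. cpoly q1 t = 0} \<union> {t. cpoly q2' t = 0}"
    by (auto simp: cpoly_simps)
  then have "param_set n (q1 * q2') h = param_set n q1 h1 \<union> param_set n q2' h2'"
    unfolding ps by (simp only: image_Un) (intro arg_cong2[of _ _ _ _ "(\<union>)"] image_cong refl; simp only: mem_Collect_eq cong cong2)
  then show ?thesis using eq2 assms(1) q2' by (intro exI[of _ "q1 * q2'"] exI[of _ h]) auto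
qed

lemma param_set_finite_union:
  assumes "finite S" "\<And>s. s \<in> S \<Longrightarrow> q s \<noteq> 0"
  shows "\<exists>p h'. p \<noteq> 0 \<and> param_set n p h' = (\<Union>s\<in>S. param_set n (q s) (h s))"
  using assms
proof (induction S)
  case empty
  \<comment> \<open>The constant 1 has no roots, so it parametrizes the empty set.\<close>
  show ?case by (intro exI[of _ 1] exI[of _ "\<lambda>_. 0"]) (simp add: param_set_def cpoly_simps)
next
  case (insert s S)
  then obtain p h' where "p \<noteq> 0" "param_set n p h' = (\<Union>s\<in>S. param_set n (q s) (h s))" by auto
  then show ?case using param_set_union[of p "q s" n h' "h s"] insert.prems by (auto simp: Un_commute)
qed

text \<open>The parametrized set consists of the conjugates of \<open>s\<close>: a primitive element
  runs through the roots of its minimal polynomial \<open>q\<close>. A rational equation at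
  \<open>s\<close> becomes a polynomial in the parameter divisible by \<open>q\<close>, so it holds
  at every conjugate.\<close>

lemma conjugates_param:
  assumes "\<And>i. i < n \<Longrightarrow> algebraic_Q (s i)" "\<And>i. i \<ge> n \<Longrightarrow> s i = 0"
  shows "\<exists>q h. q \<noteq> 0 \<and> s \<in> param_set n q h \<and>
    (\<forall>f. polyfun \<rat> {..<n} f \<longrightarrow> f s = 0 \<longrightarrow> (\<forall>y\<in>param_set n q h. f y = 0))"
proof -
  obtain t where t: "algebraic_Q t" "\<forall>i<n. s i \<in> Q_adj t" using primitive_element assms(1) by blast
  obtain q where q: "q \<noteq> 0" "cpoly q t = 0" "\<And>p. cpoly p t = 0 \<Longrightarrow> q dvd p"
    using minimal_poly[OF t(1)] by blast
  have "\<forall>i. \<exists>p. i < n \<longrightarrow> s i = cpoly p t" using t(2) by (auto simp: Q_adj_def)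
  then obtain h where h: "\<And>i. i < n \<Longrightarrow> s i = cpoly (h i) t" by metis
  have "s = (\<lambda>i. if i < n then cpoly (h i) t else 0)" using h assms(2) by auto
  then have "s \<in> param_set n q h" using q(2) by (auto simp: param_set_def)
  moreover have "f y = 0" if f: "polyfun \<rat> {..<n} f" "f s = 0" and y: "y \<in> param_set n q h" for f y
  proof -
    obtain p where p: "\<And>u. f (\<lambda>v. cpoly (h v) u) = cpoly p u" using polyfun_Rats_cpoly[OF f(1)] by blast
    have "f s = f (\<lambda>v. cpoly (h v) t)" by (rule polyfun_cong_vars[OF f(1)]) (simp add: h)
    then have "q dvd p" using f(2) p q(3) by simp
    obtain u where u: "cpoly q u = 0" "y = (\<lambda>i. if i < n then cpoly (h i) u else 0)"
      using y by (auto simp: param_set_def)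
    have "f y = f (\<lambda>v. cpoly (h v) u)" by (rule polyfun_cong_vars[OF f(1)]) (simp add: u)
    also have "\<dots> = 0" using p \<open>q dvd p\<close> u(1) by (auto elim!: dvdE simp: cpoly_simps)
    finally show ?thesis .
  qed
  ultimately show ?thesis using q(1) by blast
qed

text \<open>By \<open>closed\<close>, \<open>S\<close> contains with a point everything that
  satisfies the same rational equations, in particular its conjugates. So \<open>S\<close> is the
  union of the conjugacy classes of its finitely many points.\<close>

theorem ex_rat_param:
  assumes "finite S" "\<And>s i. s \<in> S \<Longrightarrow> i < n \<Longrightarrow> algebraic_Q (s i)" "\<And>s i. s \<in> S \<Longrightarrow> i \<ge> n \<Longrightarrow> s i = 0"
    and closed: "\<And>s y. s \<in> S \<Longrightarrow> (\<And>i. i \<ge> n \<Longrightarrow> y i = 0) \<Longrightarrow>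
      (\<And>f. polyfun \<rat> {..<n} f \<Longrightarrow> f s = 0 \<Longrightarrow> f y = 0) \<Longrightarrow> y \<in> S"
  shows "\<exists>Q. is_rat_param n Q S"
proof -
  have "\<forall>s\<in>S. \<exists>q h. q \<noteq> 0 \<and> s \<in> param_set n q h \<and>
    (\<forall>f. polyfun \<rat> {..<n} f \<longrightarrow> f s = 0 \<longrightarrow> (\<forall>y\<in>param_set n q h. f y = 0))"
    using conjugates_param assms(2,3) by blast
  then obtain q h where qh: "\<And>s. s \<in> S \<Longrightarrow> q s \<noteq> 0" "\<And>s. s \<in> S \<Longrightarrow> s \<in> param_set n (q s) (h s)"
    "\<And>s f y. s \<in> S \<Longrightarrow> polyfun \<rat> {..<n} f \<Longrightarrow> f s = 0 \<Longrightarrow> y \<in> param_set n (q s) (h s) \<Longrightarrow> f y = 0"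
    by metis
  have "param_set n (q s) (h s) \<subseteq> S" if "s \<in> S" for s
  proof
    fix y assume y: "y \<in> param_set n (q s) (h s)"
    show "y \<in> S"
    proof (rule closed[OF that])
      show "f y = 0" if "polyfun \<rat> {..<n} f" "f s = 0" for f
        using qh(3)[OF \<open>s \<in> S\<close> that y] .
    qed (use y in \<open>auto simp: param_set_def\<close>)
  qed
  then have "S = (\<Union>s\<in>S. param_set n (q s) (h s))" using qh(2) by blast
  moreover obtain p h' where "param_set n p h' = (\<Union>s\<in>S. param_set n (q s) (h s))"
    using param_set_finite_union[where n = n and h = h and q = q, OF assms(1) qh(1)] by blast
  ultimately have "is_rat_param n (p, 1, map h' [0..<n]) S"
    using is_rat_param_param_set[of n p h'] by simp
  then show ?thesis by blast
qed

subsection \<open>Pairs of symmetric matrices with product zero\<close>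

text \<open>A set of independent rows of maximal size spans the others. \<open>J\<close> serves as
  the index of a chart, and for the matrix of a minimizer its size is the rank.\<close>

lemma row_basis:
  fixes S :: "nat \<Rightarrow> nat \<Rightarrow> 'a::field"
  obtains J B where "J \<subseteq> {..<m}"
    "\<forall>a. (\<forall>k<m. (\<Sum>j\<in>J. a j * S j k) = 0) \<longrightarrow> (\<forall>j\<in>J. a j = 0)"
    "\<forall>i<m. i \<notin> J \<longrightarrow> (\<forall>k<m. S i k = (\<Sum>j\<in>J. B i j * S j k))"
proof -
  define indep where "indep J \<longleftrightarrow> J \<subseteq> {..<m} \<and> (\<forall>a. (\<forall>k<m. (\<Sum>j\<in>J. a j * S j k) = 0) \<longrightarrow> (\<forall>j\<in>J. a j = 0))" for J
  have "indep {}" by (simp add: indep_def)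
  moreover have bnd: "card J \<le> m" if "indep J" for J
    using that card_mono[of "{..<m}" J] by (auto simp: indep_def)
  ultimately have "\<exists>J. indep J \<and> (\<forall>J'. indep J' \<longrightarrow> card J' \<le> card J)"
    by (intro ex_has_greatest_nat[of indep "{}" card "Suc m"]) (auto simp: less_Suc_eq_le)
  then obtain J where J: "indep J" "\<And>J'. indep J' \<Longrightarrow> card J' \<le> card J" by blast
  have Jsub: "J \<subseteq> {..<m}" and fin: "finite J" using J(1) finite_subset by (auto simp: indep_def)
  have "\<exists>b. \<forall>k<m. S i k = (\<Sum>j\<in>J. b j * S j k)" if i: "i < m" "i \<notin> J" for i
  proof -
    have "\<not> indep (insert i J)" using J(2)[of "insert i J"] i fin by auto
    then obtain a j where a: "\<forall>k<m. (\<Sum>j\<in>insert i J. a j * S j k) = 0" "j \<in> insert i J" "a j \<noteq> 0"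
      using i Jsub by (auto simp: indep_def)
    then have eq: "a i * S i k + (\<Sum>j\<in>J. a j * S j k) = 0" if "k < m" for k
      using that i fin by auto
    have ai: "a i \<noteq> 0"
    proof
      assume "a i = 0"
      then have "\<forall>k<m. (\<Sum>j\<in>J. a j * S j k) = 0" using eq by simp
      then have "\<forall>j\<in>J. a j = 0" using J(1) unfolding indep_def by blast
      then show False using a(2,3) \<open>a i = 0\<close> by auto
    qed
    have "S i k = (\<Sum>j\<in>J. (- a j / a i) * S j k)" if "k < m" for k
    proof -
      have "(\<Sum>j\<in>J. (- a j / a i) * S j k) = - (\<Sum>j\<in>J. a j * S j k) / a i"
        by (simp add: sum_negf sum_divide_distrib)
      also have "(\<Sum>j\<in>J. a j * S j k) = - (a i * S i k)" using eq[OF that] by (simp add: eq_neg_iff_add_eq_0 add.commute)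
      also have "- (- (a i * S i k)) / a i = S i k" using ai by simp
      finally show ?thesis by simp
    qed
    then show ?thesis by (intro exI[of _ "\<lambda>j. - a j / a i"]) blast
  qed
  then obtain B where B: "\<And>i k. i < m \<Longrightarrow> i \<notin> J \<Longrightarrow> k < m \<Longrightarrow> S i k = (\<Sum>j\<in>J. B i j * S j k)" by metis
  show ?thesis
  proof (rule that[OF Jsub])
    show "\<forall>a. (\<forall>k<m. (\<Sum>j\<in>J. a j * S j k) = 0) \<longrightarrow> (\<forall>j\<in>J. a j = 0)"
      using J(1) unfolding indep_def by (rule conjunct2)
    show "\<forall>i<m. i \<notin> J \<longrightarrow> (\<forall>k<m. S i k = (\<Sum>j\<in>J. B i j * S j k))"
      by (intro allI impI B)
  qed
qed

text \<open>Only the slots on and above the diagonal are read, so a symmetric matrix costs m(m+1)/2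
  parameters, the exact dimension on which the counts below rely.\<close>

definition sym_entry :: "(nat \<times> nat \<Rightarrow> 'a) \<Rightarrow> nat \<Rightarrow> nat \<Rightarrow> 'a" where
  "sym_entry \<theta> i j = \<theta> (min i j, max i j)"

definition range_coef :: "nat set \<Rightarrow> (nat \<times> nat \<Rightarrow> 'a::field) \<Rightarrow> nat \<Rightarrow> nat \<Rightarrow> 'a" where
  "range_coef J \<theta> i j = (if i \<in> J then (if i = j then 1 else 0) else sym_entry \<theta> i j)"

definition ker_coef :: "nat set \<Rightarrow> (nat \<times> nat \<Rightarrow> 'a::field) \<Rightarrow> nat \<Rightarrow> nat \<Rightarrow> 'a" where
  "ker_coef J \<theta> i k = (if k \<in> J then - sym_entry \<theta> i k else (if i = k then 1 else 0))"

text \<open>A chart of \<open>{(S, M). S M = 0}\<close>: in block form with respect to \<open>J\<close> and its complement,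
  \<open>S = [I; B] T [I; B]\<^sup>T\<close> and \<open>M = [-B\<^sup>T; I] R [-B\<^sup>T; I]\<^sup>T\<close>, where the symmetric matrix
  \<open>\<theta> = [T, B\<^sup>T; B, R]\<close> is arbitrary.\<close>
definition chart_S :: "nat set \<Rightarrow> (nat \<times> nat \<Rightarrow> 'a::field) \<Rightarrow> nat \<Rightarrow> nat \<Rightarrow> 'a" where
  "chart_S J \<theta> i k = (\<Sum>j\<in>J. \<Sum>j'\<in>J. range_coef J \<theta> i j * sym_entry \<theta> j j' * range_coef J \<theta> k j')"

definition chart_M :: "nat \<Rightarrow> nat set \<Rightarrow> (nat \<times> nat \<Rightarrow> 'a::field) \<Rightarrow> nat \<Rightarrow> nat \<Rightarrow> 'a" where
  "chart_M m J \<theta> k l = (\<Sum>i\<in>{..<m} - J. \<Sum>i'\<in>{..<m} - J. ker_coef J \<theta> i k * sym_entry \<theta> i i' * ker_coef J \<theta> i' l)"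

lemma sym_entry_commute: "sym_entry \<theta> i j = sym_entry \<theta> j i"
  by (simp add: sym_entry_def min.commute max.commute)

lemma chart_M_block:
  assumes "a < m" "b < m" "a \<notin> J" "b \<notin> J"
  shows "chart_M m J \<theta> a b = sym_entry \<theta> a b"
proof -
  have "chart_M m J \<theta> a b = (\<Sum>i\<in>{..<m} - J. if i = a then (\<Sum>i'\<in>{..<m} - J. if i' = b then sym_entry \<theta> a b else 0) else 0)"
    unfolding chart_M_def using assms by (intro sum.cong refl) (auto simp: ker_coef_def if_distrib cong: if_cong)
  then show ?thesis using assms by (simp add: sum.delta)
qed

lemma sum_split:
  assumes "J \<subseteq> {..<m::nat}"
  shows "(\<Sum>k<m. f k) = (\<Sum>k\<in>J. f k) + (\<Sum>k\<in>{..<m} - J. f k :: 'a::comm_monoid_add)"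
  using sum.subset_diff[OF assms, of f] by (simp add: add.commute)

text \<open>Expressing all rows through those in \<open>J\<close>, and by symmetry all columns,
  gives S = C T C^T. Independence of the rows turns S M = 0 into C^T M = 0, which expresses the rows
  of M in \<open>J\<close> through the others; symmetry of M gives the two-sided form.\<close>

lemma sym_pair_chart:
  fixes S M :: "nat \<Rightarrow> nat \<Rightarrow> 'a::field"
  assumes symS: "\<And>i k. i < m \<Longrightarrow> k < m \<Longrightarrow> S i k = S k i"
    and symM: "\<And>i k. i < m \<Longrightarrow> k < m \<Longrightarrow> M i k = M k i"
    and SM: "\<And>i l. i < m \<Longrightarrow> l < m \<Longrightarrow> (\<Sum>k<m. S i k * M k l) = 0"
  shows "\<exists>J\<subseteq>{..<m}. \<exists>\<theta>. \<forall>i<m. \<forall>k<m. S i k = chart_S J \<theta> i k \<and> M i k = chart_M m J \<theta> i k"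
proof -
  obtain J B where J: "J \<subseteq> {..<m}"
    and indep: "\<forall>a. (\<forall>k<m. (\<Sum>j\<in>J. a j * S j k) = 0) \<longrightarrow> (\<forall>j\<in>J. a j = 0)"
    and B: "\<forall>i<m. i \<notin> J \<longrightarrow> (\<forall>k<m. S i k = (\<Sum>j\<in>J. B i j * S j k))"
    by (rule row_basis[of m S])
  have fin: "finite J" using J finite_subset by blast
  define \<theta> where "\<theta> = (\<lambda>(i, j). if i \<in> J then (if j \<in> J then S i j else B j i)
      else (if j \<in> J then B i j else M i j))"
  have eS: "sym_entry \<theta> i j = S i j" if "i \<in> J" "j \<in> J" for i j
    using that J symS by (auto simp: sym_entry_def \<theta>_def min_def max_def)
  have eB: "sym_entry \<theta> i j = B i j" if "i \<notin> J" "j \<in> J" for i j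
    using that by (auto simp: sym_entry_def \<theta>_def min_def max_def)
  have eM: "sym_entry \<theta> i j = M i j" if "i \<notin> J" "j \<notin> J" "i < m" "j < m" for i j
    using that symM by (auto simp: sym_entry_def \<theta>_def min_def max_def)
  let ?C = "range_coef J \<theta>"
  have Crow: "S i k = (\<Sum>j\<in>J. ?C i j * S j k)" if "i < m" "k < m" for i k
  proof (cases "i \<in> J")
    case True
    then have "(\<Sum>j\<in>J. ?C i j * S j k) = (\<Sum>j\<in>J. if i = j then S j k else 0)"
      by (intro sum.cong) (auto simp: range_coef_def)
    then show ?thesis using True fin by (simp add: sum.delta')
  next
    case False
    then have "S i k = (\<Sum>j\<in>J. B i j * S j k)" using B that by blast
    then show ?thesis using False by (simp add: range_coef_def eB)
  qed
  have Ccol: "S j k = (\<Sum>j'\<in>J. S j j' * ?C k j')" if "j \<in> J" "k < m" for j k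
  proof -
    have "S j k = S k j" using symS that J by auto
    also have "\<dots> = (\<Sum>j'\<in>J. ?C k j' * S j' j)" using Crow that J by auto
    also have "\<dots> = (\<Sum>j'\<in>J. S j j' * ?C k j')"
      by (intro sum.cong refl) (use symS that J in \<open>auto simp: mult.commute\<close>)
    finally show ?thesis .
  qed
  have S: "S i k = chart_S J \<theta> i k" if "i < m" "k < m" for i k
  proof -
    have "S i k = (\<Sum>j\<in>J. ?C i j * (\<Sum>j'\<in>J. S j j' * ?C k j'))"
      unfolding Crow[OF that] by (intro sum.cong refl) (simp add: Ccol that)
    then show ?thesis by (simp add: chart_S_def sum_distrib_left eS mult.assoc)
  qed
  have N0: "(\<Sum>k<m. ?C k j * M k l) = 0" if "j \<in> J" "l < m" for j l
  proof -
    \<comment> \<open>This is column \<open>l\<close> of C^T M. The block of S on \<open>J\<close>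
      kills it, and since the columns in \<open>J\<close> span all columns, it is a relation among
      the independent rows, hence zero.\<close>
    define N where "N j = (\<Sum>k<m. ?C k j * M k l)" for j
    have SN: "(\<Sum>j'\<in>J. S j j' * N j') = 0" if "j \<in> J" for j
    proof -
      have "(\<Sum>j'\<in>J. S j j' * N j') = (\<Sum>j'\<in>J. \<Sum>k<m. S j j' * ?C k j' * M k l)"
        by (simp add: N_def sum_distrib_left mult.assoc)
      also have "\<dots> = (\<Sum>k<m. (\<Sum>j'\<in>J. S j j' * ?C k j') * M k l)"
        by (subst sum.swap) (simp add: sum_distrib_right)
      also have "\<dots> = (\<Sum>k<m. S j k * M k l)" by (intro sum.cong refl) (simp add: Ccol that)
      also have "\<dots> = 0" using SM that J \<open>l < m\<close> by auto
      finally show ?thesis .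
    qed
    have "(\<Sum>j\<in>J. N j * S j k) = 0" if "k < m" for k
    proof -
      have "(\<Sum>j\<in>J. N j * S j k) = (\<Sum>j\<in>J. \<Sum>j'\<in>J. ?C k j' * (S j' j * N j))"
      proof (rule sum.cong[OF refl])
        fix j assume j: "j \<in> J"
        have "S j j' = S j' j" if "j' \<in> J" for j' using symS j that J by auto
        then show "N j * S j k = (\<Sum>j'\<in>J. ?C k j' * (S j' j * N j))"
          unfolding Ccol[OF j that] sum_distrib_left by (intro sum.cong refl) (simp add: mult_ac)
      qed
      also have "\<dots> = (\<Sum>j'\<in>J. ?C k j' * (\<Sum>j\<in>J. S j' j * N j))"
        by (subst sum.swap) (simp add: sum_distrib_left)
      also have "\<dots> = 0" by (simp add: SN)
      finally show ?thesis .
    qed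
    then have "\<forall>j\<in>J. N j = 0" using indep by blast
    then show ?thesis using that by (simp add: N_def)
  qed
  have Mrow: "M k l = (\<Sum>i\<in>{..<m} - J. ker_coef J \<theta> i k * M i l)" if "k < m" "l < m" for k l
  proof (cases "k \<in> J")
    case True
    have "(\<Sum>i\<in>J. ?C i k * M i l) = (\<Sum>i\<in>J. if i = k then M i l else 0)"
      by (intro sum.cong) (auto simp: range_coef_def)
    also have "\<dots> = M k l" using True fin by (simp add: sum.delta)
    finally have "M k l + (\<Sum>i\<in>{..<m} - J. ?C i k * M i l) = 0"
      using N0[OF True that(2)] by (simp add: sum_split[OF J])
    then have "M k l = - (\<Sum>i\<in>{..<m} - J. ?C i k * M i l)" by (simp add: eq_neg_iff_add_eq_0)
    also have "\<dots> = (\<Sum>i\<in>{..<m} - J. ker_coef J \<theta> i k * M i l)"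
      unfolding sum_negf[symmetric] by (intro sum.cong refl) (use True in \<open>auto simp: ker_coef_def range_coef_def\<close>)
    finally show ?thesis .
  next
    case False
    then have "(\<Sum>i\<in>{..<m} - J. ker_coef J \<theta> i k * M i l) = (\<Sum>i\<in>{..<m} - J. if i = k then M i l else 0)"
      by (intro sum.cong) (auto simp: ker_coef_def)
    then show ?thesis using False that by (simp add: sum.delta)
  qed
  have M: "M k l = chart_M m J \<theta> k l" if "k < m" "l < m" for k l
  proof -
    have "M i l = (\<Sum>i'\<in>{..<m} - J. M i i' * ker_coef J \<theta> i' l)" if "i < m" for i
    proof -
      have "M i l = M l i" using symM that \<open>l < m\<close> by auto
      also have "\<dots> = (\<Sum>i'\<in>{..<m} - J. ker_coef J \<theta> i' l * M i' i)" by (rule Mrow) (use that \<open>l < m\<close> in auto)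
      also have "\<dots> = (\<Sum>i'\<in>{..<m} - J. M i i' * ker_coef J \<theta> i' l)"
        by (intro sum.cong refl) (use symM that in \<open>auto simp: mult.commute\<close>)
      finally show ?thesis .
    qed
    then have "M k l = (\<Sum>i\<in>{..<m} - J. ker_coef J \<theta> i k * (\<Sum>i'\<in>{..<m} - J. M i i' * ker_coef J \<theta> i' l))"
      unfolding Mrow[OF that] by (intro sum.cong refl) auto
    then show ?thesis by (simp add: chart_M_def sum_distrib_left eM mult.assoc)
  qed
  show ?thesis using J S M by blast
qed

text \<open>The block outside \<open>J\<close> enters \<open>chart_M\<close> linearly and
  \<open>chart_S\<close> not at all. So M can be rescaled with S fixed, which permits the
  normalization \<open>M a b = 1\<close>.\<close>

lemma chart_M_scale:
  assumes "c \<noteq> 0"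
  shows "\<exists>\<theta>'. (\<forall>i k. chart_S J \<theta>' i k = chart_S J \<theta> i k) \<and> (\<forall>k l. chart_M m J \<theta>' k l = c * chart_M m J \<theta> k l) \<and>
    (\<forall>a b. a \<notin> J \<longrightarrow> b \<notin> J \<longrightarrow> sym_entry \<theta>' a b = c * sym_entry \<theta> a b)"
proof -
  define \<theta>' where "\<theta>' = (\<lambda>(i, j). if i \<notin> J \<and> j \<notin> J then c * \<theta> (i, j) else \<theta> (i, j))"
  have e: "sym_entry \<theta>' a b = (if a \<notin> J \<and> b \<notin> J then c * sym_entry \<theta> a b else sym_entry \<theta> a b)" for a b
    by (auto simp: sym_entry_def \<theta>'_def min_def max_def)
  have "chart_S J \<theta>' i k = chart_S J \<theta> i k" for i k
    unfolding chart_S_def by (intro sum.cong refl) (auto simp: range_coef_def e)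
  moreover have "chart_M m J \<theta>' k l = c * chart_M m J \<theta> k l" for k l
    unfolding chart_M_def sum_distrib_left
    by (intro sum.cong refl) (auto simp: ker_coef_def e)
  ultimately show ?thesis using e by (intro exI[of _ \<theta>']) auto
qed

subsection \<open>Generic pencils\<close>

definition lin_mat :: "nat \<Rightarrow> (nat \<times> nat \<times> nat \<Rightarrow> 'a::comm_ring_1) \<Rightarrow> (nat \<Rightarrow> 'a) \<Rightarrow> nat \<Rightarrow> nat \<Rightarrow> 'a" where
  "lin_mat n A x i j = A (0,i,j) + (\<Sum>l<n. x l * A (Suc l,i,j))"

definition annihilator :: "nat \<Rightarrow> nat \<Rightarrow> (nat \<times> nat \<times> nat \<Rightarrow> complex) \<Rightarrow> (nat \<Rightarrow> complex) \<Rightarrow> (nat \<Rightarrow> nat \<Rightarrow> complex) \<Rightarrow> bool" where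
  "annihilator m n A x M \<longleftrightarrow> (\<forall>i<m. \<forall>k<m. M i k = M k i) \<and>
     (\<forall>i<m. \<forall>l<m. (\<Sum>k<m. lin_mat n A x i k * M k l) = 0)"

text \<open>The symmetric M with A(x) M = 0 form the normal space, at A(x), of the matrices of the
  same rank. A nonzero one orthogonal to all \<open>A_l\<close> means that the pencil meets this
  stratum non-transversally.\<close>

definition degenerate :: "nat \<Rightarrow> nat \<Rightarrow> (nat \<times> nat \<times> nat \<Rightarrow> complex) \<Rightarrow> bool" where
  "degenerate m n A \<longleftrightarrow> (\<exists>x M. annihilator m n A x M \<and> (\<exists>i<m. \<exists>j<m. M i j \<noteq> 0) \<and>
     (\<forall>l<n. (\<Sum>i<m. \<Sum>j<m. A (Suc l,i,j) * M i j) = 0))"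

text \<open>Complementarity and stationarity of a semidefinite program with dual matrix M, over the
  complex numbers and without positivity.\<close>

definition kkt :: "nat \<Rightarrow> nat \<Rightarrow> (nat \<times> nat \<times> nat \<Rightarrow> complex) \<Rightarrow> (nat \<Rightarrow> complex) \<Rightarrow> (nat \<Rightarrow> complex) \<Rightarrow> bool" where
  "kkt m n A x c \<longleftrightarrow> (\<exists>M. annihilator m n A x M \<and>
     (\<forall>l<n. (\<Sum>i<m. \<Sum>j<m. A (Suc l,i,j) * M i j) = c l))"

definition symmetric_pencil :: "(nat \<times> nat \<times> nat \<Rightarrow> 'a) \<Rightarrow> bool" where
  "symmetric_pencil A \<longleftrightarrow> (\<forall>k i j. A (k,i,j) = A (k,j,i))"

definition tri :: "nat \<Rightarrow> (nat \<times> nat) set" where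
  "tri m = {(i, j). i \<le> j \<and> j < m}"

definition tri_vars :: "nat \<Rightarrow> nat \<Rightarrow> (nat \<times> nat \<times> nat) set" where
  "tri_vars m n = {(k, i, j). k \<le> n \<and> i \<le> j \<and> j < m}"

lemma finite_tri: "finite (tri m)"
  by (rule finite_subset[of _ "{..<m} \<times> {..<m}"]) (auto simp: tri_def)

lemma finite_tri_vars: "finite (tri_vars m n)"
  by (rule finite_subset[of _ "{..n} \<times> {..<m} \<times> {..<m}"]) (auto simp: tri_vars_def)

lemma sum_sym_tri:
  fixes f :: "nat \<Rightarrow> nat \<Rightarrow> 'a::comm_ring_1"
  assumes "\<And>i j. i < m \<Longrightarrow> j < m \<Longrightarrow> f i j = f j i"
  shows "(\<Sum>i<m. \<Sum>j<m. f i j) = (\<Sum>(i,j)\<in>tri m. (if i = j then 1 else 2) * f i j)"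
proof -
  let ?D = "{(i, j). i = j \<and> j < m}" and ?U = "{(i, j). i < j \<and> j < m}"
  have fin: "finite ?D" "finite ?U"
    by (rule finite_subset[of _ "{..<m} \<times> {..<m}"]; auto)+
  have sq: "{..<m} \<times> {..<m} = (?D \<union> ?U) \<union> prod.swap ` ?U"
    by (auto simp: image_iff)
  have "(\<Sum>i<m. \<Sum>j<m. f i j) = (\<Sum>(i,j)\<in>{..<m} \<times> {..<m}. f i j)"
    by (simp add: sum.cartesian_product)
  also have "\<dots> = (\<Sum>(i,j)\<in>?D. f i j) + (\<Sum>(i,j)\<in>?U. f i j) + (\<Sum>(i,j)\<in>prod.swap ` ?U. f i j)"
    unfolding sq using fin by (subst sum.union_disjoint, auto)+
  also have "(\<Sum>(i,j)\<in>prod.swap ` ?U. f i j) = (\<Sum>(i,j)\<in>?U. f i j)"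
    by (subst sum.reindex) (auto intro!: sum.cong assms)
  also have "(\<Sum>(i,j)\<in>?D. f i j) + (\<Sum>(i,j)\<in>?U. f i j) + (\<Sum>(i,j)\<in>?U. f i j) =
     (\<Sum>(i,j)\<in>?D. (if i = j then 1 else 2) * f i j) + (\<Sum>(i,j)\<in>?U. (if i = j then 1 else 2) * f i j)"
  proof -
    have "(\<Sum>(i,j)\<in>?D. (if i = j then 1 else 2) * f i j) = (\<Sum>(i,j)\<in>?D. f i j)"
      by (rule sum.cong) auto
    moreover have "(\<Sum>(i,j)\<in>?U. (if i = j then 1 else 2) * f i j) = (\<Sum>(i,j)\<in>?U. f i j) + (\<Sum>(i,j)\<in>?U. f i j)"
      unfolding sum.distrib[symmetric] by (rule sum.cong) auto
    ultimately show ?thesis by simp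
  qed
  also have "\<dots> = (\<Sum>(i,j)\<in>?D \<union> ?U. (if i = j then 1 else 2) * f i j)"
    using fin by (subst sum.union_disjoint) auto
  also have "?D \<union> ?U = tri m" by (auto simp: tri_def)
  finally show ?thesis .
qed

lemma polyfun_charts:
  assumes "\<And>i j. i \<le> j \<Longrightarrow> j < m \<Longrightarrow> polyfun UNIV Vs (\<lambda>u. \<theta> u (i, j))" "J \<subseteq> {..<m}" "i < m" "k < m"
  shows "polyfun UNIV Vs (\<lambda>u. chart_S J (\<theta> u) i k)" "polyfun UNIV Vs (\<lambda>u. chart_M m J (\<theta> u) i k)"
proof -
  have e: "polyfun UNIV Vs (\<lambda>u. sym_entry (\<theta> u) a b)" if "a < m" "b < m" for a b
    unfolding sym_entry_def by (rule assms(1)) (use that in auto)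
  have e': "polyfun UNIV Vs (\<lambda>u. range_coef J (\<theta> u) a b)" if "a < m" "b < m" for a b
    unfolding range_coef_def by (intro polyfun_intros e that) auto
  have e'': "polyfun UNIV Vs (\<lambda>u. ker_coef J (\<theta> u) a b)" if "a < m" "b < m" for a b
    unfolding ker_coef_def by (intro polyfun_intros e that) auto
  show "polyfun UNIV Vs (\<lambda>u. chart_S J (\<theta> u) i k)"
    unfolding chart_S_def using assms(2-4)
    by (intro polyfun_sum pf_mult e e' UNIV_I) auto
  show "polyfun UNIV Vs (\<lambda>u. chart_M m J (\<theta> u) i k)"
    unfolding chart_M_def using assms(2-4)
    by (intro polyfun_sum pf_mult e e'' UNIV_I) auto
qed

lemma lin_mat_sym: "symmetric_pencil A \<Longrightarrow> lin_mat n A x i j = lin_mat n A x j i"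
  unfolding lin_mat_def symmetric_pencil_def by simp

lemma annihilator_chart:
  assumes "symmetric_pencil A" "annihilator m n A x M"
  shows "\<exists>J\<subseteq>{..<m}. \<exists>\<theta>. \<forall>i<m. \<forall>k<m. lin_mat n A x i k = chart_S J \<theta> i k \<and> M i k = chart_M m J \<theta> i k"
  by (rule sym_pair_chart) (use assms lin_mat_sym in \<open>auto simp: annihilator_def\<close>)

text \<open>The degenerate pencils are parametrized by one coordinate less than the dimension of the
  space of pencils: normalizing \<open>M a b = 1\<close>, the conditions \<open>\<langle>A\<^sub>l, M\<rangle> = 0\<close> determine the entries
  \<open>(a, b)\<close> of the \<open>A\<^sub>l\<close> (whose slots hold \<open>x\<^sub>l\<close> instead), and \<open>A\<^sub>0 = A(x) - \<Sum> x\<^sub>l A\<^sub>l\<close>.\<close>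
lemma degenerate_chart_hypersurface:
  assumes J: "J \<subseteq> {..<m}" and ab: "a \<le> b" "b < m"
  shows "\<exists>P. polyfun UNIV (tri_vars m n) P \<and> (\<exists>u. P u \<noteq> 0) \<and>
    (\<forall>A x M \<theta>. symmetric_pencil A \<longrightarrow>
      (\<forall>i<m. \<forall>k<m. lin_mat n A x i k = chart_S J \<theta> i k \<and> M i k = chart_M m J \<theta> i k) \<longrightarrow>
      M a b = 1 \<longrightarrow> \<theta> (a, b) = 1 \<longrightarrow> (\<forall>i<m. \<forall>k<m. M i k = M k i) \<longrightarrow>
      (\<forall>l<n. (\<Sum>i<m. \<Sum>j<m. A (Suc l,i,j) * M i j) = 0) \<longrightarrow> P A = 0)"
proof -
  \<comment> \<open>The missing slot \<open>(0, a, b)\<close> is the entry normalized to 1; this is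
    the one dimension that is lost.\<close>
  let ?Is = "tri_vars m n" and ?Vs = "tri_vars m n - {(0, a, b)}"
  \<comment> \<open>A sum over the full square counts each off-diagonal pair twice. These weights
    appear when the pairing with M, written over the upper triangle, is solved for the entry
    \<open>(a, b)\<close>.\<close>
  define wt :: "nat \<Rightarrow> nat \<Rightarrow> complex" where "wt i j = (if i = j then 1 else 2)" for i j
  define th where "th u = (\<lambda>(i, j). if (i, j) = (a, b) then 1 else u (0::nat, i, j))" for u :: "nat \<times> nat \<times> nat \<Rightarrow> complex"
  define Al where "Al u l i j = (if (i, j) = (a, b)
      then - (1 / wt a b) * (\<Sum>p\<in>tri m - {(a, b)}. wt (fst p) (snd p) * u (Suc l, fst p, snd p) * chart_M m J (th u) (fst p) (snd p))
      else u (Suc l, i, j))" for u l i j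
  define g where "g = (\<lambda>(k, i, j) u. if k = 0 then chart_S J (th u) i j - (\<Sum>l<n. u (Suc l, a, b) * Al u l i j)
      else Al u (k - 1) i j)"
  have pf_th: "polyfun UNIV ?Vs (\<lambda>u. th u (i, j))" if "i \<le> j" "j < m" for i j
    unfolding th_def prod.case by (intro polyfun_intros) (use that in \<open>auto simp: tri_vars_def\<close>)
  have pf_M: "polyfun UNIV ?Vs (\<lambda>u. chart_M m J (th u) (fst p) (snd p))" if "p \<in> tri m" for p
    by (rule polyfun_charts(2)[where \<theta> = th, OF pf_th J]) (use that in \<open>auto simp: tri_def\<close>)
  have pf_A: "polyfun UNIV ?Vs (\<lambda>u. Al u l i j)" if "i \<le> j" "j < m" "l < n" for i j l
    unfolding Al_def
    by (intro polyfun_intros pf_M) (use that in \<open>auto simp: tri_vars_def tri_def\<close>)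
  have pf_x: "polyfun UNIV ?Vs (\<lambda>u. u (Suc l, a, b))" if "l < n" for l
    by (intro polyfun_intros) (use that ab in \<open>auto simp: tri_vars_def\<close>)
  have pf_g: "polyfun UNIV ?Vs (g p)" if p: "p \<in> ?Is" for p
  proof -
    obtain k i j where [simp]: "p = (k, i, j)" by (cases p)
    have ij: "i \<le> j" "j < m" "k \<le> n" using p by (auto simp: tri_vars_def)
    show ?thesis
    proof (cases "k = 0")
      case True
      have "polyfun UNIV ?Vs (\<lambda>u. chart_S J (th u) i j - (\<Sum>l<n. u (Suc l, a, b) * Al u l i j))"
        by (intro polyfun_diff polyfun_sum pf_mult polyfun_charts(1)[where \<theta> = th, OF pf_th J] pf_A pf_x) (use ij in auto)
      then show ?thesis using True by (simp add: g_def)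
    next
      case False
      have "polyfun UNIV ?Vs (\<lambda>u. Al u (k - 1) i j)" by (rule pf_A) (use ij False in auto)
      then show ?thesis using False by (simp add: g_def)
    qed
  qed
  have "card ?Vs < card ?Is"
    by (rule psubset_card_mono[OF finite_tri_vars]) (use ab in \<open>auto simp: tri_vars_def\<close>)
  then obtain P where P: "polyfun UNIV ?Is P" "\<exists>u. P u \<noteq> 0" "\<And>u. P (\<lambda>p. g p u) = 0"
    using algebraic_dependence[where g = g, OF finite_tri_vars _ _ pf_g] finite_tri_vars by blast
  have "P A = 0" if A: "symmetric_pencil A"
    and S: "\<forall>i<m. \<forall>k<m. lin_mat n A x i k = chart_S J \<theta> i k \<and> M i k = chart_M m J \<theta> i k"
    and Mab: "M a b = 1" "\<theta> (a, b) = 1" and symM: "\<forall>i<m. \<forall>k<m. M i k = M k i"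
    and orth: "\<forall>l<n. (\<Sum>i<m. \<Sum>j<m. A (Suc l,i,j) * M i j) = 0" for A x M \<theta>
  proof -
    define u where "u = (\<lambda>(k, i, j). if k = 0 then \<theta> (i, j) else if (i, j) = (a, b) then x (k - 1) else A (k, i, j))"
    have th: "th u = \<theta>" by (auto simp: th_def u_def Mab fun_eq_iff)
    have Al: "Al u l i j = A (Suc l, i, j)" if "i \<le> j" "j < m" "l < n" for l i j
    proof (cases "(i, j) = (a, b)")
      case True
      have ab_tri: "(a, b) \<in> tri m" using ab by (auto simp: tri_def)
      have "0 = (\<Sum>i<m. \<Sum>j<m. A (Suc l,i,j) * M i j)" using orth that by simp
      also have "\<dots> = (\<Sum>(i,j)\<in>tri m. wt i j * (A (Suc l,i,j) * M i j))"
        unfolding wt_def by (rule sum_sym_tri) (use A symM in \<open>auto simp: symmetric_pencil_def\<close>)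
      also have "\<dots> = (\<Sum>p\<in>tri m. wt (fst p) (snd p) * (A (Suc l,fst p,snd p) * M (fst p) (snd p)))"
        by (simp add: case_prod_unfold)
      also have "\<dots> = wt a b * A (Suc l, a, b) + (\<Sum>p\<in>tri m - {(a, b)}. wt (fst p) (snd p) * (A (Suc l,fst p,snd p) * M (fst p) (snd p)))"
        by (subst sum.remove[OF finite_tri ab_tri]) (simp add: Mab)
      also have "(\<Sum>p\<in>tri m - {(a, b)}. wt (fst p) (snd p) * (A (Suc l,fst p,snd p) * M (fst p) (snd p))) =
         (\<Sum>p\<in>tri m - {(a, b)}. wt (fst p) (snd p) * u (Suc l, fst p, snd p) * chart_M m J (th u) (fst p) (snd p))"
      proof (rule sum.cong[OF refl])
        fix p assume "p \<in> tri m - {(a, b)}"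
        then obtain i j where p: "p = (i, j)" "i \<le> j" "j < m" "(i, j) \<noteq> (a, b)" by (auto simp: tri_def)
        have "u (Suc l, i, j) = A (Suc l, i, j)" using p(4) by (auto simp: u_def)
        moreover have "M i j = chart_M m J (th u) i j" using S p unfolding th by simp
        ultimately show "wt (fst p) (snd p) * (A (Suc l,fst p,snd p) * M (fst p) (snd p)) =
            wt (fst p) (snd p) * u (Suc l, fst p, snd p) * chart_M m J (th u) (fst p) (snd p)"
          by (simp add: p(1))
      qed
      finally have "A (Suc l, a, b) = - (1 / wt a b) * (\<Sum>p\<in>tri m - {(a, b)}. wt (fst p) (snd p) * u (Suc l, fst p, snd p) * chart_M m J (th u) (fst p) (snd p))"
        by (simp add: wt_def field_simps eq_neg_iff_add_eq_0 split: if_splits)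
      then show ?thesis using True by (simp add: Al_def)
    next
      case False
      then show ?thesis unfolding Al_def u_def by auto
    qed
    have "P A = P (\<lambda>p. g p u)"
    proof (rule polyfun_cong_vars[OF P(1)])
      fix p assume "p \<in> ?Is"
      then obtain k i j where p: "p = (k, i, j)" "k \<le> n" "i \<le> j" "j < m" by (auto simp: tri_vars_def)
      show "A p = g p u"
      proof (cases "k = 0")
        case True
        have "(\<Sum>l<n. u (Suc l, a, b) * Al u l i j) = (\<Sum>l<n. x l * A (Suc l, i, j))"
          by (rule sum.cong) (use Al p in \<open>auto simp: u_def\<close>)
        moreover have "chart_S J (th u) i j = A (0, i, j) + (\<Sum>l<n. x l * A (Suc l, i, j))"
          using S[rule_format, of i j] p unfolding th lin_mat_def by simp
        ultimately show ?thesis using True p by (simp add: g_def)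
      next
        case False
        then show ?thesis using p Al[of i j "k - 1"] by (auto simp: g_def)
      qed
    qed
    then show ?thesis using P(3) by simp
  qed
  then show ?thesis using P(1,2) by blast
qed

text \<open>There is one polynomial for each chart \<open>J\<close> and each position
  \<open>(a, b)\<close> of the normalized entry. A nonzero M forces a nonzero parameter in the block
  outside \<open>J\<close>, and that block can be rescaled without moving A(x).\<close>

lemma degenerate_hypersurfaces:
  "\<exists>F. finite F \<and> (\<forall>f\<in>F. polyfun UNIV (tri_vars m n) f \<and> (\<exists>u. f u \<noteq> 0)) \<and>
    (\<forall>A. symmetric_pencil A \<longrightarrow> degenerate m n A \<longrightarrow> (\<exists>f\<in>F. f A = 0))"
proof -
  define D where "D = Pow {..<m} \<times> tri m"
  have "\<forall>d\<in>D. \<exists>P. polyfun UNIV (tri_vars m n) P \<and> (\<exists>u. P u \<noteq> 0) \<and>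
    (\<forall>A x M \<theta>. symmetric_pencil A \<longrightarrow>
      (\<forall>i<m. \<forall>k<m. lin_mat n A x i k = chart_S (fst d) \<theta> i k \<and> M i k = chart_M m (fst d) \<theta> i k) \<longrightarrow>
      M (fst (snd d)) (snd (snd d)) = 1 \<longrightarrow> \<theta> (fst (snd d), snd (snd d)) = 1 \<longrightarrow> (\<forall>i<m. \<forall>k<m. M i k = M k i) \<longrightarrow>
      (\<forall>l<n. (\<Sum>i<m. \<Sum>j<m. A (Suc l,i,j) * M i j) = 0) \<longrightarrow> P A = 0)"
    by (intro ballI degenerate_chart_hypersurface) (auto simp: D_def tri_def)
  from bchoice[OF this] obtain P where P: "\<forall>d\<in>D. polyfun UNIV (tri_vars m n) (P d) \<and> (\<exists>u. P d u \<noteq> 0) \<and>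
    (\<forall>A x M \<theta>. symmetric_pencil A \<longrightarrow>
      (\<forall>i<m. \<forall>k<m. lin_mat n A x i k = chart_S (fst d) \<theta> i k \<and> M i k = chart_M m (fst d) \<theta> i k) \<longrightarrow>
      M (fst (snd d)) (snd (snd d)) = 1 \<longrightarrow> \<theta> (fst (snd d), snd (snd d)) = 1 \<longrightarrow> (\<forall>i<m. \<forall>k<m. M i k = M k i) \<longrightarrow>
      (\<forall>l<n. (\<Sum>i<m. \<Sum>j<m. A (Suc l,i,j) * M i j) = 0) \<longrightarrow> P d A = 0)" by blast
  have "\<exists>f\<in>P ` D. f A = 0" if A: "symmetric_pencil A" "degenerate m n A" for A
  proof -
    obtain x M where M: "annihilator m n A x M" "\<exists>i<m. \<exists>j<m. M i j \<noteq> 0"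
      "\<forall>l<n. (\<Sum>i<m. \<Sum>j<m. A (Suc l,i,j) * M i j) = 0"
      using A(2) unfolding degenerate_def by blast
    obtain J \<theta> where J: "J \<subseteq> {..<m}"
      and ch: "\<forall>i<m. \<forall>k<m. lin_mat n A x i k = chart_S J \<theta> i k \<and> M i k = chart_M m J \<theta> i k"
      using annihilator_chart[OF A(1) M(1)] by blast
    have "\<exists>a'<m. \<exists>b'<m. a' \<notin> J \<and> b' \<notin> J \<and> sym_entry \<theta> a' b' \<noteq> 0"
    proof (rule ccontr)
      assume "\<not> ?thesis"
      then have "chart_M m J \<theta> i k = 0" for i k unfolding chart_M_def by (intro sum.neutral ballI) auto
      then show False using M(2) ch by auto
    qed
    then obtain a' b' where ab': "a' < m" "b' < m" "a' \<notin> J" "b' \<notin> J" "sym_entry \<theta> a' b' \<noteq> 0" by blast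
    define a b where "a = min a' b'" and "b = max a' b'"
    have ab: "a \<le> b" "b < m" "a \<notin> J" "b \<notin> J" "sym_entry \<theta> a b \<noteq> 0"
      using ab' by (auto simp: a_def b_def min_def max_def sym_entry_commute)
    define c where "c = 1 / sym_entry \<theta> a b"
    have "c \<noteq> 0" using ab by (simp add: c_def)
    then obtain \<theta>' where \<theta>': "\<forall>i k. chart_S J \<theta>' i k = chart_S J \<theta> i k"
      "\<forall>k l. chart_M m J \<theta>' k l = c * chart_M m J \<theta> k l"
      "\<forall>a b. a \<notin> J \<longrightarrow> b \<notin> J \<longrightarrow> sym_entry \<theta>' a b = c * sym_entry \<theta> a b"
      using chart_M_scale[of c J \<theta> m] by blast
    have e1: "sym_entry \<theta>' a b = 1" using \<theta>'(3) ab by (simp add: c_def)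
    then have t1: "\<theta>' (a, b) = 1" using ab(1) by (simp add: sym_entry_def)
    have m1: "c * M a b = 1"
      using ch ab \<theta>'(2) chart_M_block[of a m b J \<theta>'] e1 by (metis le_less_trans)
    have "(J, a, b) \<in> D" using J ab by (auto simp: D_def tri_def)
    then have "P (J, a, b) A = 0"
    proof -
      assume d: "(J, a, b) \<in> D"
      have "\<forall>i<m. \<forall>k<m. lin_mat n A x i k = chart_S J \<theta>' i k \<and> c * M i k = chart_M m J \<theta>' i k"
        using ch \<theta>' by simp
      moreover have "\<forall>i<m. \<forall>k<m. c * M i k = c * M k i" using M(1) by (simp add: annihilator_def)
      moreover have "\<forall>l<n. (\<Sum>i<m. \<Sum>j<m. A (Suc l,i,j) * (c * M i j)) = 0"
      proof (intro allI impI)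
        fix l assume "l < n"
        have "(\<Sum>i<m. \<Sum>j<m. A (Suc l,i,j) * (c * M i j)) = c * (\<Sum>i<m. \<Sum>j<m. A (Suc l,i,j) * M i j)"
          by (simp add: sum_distrib_left algebra_simps)
        then show "(\<Sum>i<m. \<Sum>j<m. A (Suc l,i,j) * (c * M i j)) = 0" using M(3) \<open>l < n\<close> by simp
      qed
      ultimately show ?thesis
        using bspec[OF P d, THEN conjunct2, THEN conjunct2, rule_format, of A x \<theta>' "\<lambda>i k. c * M i k"] A(1) m1 t1
        by simp
    qed
    then show ?thesis using \<open>(J, a, b) \<in> D\<close> by blast
  qed
  moreover have "finite (P ` D)" by (simp add: D_def finite_tri)
  ultimately show ?thesis using P by (intro exI[of _ "P ` D"]) blast
qed

section \<open>The hypersurfaces containing the critical points\<close>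

definition ext_vars :: "nat \<Rightarrow> nat \<Rightarrow> (nat \<times> nat \<times> nat) set" where
  "ext_vars m n = tri_vars m n \<union> {(k, i, j). k \<le> n \<and> i = m \<and> j = m}"

text \<open>The slots \<open>(0, m, m)\<close> and \<open>(Suc l, m, m)\<close>, which no entry of the pencil occupies, hold an
  additional value \<open>t\<close> and the coefficients \<open>c\<^sub>l\<close> of the objective.\<close>
definition ext_point :: "nat \<Rightarrow> complex \<Rightarrow> (nat \<Rightarrow> complex) \<Rightarrow> (nat \<times> nat \<times> nat \<Rightarrow> complex) \<Rightarrow> nat \<times> nat \<times> nat \<Rightarrow> complex" where
  "ext_point m t c A = (\<lambda>(k, i, j). if i = m then (if k = 0 then t else c (k - 1)) else A (k, i, j))"

lemma finite_ext_vars: "finite (ext_vars m n)"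
proof -
  have "finite {(k, i, j). k \<le> n \<and> i = m \<and> j = m}"
    by (rule finite_subset[of _ "{..n} \<times> {m} \<times> {m}"]) auto
  then show ?thesis by (simp add: ext_vars_def finite_tri_vars)
qed

text \<open>The parameters are the chart in layer 0, the values \<open>x l\<close> in the slots
  \<open>(Suc l, m, m)\<close>, and the matrices \<open>A_l\<close>; from them \<open>A_0\<close>
  and c are computed. The target has one coordinate more, at \<open>(0, m, m)\<close>, into which
  \<open>x l0\<close> is copied, and this forces a polynomial relation.\<close>

lemma kkt_chart_hypersurface:
  assumes J: "J \<subseteq> {..<m}" and l0: "l0 < n"
  shows "\<exists>P. polyfun UNIV (ext_vars m n) P \<and> (\<exists>u. P u \<noteq> 0) \<and>
    (\<forall>A x M c \<theta>. symmetric_pencil A \<longrightarrow>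
      (\<forall>i<m. \<forall>k<m. lin_mat n A x i k = chart_S J \<theta> i k \<and> M i k = chart_M m J \<theta> i k) \<longrightarrow>
      (\<forall>l<n. (\<Sum>i<m. \<Sum>j<m. A (Suc l,i,j) * M i j) = c l) \<longrightarrow> P (ext_point m (x l0) c A) = 0)"
proof -
  let ?Is = "ext_vars m n" and ?Vs = "ext_vars m n - {(0, m, m)}"
  define th where "th u = (\<lambda>(i, j). u (0::nat, i, j))" for u :: "nat \<times> nat \<times> nat \<Rightarrow> complex"
  define obj where "obj u k = (\<Sum>i<m. \<Sum>j<m. u (k, min i j, max i j) * chart_M m J (th u) i j)" for u k
  define g where "g = (\<lambda>(k, i, j) u. if i = m then (if k = 0 then u (Suc l0, m, m) else obj u k)
      else (if k = 0 then chart_S J (th u) i j - (\<Sum>l<n. u (Suc l, m, m) * u (Suc l, i, j)) else u (k, i, j)))"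
  have var: "polyfun UNIV ?Vs (\<lambda>u. u (k, i, j))" if "k \<le> n" "i \<le> j" "j < m" for k i j
    by (rule pf_var) (use that in \<open>auto simp: ext_vars_def tri_vars_def\<close>)
  have var': "polyfun UNIV ?Vs (\<lambda>u. u (Suc l, m, m))" if "l < n" for l
    by (rule pf_var) (use that in \<open>auto simp: ext_vars_def tri_vars_def\<close>)
  have pf_th: "polyfun UNIV ?Vs (\<lambda>u. th u (i, j))" if "i \<le> j" "j < m" for i j
    unfolding th_def prod.case by (rule var) (use that in auto)
  have pf_obj: "polyfun UNIV ?Vs (\<lambda>u. obj u k)" if "k \<le> n" for k
    unfolding obj_def
    by (intro polyfun_sum pf_mult var polyfun_charts(2)[where \<theta> = th, OF pf_th J]) (use that in auto)
  have pf_S: "polyfun UNIV ?Vs (\<lambda>u. chart_S J (th u) i j - (\<Sum>l<n. u (Suc l, m, m) * u (Suc l, i, j)))"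
    if "i \<le> j" "j < m" for i j
    by (intro polyfun_diff polyfun_sum pf_mult var var' polyfun_charts(1)[where \<theta> = th, OF pf_th J])
      (use that in auto)
  have pf_g: "polyfun UNIV ?Vs (g p)" if "p \<in> ?Is" for p
  proof -
    obtain k i j where p: "p = (k, i, j)" by (cases p)
    show ?thesis
      using that l0 var[of k i j] var'[of l0] pf_obj[of k] pf_S[of i j]
      unfolding p g_def prod.case ext_vars_def tri_vars_def
      by (cases "i = m"; cases "k = 0") auto
  qed
  have "card ?Vs < card ?Is"
    by (rule psubset_card_mono[OF finite_ext_vars]) (auto simp: ext_vars_def)
  then obtain P where P: "polyfun UNIV ?Is P" "\<exists>u. P u \<noteq> 0" "\<And>u. P (\<lambda>p. g p u) = 0"
    using algebraic_dependence[where g = g, OF finite_ext_vars _ _ pf_g] finite_ext_vars by blast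
  have "P (ext_point m (x l0) c A) = 0" if A: "symmetric_pencil A"
    and S: "\<forall>i<m. \<forall>k<m. lin_mat n A x i k = chart_S J \<theta> i k \<and> M i k = chart_M m J \<theta> i k"
    and c: "\<forall>l<n. (\<Sum>i<m. \<Sum>j<m. A (Suc l,i,j) * M i j) = c l" for A x M c \<theta>
  proof -
    define u where "u = (\<lambda>(k, i, j). if k = 0 then \<theta> (i, j) else if i = m then x (k - 1) else A (k, i, j))"
    have th: "th u = \<theta>" by (auto simp: th_def u_def fun_eq_iff)
    have u_min: "u (Suc l, min i j, max i j) = A (Suc l, i, j)" if "i < m" "j < m" for l i j
      using A that by (auto simp: u_def min_def max_def symmetric_pencil_def)
    have "P (ext_point m (x l0) c A) = P (\<lambda>p. g p u)"
    proof (rule polyfun_cong_vars[OF P(1)])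
      fix p assume pIs: "p \<in> ?Is"
      obtain k i j where p: "p = (k, i, j)" by (cases p)
      have kn: "k \<le> n" using pIs p by (auto simp: ext_vars_def tri_vars_def)
      show "ext_point m (x l0) c A p = g p u"
      proof (cases "i = m")
        case True
        show ?thesis
        proof (cases k)
          case 0
          then show ?thesis using True p by (simp add: g_def ext_point_def u_def)
        next
          case (Suc l)
          then have "obj u k = (\<Sum>i<m. \<Sum>j<m. A (Suc l,i,j) * M i j)"
            unfolding obj_def th using S u_min by (intro sum.cong refl) auto
          then show ?thesis using True p Suc c kn by (simp add: g_def ext_point_def)
        qed
      next
        case False
        then have ij: "i \<le> j" "j < m" using pIs p by (auto simp: ext_vars_def tri_vars_def)
        show ?thesis
        proof (cases k)
          case 0
          have "(\<Sum>l<n. u (Suc l, m, m) * u (Suc l, i, j)) = (\<Sum>l<n. x l * A (Suc l, i, j))"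
            using False by (auto simp: u_def)
          moreover have "chart_S J (th u) i j = A (0, i, j) + (\<Sum>l<n. x l * A (Suc l, i, j))"
            using S[rule_format, of i j] ij unfolding th lin_mat_def by simp
          ultimately show ?thesis using 0 False p by (simp add: g_def ext_point_def)
        next
          case (Suc l)
          then show ?thesis using False p by (simp add: g_def ext_point_def u_def)
        qed
      qed
    qed
    then show ?thesis using P(3) by simp
  qed
  then show ?thesis using P(1,2) by blast
qed

lemma kkt_hypersurfaces:
  assumes l0: "l0 < n"
  shows "\<exists>F. finite F \<and> (\<forall>f\<in>F. polyfun UNIV (ext_vars m n) f \<and> (\<exists>u. f u \<noteq> 0)) \<and>
    (\<forall>A x c. symmetric_pencil A \<longrightarrow> kkt m n A x c \<longrightarrow> (\<exists>f\<in>F. f (ext_point m (x l0) c A) = 0))"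
proof -
  have "\<forall>J\<in>Pow {..<m}. \<exists>P. polyfun UNIV (ext_vars m n) P \<and> (\<exists>u. P u \<noteq> 0) \<and>
    (\<forall>A x M c \<theta>. symmetric_pencil A \<longrightarrow>
      (\<forall>i<m. \<forall>k<m. lin_mat n A x i k = chart_S J \<theta> i k \<and> M i k = chart_M m J \<theta> i k) \<longrightarrow>
      (\<forall>l<n. (\<Sum>i<m. \<Sum>j<m. A (Suc l,i,j) * M i j) = c l) \<longrightarrow> P (ext_point m (x l0) c A) = 0)"
    by (intro ballI kkt_chart_hypersurface l0) auto
  from bchoice[OF this] obtain P where P: "\<forall>J\<in>Pow {..<m}. polyfun UNIV (ext_vars m n) (P J) \<and> (\<exists>u. P J u \<noteq> 0) \<and>
    (\<forall>A x M c \<theta>. symmetric_pencil A \<longrightarrow>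
      (\<forall>i<m. \<forall>k<m. lin_mat n A x i k = chart_S J \<theta> i k \<and> M i k = chart_M m J \<theta> i k) \<longrightarrow>
      (\<forall>l<n. (\<Sum>i<m. \<Sum>j<m. A (Suc l,i,j) * M i j) = c l) \<longrightarrow> P J (ext_point m (x l0) c A) = 0)"
    by blast
  have "\<exists>f\<in>P ` Pow {..<m}. f (ext_point m (x l0) c A) = 0" if A: "symmetric_pencil A" "kkt m n A x c" for A x c
  proof -
    obtain M where M: "annihilator m n A x M" "\<forall>l<n. (\<Sum>i<m. \<Sum>j<m. A (Suc l,i,j) * M i j) = c l"
      using A(2) unfolding kkt_def by blast
    obtain J \<theta> where J: "J \<in> Pow {..<m}"
      and ch: "\<forall>i<m. \<forall>k<m. lin_mat n A x i k = chart_S J \<theta> i k \<and> M i k = chart_M m J \<theta> i k"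
      using annihilator_chart[OF A(1) M(1)] by blast
    have "P J (ext_point m (x l0) c A) = 0"
      using bspec[OF P J, THEN conjunct2, THEN conjunct2, rule_format, of A x \<theta> M c] A(1) ch M(2) by simp
    then show ?thesis using J by blast
  qed
  moreover have "finite (P ` Pow {..<m})" by simp
  ultimately show ?thesis using P by (intro exI[of _ "P ` Pow {..<m}"]) blast
qed

section \<open>Choice of the open sets\<close>

lemma zariski_open_nonzero:
  assumes "polyfun UNIV Vs f"
  shows "zariski_open_in Vs S {w \<in> S. f w \<noteq> 0}"
  unfolding zariski_open_in_def by (rule exI[of _ "{f}"]) (use assms in auto)

text \<open>Each relation \<open>f\<close> is nonzero at some triple (t, c, A). Fixing its t and c
  leaves a nonzero condition on A; with A chosen, fixing t leaves one on c. For such A and c,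
  \<open>f\<close> is still a nonzero polynomial in t and has finitely many roots. The reference
  values \<open>t0 f\<close> and \<open>c0 f\<close> may differ from one \<open>f\<close> to
  another.\<close>

theorem generic_pencil:
  "\<exists>\<A>. zariski_open_in (sym_vars m n) (sym_space m n) \<A> \<and> \<A> \<noteq> {} \<and>
    (\<forall>A\<in>\<A>. \<not> degenerate m n A \<and>
      (\<exists>\<C>. zariski_open_in {..<n} (cvecs n) \<C> \<and> \<C> \<noteq> {} \<and>
        (\<forall>c\<in>\<C>. \<forall>l<n. finite {x l | x. kkt m n A x c})))"
proof -
  obtain F1 where F1: "finite F1" "\<And>f. f \<in> F1 \<Longrightarrow> polyfun UNIV (tri_vars m n) f"
    "\<And>f. f \<in> F1 \<Longrightarrow> \<exists>u. f u \<noteq> 0"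
    "\<And>A. symmetric_pencil A \<Longrightarrow> degenerate m n A \<Longrightarrow> \<exists>f\<in>F1. f A = 0"
    using degenerate_hypersurfaces[of m n] by blast
  have "\<forall>l\<in>{..<n}. \<exists>F. finite F \<and> (\<forall>f\<in>F. polyfun UNIV (ext_vars m n) f \<and> (\<exists>u. f u \<noteq> 0)) \<and>
    (\<forall>A x c. symmetric_pencil A \<longrightarrow> kkt m n A x c \<longrightarrow> (\<exists>f\<in>F. f (ext_point m (x l) c A) = 0))"
    by (intro ballI kkt_hypersurfaces) simp
  from bchoice[OF this] obtain F2 where F2: "\<forall>l\<in>{..<n}. finite (F2 l) \<and>
      (\<forall>f\<in>F2 l. polyfun UNIV (ext_vars m n) f \<and> (\<exists>u. f u \<noteq> 0)) \<and>
    (\<forall>A x c. symmetric_pencil A \<longrightarrow> kkt m n A x c \<longrightarrow> (\<exists>f\<in>F2 l. f (ext_point m (x l) c A) = 0))" by blast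
  define G where "G = (\<Union>l<n. F2 l)"
  have G: "finite G" "\<And>f. f \<in> G \<Longrightarrow> polyfun UNIV (ext_vars m n) f" "\<And>f. f \<in> G \<Longrightarrow> \<exists>u. f u \<noteq> 0"
    using F2 unfolding G_def by blast+
  obtain u where u: "\<And>f. f \<in> G \<Longrightarrow> f (u f) \<noteq> 0" using G(3) by metis
  define t0 where "t0 f = u f (0, m, m)" for f
  define c0 where "c0 f l = u f (Suc l, m, m)" for f l
  have u_ext: "f (ext_point m (t0 f) (c0 f) (u f)) \<noteq> 0" if "f \<in> G" for f
  proof -
    have "f (ext_point m (t0 f) (c0 f) (u f)) = f (u f)"
      by (rule polyfun_cong_vars[OF G(2)[OF that]])
        (auto simp: ext_vars_def tri_vars_def ext_point_def t0_def c0_def)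
    then show ?thesis using u that by simp
  qed
  have pf_tri: "polyfun UNIV (tri_vars m n) (\<lambda>A. f (ext_point m t c A))" if "f \<in> G" for f t c
  proof (rule polyfun_compose[where g = "\<lambda>p A. ext_point m t c A p", OF G(2)[OF that], simplified])
    fix p assume "p \<in> ext_vars m n"
    then show "polyfun UNIV (tri_vars m n) (\<lambda>A. ext_point m t c A p)"
      by (cases p) (auto simp: ext_vars_def ext_point_def tri_vars_def intro!: polyfun.intros)
  qed
  define H where "H = F1 \<union> (\<lambda>f A. f (ext_point m (t0 f) (c0 f) A)) ` G"
  have H: "finite H" "\<And>f. f \<in> H \<Longrightarrow> polyfun UNIV (tri_vars m n) f" "\<And>f. f \<in> H \<Longrightarrow> \<exists>u. f u \<noteq> 0"
    using F1(1-3) G(1) pf_tri u_ext unfolding H_def by blast+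
  obtain w where w: "\<forall>f\<in>H. f w \<noteq> 0" using polyfun_common_nonzero[OF H] by blast
  define prod_H where "prod_H A = (\<Prod>f\<in>H. f A)" for A
  define \<A> where "\<A> = {A \<in> sym_space m n. prod_H A \<noteq> 0}"
  have "polyfun UNIV (sym_vars m n) prod_H"
    unfolding prod_H_def
    by (intro polyfun_prod polyfun_mono[OF H(2)]) (auto simp: tri_vars_def sym_vars_def)
  then have open_A: "zariski_open_in (sym_vars m n) (sym_space m n) \<A>"
    unfolding \<A>_def by (rule zariski_open_nonzero)
  \<comment> \<open>The conditions read only the upper triangle, so the good point \<open>w\<close>
    may be symmetrized without changing their values.\<close>
  define A0 where "A0 = (\<lambda>(k, i, j). if (k, i, j) \<in> sym_vars m n then w (k, min i j, max i j) else 0)"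
  have "A0 \<in> sym_space m n"
    by (auto simp: A0_def sym_space_def aff_def sym_vars_def min.commute max.commute)
  moreover have "prod_H A0 \<noteq> 0"
  proof -
    have "f A0 = f w" if "f \<in> H" for f
      by (rule polyfun_cong_vars[OF H(2)[OF that]]) (auto simp: A0_def tri_vars_def sym_vars_def)
    then have "\<forall>f\<in>H. f A0 \<noteq> 0" using w by metis
    then show ?thesis using H(1) by (simp add: prod_H_def)
  qed
  ultimately have ne_A: "\<A> \<noteq> {}" unfolding \<A>_def by blast
  have "\<not> degenerate m n A \<and> (\<exists>\<C>. zariski_open_in {..<n} (cvecs n) \<C> \<and> \<C> \<noteq> {} \<and>
        (\<forall>c\<in>\<C>. \<forall>l<n. finite {x l | x. kkt m n A x c}))" if A: "A \<in> \<A>" for A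
  proof
    have symA: "symmetric_pencil A" using A by (auto simp: \<A>_def sym_space_def symmetric_pencil_def)
    have nz: "f A \<noteq> 0" if "f \<in> H" for f using A that H(1) by (auto simp: \<A>_def prod_H_def)
    show "\<not> degenerate m n A" using F1(4)[OF symA] nz unfolding H_def by blast
    have nzG: "f (ext_point m (t0 f) (c0 f) A) \<noteq> 0" if "f \<in> G" for f
      using nz[of "\<lambda>A. f (ext_point m (t0 f) (c0 f) A)"] that unfolding H_def by blast
    have pf_c: "polyfun UNIV {..<n} (\<lambda>c. f (ext_point m t c A))" if "f \<in> G" for f t
    proof (rule polyfun_compose[where g = "\<lambda>p c. ext_point m t c A p", OF G(2)[OF that], simplified])
      fix p assume "p \<in> ext_vars m n"
      then show "polyfun UNIV {..<n} (\<lambda>c. ext_point m t c A p)"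
        by (cases p) (auto simp: ext_vars_def ext_point_def tri_vars_def intro!: polyfun_intros)
    qed
    define H' where "H' = (\<lambda>f c. f (ext_point m (t0 f) c A)) ` G"
    have H': "finite H'" "\<And>f. f \<in> H' \<Longrightarrow> polyfun UNIV {..<n} f" "\<And>f. f \<in> H' \<Longrightarrow> \<exists>c. f c \<noteq> 0"
      using G(1) pf_c nzG unfolding H'_def by blast+
    obtain c1 where c1: "\<forall>f\<in>H'. f c1 \<noteq> 0" using polyfun_common_nonzero[OF H'] by blast
    define prod_H' where "prod_H' c = (\<Prod>f\<in>H'. f c)" for c
    define \<C> where "\<C> = {c \<in> cvecs n. prod_H' c \<noteq> 0}"
    have "polyfun UNIV {..<n} prod_H'"
      unfolding prod_H'_def by (intro polyfun_prod H'(2)) auto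
    then have "zariski_open_in {..<n} (cvecs n) \<C>" unfolding \<C>_def by (rule zariski_open_nonzero)
    moreover have "(\<lambda>l. if l < n then c1 l else 0) \<in> \<C>"
    proof -
      have "f (\<lambda>l. if l < n then c1 l else 0) = f c1" if "f \<in> H'" for f
        by (rule polyfun_cong_vars[OF H'(2)[OF that]]) auto
      then have "\<forall>f\<in>H'. f (\<lambda>l. if l < n then c1 l else 0) \<noteq> 0" using c1 by metis
      then show ?thesis using H'(1) by (simp add: \<C>_def prod_H'_def cvecs_def aff_def)
    qed
    moreover have "finite {x l | x. kkt m n A x c}" if c: "c \<in> \<C>" and l: "l < n" for c l
    proof -
      have nzc: "f (ext_point m (t0 f) c A) \<noteq> 0" if "f \<in> G" for f
        using c that H'(1) by (auto simp: \<C>_def prod_H'_def H'_def)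
      have fin: "finite {t. f (ext_point m t c A) = 0}" if f: "f \<in> G" for f
      proof -
        obtain p where p: "\<And>t. f ((ext_point m 0 c A)((0, m, m) := t)) = poly p t"
          using polyfun_univariate[OF G(2)[OF f]] by blast
        have eq: "f (ext_point m t c A) = poly p t" for t
        proof -
          have "f (ext_point m t c A) = f ((ext_point m 0 c A)((0, m, m) := t))"
            by (rule polyfun_cong_vars[OF G(2)[OF f]])
              (auto simp: ext_vars_def tri_vars_def ext_point_def split: if_splits)
          then show ?thesis using p by simp
        qed
        have "p \<noteq> 0" using nzc[OF f] eq by auto
        then show ?thesis using poly_roots_finite by (simp add: eq)
      qed
      have "{x l | x. kkt m n A x c} \<subseteq> (\<Union>f\<in>F2 l. {t. f (ext_point m t c A) = 0})"
      proof
        fix t assume "t \<in> {x l | x. kkt m n A x c}"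
        then obtain x where "t = x l" "kkt m n A x c" by blast
        moreover obtain f where "f \<in> F2 l" "f (ext_point m (x l) c A) = 0"
          using bspec[OF F2, of l] l symA calculation(2) by blast
        ultimately show "t \<in> (\<Union>f\<in>F2 l. {t. f (ext_point m t c A) = 0})" by blast
      qed
      moreover have "finite (\<Union>f\<in>F2 l. {t. f (ext_point m t c A) = 0})"
        using bspec[OF F2, of l] l fin l unfolding G_def by blast
      ultimately show ?thesis by (rule finite_subset)
    qed
    ultimately show "\<exists>\<C>. zariski_open_in {..<n} (cvecs n) \<C> \<and> \<C> \<noteq> {} \<and>
        (\<forall>c\<in>\<C>. \<forall>l<n. finite {x l | x. kkt m n A x c})" by blast
  qed
  then show ?thesis using open_A ne_A by blast
qed

subsection \<open>The Lagrange system\<close>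

lemma Amat_lin_mat: "Amat n A w = lin_mat n A (\<lambda>l. w (X l))"
  by (simp add: fun_eq_iff Amat_def lin_mat_def)

lemma bij_idx:
  assumes "\<iota> \<in> index_sets m p"
  shows "bij_betw (idx \<iota>) {..<m - p} \<iota>"
proof -
  have fin: "finite \<iota>" and card: "card \<iota> = m - p"
    using assms finite_subset[of \<iota> "{..<m}"] by (auto simp: index_sets_def)
  have "bij_betw ((!) (sorted_list_of_set \<iota>)) {..<length (sorted_list_of_set \<iota>)} (set (sorted_list_of_set \<iota>))"
    by (rule bij_betw_nth) auto
  then show ?thesis using fin card by (simp add: idx_def[abs_def])
qed

lemma idx_mem: "\<iota> \<in> index_sets m p \<Longrightarrow> a < m - p \<Longrightarrow> idx \<iota> a \<in> \<iota>"
  using bij_betwE[OF bij_idx, of \<iota> m p] by simp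

lemma idx_less: "\<iota> \<in> index_sets m p \<Longrightarrow> a < m - p \<Longrightarrow> idx \<iota> a < m"
  using idx_mem[of \<iota> m p a] by (auto simp: index_sets_def)

lemma idx_inj: "\<iota> \<in> index_sets m p \<Longrightarrow> a < m - p \<Longrightarrow> b < m - p \<Longrightarrow> idx \<iota> a = idx \<iota> b \<longleftrightarrow> a = b"
  using bij_betw_imp_inj_on[OF bij_idx] by (auto simp: inj_on_def)

lemma sum_idx:
  assumes "\<iota> \<in> index_sets m p"
  shows "(\<Sum>k\<in>\<iota>. f k) = (\<Sum>a<m - p. f (idx \<iota> a))"
  using sum.reindex_bij_betw[OF bij_idx[OF assms], of f] by simp

lemma finite_feqs: "finite (feqs m n p)"
proof -
  have "feqs m n p = case_prod EqAY ` ({..<m} \<times> {..<m - p}) \<union> case_prod EqId ` ({..<m - p} \<times> {..<m - p})"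
    by (auto simp: feqs_def)
  then show ?thesis by simp
qed

lemma sum_feqs:
  "(\<Sum>e\<in>feqs m n p. F e) = (\<Sum>i<m. \<Sum>j<m - p. F (EqAY i j)) + (\<Sum>a<m - p. \<Sum>j<m - p. F (EqId a j))"
proof -
  have eq: "feqs m n p = case_prod EqAY ` ({..<m} \<times> {..<m - p}) \<union> case_prod EqId ` ({..<m - p} \<times> {..<m - p})"
    by (auto simp: feqs_def)
  have "(\<Sum>e\<in>feqs m n p. F e) = (\<Sum>e\<in>case_prod EqAY ` ({..<m} \<times> {..<m - p}). F e) +
      (\<Sum>e\<in>case_prod EqId ` ({..<m - p} \<times> {..<m - p}). F e)"
    unfolding eq by (rule sum.union_disjoint) auto
  also have "(\<Sum>e\<in>case_prod EqAY ` ({..<m} \<times> {..<m - p}). F e) = (\<Sum>i<m. \<Sum>j<m - p. F (EqAY i j))"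
    by (subst sum.reindex) (auto simp: inj_on_def sum.cartesian_product intro!: sum.cong)
  also have "(\<Sum>e\<in>case_prod EqId ` ({..<m - p} \<times> {..<m - p}). F e) = (\<Sum>a<m - p. \<Sum>j<m - p. F (EqId a j))"
    by (subst sum.reindex) (auto simp: inj_on_def sum.cartesian_product intro!: sum.cong)
  finally show ?thesis .
qed

lemma finite_xy_vars: "finite (xy_vars m n p)"
proof -
  have "xy_vars m n p = X ` {..<n} \<union> case_prod Y ` ({..<m} \<times> {..<m - p})"
    by (auto simp: xy_vars_def)
  then show ?thesis by simp
qed

section \<open>Derivatives of the equations and the multiplier matrix\<close>

definition dfeq :: "nat \<Rightarrow> nat \<Rightarrow> (nat \<times> nat \<times> nat \<Rightarrow> complex) \<Rightarrow> nat set \<Rightarrow> eqn \<Rightarrow> var \<Rightarrow> (var \<Rightarrow> complex) \<Rightarrow> complex" where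
  "dfeq m n A \<iota> e v w = (case v of
      X l \<Rightarrow> (case e of EqAY i j \<Rightarrow> (if l < n then \<Sum>k<m. A (Suc l,i,k) * w (Y k j) else 0) | EqId a j \<Rightarrow> 0)
    | Y k j' \<Rightarrow> (case e of EqAY i j \<Rightarrow> (if j = j' \<and> k < m then Amat n A w i k else 0)
        | EqId a j \<Rightarrow> (if idx \<iota> a = k \<and> j = j' then 1 else 0))
    | Z e' \<Rightarrow> 0)"

lemma Amat_upd: "Amat n A (w(v := t)) i k =
    Amat n A w i k + (case v of X l \<Rightarrow> (if l < n then (t - w v) * A (Suc l,i,k) else 0) | _ \<Rightarrow> 0)"
proof (cases v)
  case (X l)
  have "(\<Sum>l'<n. (w(v := t)) (var.X l') * A (Suc l',i,k)) =
      (\<Sum>l'<n. w (var.X l') * A (Suc l',i,k) + (if l' = l then (t - w v) * A (Suc l,i,k) else 0))"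
    by (intro sum.cong) (auto simp: X algebra_simps)
  also have "\<dots> = (\<Sum>l'<n. w (var.X l') * A (Suc l',i,k)) + (if l < n then (t - w v) * A (Suc l,i,k) else 0)"
    by (simp add: sum.distrib)
  finally show ?thesis using X by (simp add: Amat_def)
qed (auto simp: Amat_def)

text \<open>No equation has degree above one in any single variable, so this difference formula is
  exact. It yields both the complex partial derivative and, on real points, the real one.\<close>

lemma feq_upd: "feq m n A \<iota> e (w(v := t)) = feq m n A \<iota> e w + (t - w v) * dfeq m n A \<iota> e v w"
proof (cases e)
  case e: (EqAY i j)
  show ?thesis
  proof (cases v)
    case (X l)
    have "(\<Sum>k<m. Amat n A (w(v := t)) i k * (w(v := t)) (Y k j)) =
        (\<Sum>k<m. Amat n A w i k * w (Y k j) + (t - w v) * (if l < n then A (Suc l,i,k) * w (Y k j) else 0))"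
      by (intro sum.cong refl) (auto simp: Amat_upd X algebra_simps)
    then show ?thesis by (simp add: e X dfeq_def sum.distrib sum_distrib_left)
  next
    case (Y k' j')
    have "(\<Sum>k<m. Amat n A (w(v := t)) i k * (w(v := t)) (var.Y k j)) =
        (\<Sum>k<m. Amat n A w i k * w (var.Y k j) + (if k = k' then (if j = j' then (t - w v) * Amat n A w i k' else 0) else 0))"
      by (intro sum.cong refl) (auto simp: Amat_upd Y algebra_simps)
    then show ?thesis by (auto simp: e Y dfeq_def sum.distrib)
  next
    case (Z e')
    then show ?thesis by (simp add: e dfeq_def Amat_upd)
  qed
next
  case (EqId a j)
  then show ?thesis by (cases v) (auto simp: dfeq_def)
qed

lemma pdiff_affine:
  assumes "\<And>t. f (w(v := t)) = f w + (t - w v) * d"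
  shows "pdiff f v w = d"
proof -
  have "((\<lambda>t. f w + (t - w v) * d) has_field_derivative d) (at (w v))"
    by (auto intro!: derivative_eq_intros)
  then show ?thesis unfolding pdiff_def assms by (rule DERIV_imp_deriv)
qed

lemma pdiff_feq: "pdiff (feq m n A \<iota> e) v w = dfeq m n A \<iota> e v w"
  by (rule pdiff_affine) (rule feq_upd)

lemma pdiff_Lc: "pdiff (Lc n c) v w = (case v of X l \<Rightarrow> (if l < n then c l else 0) | _ \<Rightarrow> 0)"
proof (rule pdiff_affine)
  fix t
  show "Lc n c (w(v := t)) = Lc n c w + (t - w v) * (case v of X l \<Rightarrow> (if l < n then c l else 0) | _ \<Rightarrow> 0)"
  proof (cases v)
    case (X l)
    have "(\<Sum>l'<n. c l' * (w(v := t)) (var.X l')) = (\<Sum>l'<n. c l' * w (var.X l') + (if l' = l then (t - w v) * c l else 0))"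
      by (intro sum.cong) (auto simp: X algebra_simps)
    then show ?thesis by (auto simp: X Lc_def sum.distrib)
  qed (auto simp: Lc_def)
qed

lemma sum_dfeq_X:
  assumes "l < n"
  shows "(\<Sum>e\<in>feqs m n p. \<zeta> e * dfeq m n A \<iota> e (X l) w) =
    (\<Sum>i<m. \<Sum>k<m. A (Suc l,i,k) * (\<Sum>j<m - p. \<zeta> (EqAY i j) * w (Y k j)))"
proof -
  have "(\<Sum>e\<in>feqs m n p. \<zeta> e * dfeq m n A \<iota> e (X l) w) =
      (\<Sum>i<m. \<Sum>j<m - p. \<Sum>k<m. A (Suc l,i,k) * (\<zeta> (EqAY i j) * w (Y k j)))"
    unfolding sum_feqs using assms by (simp add: dfeq_def sum_distrib_left mult_ac)
  also have "\<dots> = (\<Sum>i<m. \<Sum>k<m. \<Sum>j<m - p. A (Suc l,i,k) * (\<zeta> (EqAY i j) * w (Y k j)))"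
    by (intro sum.cong refl sum.swap)
  finally show ?thesis by (simp add: sum_distrib_left)
qed

lemma sum_dfeq_Y:
  assumes "k < m" "j < m - p"
  shows "(\<Sum>e\<in>feqs m n p. \<zeta> e * dfeq m n A \<iota> e (Y k j) w) =
    (\<Sum>i<m. \<zeta> (EqAY i j) * Amat n A w i k) + (\<Sum>a<m - p. if idx \<iota> a = k then \<zeta> (EqId a j) else 0)"
proof -
  have "(\<Sum>i<m. \<Sum>j'<m - p. \<zeta> (EqAY i j') * dfeq m n A \<iota> (EqAY i j') (Y k j) w) =
      (\<Sum>i<m. \<Sum>j'<m - p. if j' = j then \<zeta> (EqAY i j) * Amat n A w i k else 0)"
    using assms by (intro sum.cong refl) (auto simp: dfeq_def)
  moreover have "(\<Sum>a<m - p. \<Sum>j'<m - p. \<zeta> (EqId a j') * dfeq m n A \<iota> (EqId a j') (Y k j) w) =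
      (\<Sum>a<m - p. \<Sum>j'<m - p. if j' = j then (if idx \<iota> a = k then \<zeta> (EqId a j) else 0) else 0)"
    by (intro sum.cong refl) (auto simp: dfeq_def)
  ultimately show ?thesis unfolding sum_feqs using assms by simp
qed

text \<open>The symmetrization of Z Y^T, where Z holds the multipliers of A(x) Y = 0. The symmetric
  \<open>A_l\<close> pair with it as with Z Y^T itself, and this pairing is the x-part of the
  Lagrange equations.\<close>

definition mult_matrix :: "nat \<Rightarrow> (eqn \<Rightarrow> complex) \<Rightarrow> (var \<Rightarrow> complex) \<Rightarrow> nat \<Rightarrow> nat \<Rightarrow> complex" where
  "mult_matrix d \<zeta> w i k = ((\<Sum>j<d. \<zeta> (EqAY i j) * w (Y k j)) + (\<Sum>j<d. \<zeta> (EqAY k j) * w (Y i j))) / 2"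

text \<open>If the \<open>Y\<close>-part of the Lagrange equations holds, with multipliers \<open>Z\<close> of \<open>A(x) Y = 0\<close> and
  \<open>U\<close> of \<open>Y\<^sub>\<iota> = Id\<close>, then \<open>A(x) Z\<close> is supported on the rows in \<open>\<iota>\<close> and equals \<open>-U\<close> there, while
  \<open>U = Y\<^sup>T [U; 0] = - Y\<^sup>T A(x) Z = 0\<close>.\<close>
lemma multipliers_annihilated:
  assumes A: "symmetric_pencil A" and \<iota>: "\<iota> \<in> index_sets m p"
    and w: "\<And>e. e \<in> feqs m n p \<Longrightarrow> feq m n A \<iota> e w = 0"
    and \<zeta>: "\<And>k j. k < m \<Longrightarrow> j < m - p \<Longrightarrow> (\<Sum>e\<in>feqs m n p. \<zeta> e * dfeq m n A \<iota> e (Y k j) w) = 0"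
  shows "a < m - p \<Longrightarrow> j < m - p \<Longrightarrow> \<zeta> (EqId a j) = 0"
    and "annihilator m n A (\<lambda>l. w (X l)) (mult_matrix (m - p) \<zeta> w)"
proof -
  let ?S = "Amat n A w"
  have symS: "?S i k = ?S k i" for i k unfolding Amat_lin_mat by (rule lin_mat_sym[OF A])
  have SY: "(\<Sum>k<m. ?S i k * w (Y k j)) = 0" if "i < m" "j < m - p" for i j
    using w[of "EqAY i j"] that by (simp add: feqs_def)
  have YI: "w (Y (idx \<iota> a) j) = (if a = j then 1 else 0)" if "a < m - p" "j < m - p" for a j
    using w[of "EqId a j"] that by (simp add: feqs_def)
  have SZ: "(\<Sum>i<m. ?S k i * \<zeta> (EqAY i j)) = - (\<Sum>a<m - p. if idx \<iota> a = k then \<zeta> (EqId a j) else 0)"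
    if "k < m" "j < m - p" for k j
  proof -
    have "(\<Sum>i<m. ?S k i * \<zeta> (EqAY i j)) = (\<Sum>i<m. \<zeta> (EqAY i j) * ?S i k)"
      by (intro sum.cong refl) (simp add: symS[of k] mult.commute)
    then show ?thesis using \<zeta>[OF that] sum_dfeq_Y[OF that, where n = n and \<zeta> = \<zeta> and A = A and \<iota> = \<iota> and w = w] by (simp add: eq_neg_iff_add_eq_0)
  qed
  have U0: "\<zeta> (EqId a j) = 0" if "a < m - p" "j < m - p" for a j
  proof -
    have "(\<Sum>k<m. w (Y k a) * (\<Sum>i<m. ?S k i * \<zeta> (EqAY i j))) = (\<Sum>i<m. (\<Sum>k<m. ?S i k * w (Y k a)) * \<zeta> (EqAY i j))"
      unfolding sum_distrib_left sum_distrib_right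
      by (subst sum.swap) (intro sum.cong refl, simp add: symS mult_ac)
    also have "\<dots> = 0" using SY that by simp
    finally have "0 = (\<Sum>k<m. w (Y k a) * (\<Sum>b<m - p. if idx \<iota> b = k then \<zeta> (EqId b j) else 0))"
      using SZ[OF _ that(2)] by (simp add: sum_negf)
    also have "\<dots> = (\<Sum>k<m. \<Sum>b<m - p. if idx \<iota> b = k then w (Y k a) * \<zeta> (EqId b j) else 0)"
      unfolding sum_distrib_left by (intro sum.cong refl) auto
    also have "\<dots> = (\<Sum>b<m - p. \<Sum>k<m. if idx \<iota> b = k then w (Y k a) * \<zeta> (EqId b j) else 0)"
      by (rule sum.swap)
    also have "\<dots> = (\<Sum>b<m - p. if b = a then \<zeta> (EqId b j) else 0)"
      using idx_less[OF \<iota>] YI that by (intro sum.cong refl) (auto simp: sum.delta')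
    also have "\<dots> = \<zeta> (EqId a j)" using that by simp
    finally show ?thesis by simp
  qed
  then show "a < m - p \<Longrightarrow> j < m - p \<Longrightarrow> \<zeta> (EqId a j) = 0" .
  have SZ0: "(\<Sum>i<m. ?S k i * \<zeta> (EqAY i j)) = 0" if "k < m" "j < m - p" for k j
    using SZ[OF that] U0 that by (simp cong: if_cong)
  have "(\<Sum>k<m. ?S i k * mult_matrix (m - p) \<zeta> w k l) = 0" if "i < m" "l < m" for i l
  proof -
    have "(\<Sum>k<m. ?S i k * mult_matrix (m - p) \<zeta> w k l) =
        ((\<Sum>k<m. \<Sum>j<m - p. ?S i k * \<zeta> (EqAY k j) * w (Y l j)) + (\<Sum>k<m. \<Sum>j<m - p. ?S i k * w (Y k j) * \<zeta> (EqAY l j))) / 2"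
      by (simp add: mult_matrix_def sum_distrib_left sum_divide_distrib sum.distrib add_divide_distrib distrib_left mult_ac)
    also have "(\<Sum>k<m. \<Sum>j<m - p. ?S i k * \<zeta> (EqAY k j) * w (Y l j)) = (\<Sum>j<m - p. (\<Sum>k<m. ?S i k * \<zeta> (EqAY k j)) * w (Y l j))"
      by (subst sum.swap) (simp add: sum_distrib_right)
    also have "\<dots> = 0" using SZ0 that by simp
    also have "(\<Sum>k<m. \<Sum>j<m - p. ?S i k * w (Y k j) * \<zeta> (EqAY l j)) = (\<Sum>j<m - p. (\<Sum>k<m. ?S i k * w (Y k j)) * \<zeta> (EqAY l j))"
      by (subst sum.swap) (simp add: sum_distrib_right)
    also have "\<dots> = 0" using SY that by simp
    finally show ?thesis by simp
  qed
  then show "annihilator m n A (\<lambda>l. w (X l)) (mult_matrix (m - p) \<zeta> w)"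
    unfolding annihilator_def Amat_lin_mat[symmetric] by (simp add: mult_matrix_def add.commute)
qed

lemma mult_matrix_pairing:
  assumes "symmetric_pencil A" "l < n"
  shows "(\<Sum>i<m. \<Sum>k<m. A (Suc l,i,k) * mult_matrix (m - p) \<zeta> w i k) = (\<Sum>e\<in>feqs m n p. \<zeta> e * dfeq m n A \<iota> e (X l) w)"
proof -
  define M' where "M' i k = (\<Sum>j<m - p. \<zeta> (EqAY i j) * w (Y k j))" for i k
  have "(\<Sum>i<m. \<Sum>k<m. A (Suc l,i,k) * mult_matrix (m - p) \<zeta> w i k) =
      ((\<Sum>i<m. \<Sum>k<m. A (Suc l,i,k) * M' i k) + (\<Sum>i<m. \<Sum>k<m. A (Suc l,i,k) * M' k i)) / 2"
    unfolding sum.distrib[symmetric] sum_divide_distrib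
    by (intro sum.cong refl) (simp add: mult_matrix_def M'_def distrib_left)
  also have "(\<Sum>i<m. \<Sum>k<m. A (Suc l,i,k) * M' k i) = (\<Sum>k<m. \<Sum>i<m. A (Suc l,i,k) * M' k i)"
    by (rule sum.swap)
  also have "\<dots> = (\<Sum>i<m. \<Sum>k<m. A (Suc l,i,k) * M' i k)"
    using assms(1) unfolding symmetric_pencil_def by (intro sum.cong refl) metis
  finally show ?thesis using sum_dfeq_X[OF assms(2), where m = m and p = p and \<zeta> = \<zeta> and A = A and \<iota> = \<iota> and w = w] by (simp add: M'_def)
qed

theorem Lag_zero_kkt:
  assumes A: "symmetric_pencil A" and \<iota>: "\<iota> \<in> index_sets m p"
    and w: "\<And>q. q \<in> Lag m n A c p \<iota> \<Longrightarrow> q w = 0"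
  shows "kkt m n A (\<lambda>l. w (X l)) c"
proof -
  \<comment> \<open>\<open>Lag\<close> adds the gradient of the objective to the combination of
    gradients, whereas \<open>kkt\<close> equates the two; hence the sign.\<close>
  define \<zeta> where "\<zeta> e = - w (Z e)" for e
  have f: "feq m n A \<iota> e w = 0" if "e \<in> feqs m n p" for e
    using w that unfolding Lag_def by blast
  have g: "(\<Sum>e\<in>feqs m n p. \<zeta> e * dfeq m n A \<iota> e v w) = pdiff (Lc n c) v w" if "v \<in> xy_vars m n p" for v
  proof -
    have "(\<lambda>w. (\<Sum>e\<in>feqs m n p. w (Z e) * pdiff (feq m n A \<iota> e) v w) + pdiff (Lc n c) v w) w = 0"
      by (rule w) (use that in \<open>auto simp: Lag_def\<close>)
    then show ?thesis by (simp add: \<zeta>_def pdiff_feq sum_negf neg_eq_iff_add_eq_0)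
  qed
  have gY: "(\<Sum>e\<in>feqs m n p. \<zeta> e * dfeq m n A \<iota> e (Y k j) w) = 0" if "k < m" "j < m - p" for k j
    using g[of "Y k j"] that by (auto simp: xy_vars_def pdiff_Lc)
  have gX: "(\<Sum>e\<in>feqs m n p. \<zeta> e * dfeq m n A \<iota> e (X l) w) = c l" if "l < n" for l
    using g[of "X l"] that by (auto simp: xy_vars_def pdiff_Lc)
  show ?thesis unfolding kkt_def
    using multipliers_annihilated(2)[OF A \<iota> f gY] mult_matrix_pairing[OF A] gX
    by (intro exI[of _ "mult_matrix (m - p) \<zeta> w"]) simp
qed

text \<open>Since \<open>Y\<^sup>T A(x) Y\<close> is symmetric, the equations \<open>(A(x) Y) (\<iota> a) j = 0\<close> with \<open>j < a\<close> follow from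
  the others; the remaining ones have independent gradients.\<close>
definition red_eqs :: "nat \<Rightarrow> nat \<Rightarrow> nat \<Rightarrow> nat set \<Rightarrow> eqn set" where
  "red_eqs m n p \<iota> = feqs m n p - {EqAY (idx \<iota> a) j | a j. j < a \<and> a < m - p}"

lemma red_eqs_subset: "red_eqs m n p \<iota> \<subseteq> feqs m n p"
  by (auto simp: red_eqs_def)

lemma feqs_if_red_eqs:
  assumes A: "symmetric_pencil A" and \<iota>: "\<iota> \<in> index_sets m p"
    and red: "\<And>e. e \<in> red_eqs m n p \<iota> \<Longrightarrow> feq m n A \<iota> e w = 0" and e: "e \<in> feqs m n p"
  shows "feq m n A \<iota> e w = 0"
proof (cases "e \<in> red_eqs m n p \<iota>")
  case False
  then obtain a j where ea: "e = EqAY (idx \<iota> a) j" "j < a" "a < m - p" using e by (auto simp: red_eqs_def)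
  let ?S = "Amat n A w"
  define E where "E i j = (\<Sum>k<m. ?S i k * w (Y k j))" for i j
  have symS: "?S i k = ?S k i" for i k unfolding Amat_lin_mat by (rule lin_mat_sym[OF A])
  have YI: "w (Y (idx \<iota> a) j) = (if a = j then 1 else 0)" if "a < m - p" "j < m - p" for a j
    using red[of "EqId a j"] that by (auto simp: red_eqs_def feqs_def)
  have E0: "E i j = 0" if "i < m" "j < m - p" "i \<notin> \<iota>" for i j
  proof -
    have "i \<noteq> idx \<iota> a" if "a < m - p" for a using bij_betwE[OF bij_idx[OF \<iota>]] that \<open>i \<notin> \<iota>\<close> by auto
    then have "EqAY i j \<in> red_eqs m n p \<iota>" using that by (auto simp: red_eqs_def feqs_def)
    then show ?thesis using red[of "EqAY i j"] by (simp add: E_def)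
  qed
  have sub: "\<iota> \<subseteq> {..<m}" using \<iota> by (simp add: index_sets_def)
  \<comment> \<open>Since the equations off \<open>\<iota>\<close> hold and Y is the identity on
    \<open>\<iota>\<close>, the entries of Y^T A(x) Y are those of A(x) Y in the rows of
    \<open>\<iota>\<close>.\<close>
  have quad: "(\<Sum>i<m. w (Y i b) * E i j) = E (idx \<iota> b) j" if "b < m - p" "j < m - p" for b j
  proof -
    have "(\<Sum>i\<in>{..<m} - \<iota>. w (Y i b) * E i j) = 0" using E0 that by (intro sum.neutral) auto
    then have "(\<Sum>i<m. w (Y i b) * E i j) = (\<Sum>i\<in>\<iota>. w (Y i b) * E i j)" by (simp add: sum_split[OF sub])
    also have "\<dots> = (\<Sum>a<m - p. w (Y (idx \<iota> a) b) * E (idx \<iota> a) j)" by (rule sum_idx[OF \<iota>])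
    also have "\<dots> = (\<Sum>a<m - p. if a = b then E (idx \<iota> a) j else 0)"
      using YI that by (intro sum.cong refl) auto
    finally show ?thesis using that by simp
  qed
  have "(\<Sum>i<m. w (Y i a) * E i j) = (\<Sum>i<m. w (Y i j) * E i a)"
    unfolding E_def sum_distrib_left
    by (subst sum.swap) (intro sum.cong refl, simp add: symS mult_ac)
  then have "E (idx \<iota> a) j = E (idx \<iota> j) a" using quad ea by simp
  also have "\<dots> = 0"
  proof -
    have "EqAY (idx \<iota> j) a \<in> red_eqs m n p \<iota>"
      using ea idx_less[OF \<iota>] idx_inj[OF \<iota>] by (auto simp: red_eqs_def feqs_def)
    then show ?thesis using red[of "EqAY (idx \<iota> j) a"] by (simp add: E_def)
  qed
  finally show ?thesis by (simp add: ea E_def)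
qed (rule red)

text \<open>A dependence solves the Lagrange equations with c = 0, so nondegeneracy kills the
  symmetrized matrix: Z Y^T + Y Z^T = 0. With \<open>Z_\<iota>\<close> the rows of Z in
  \<open>\<iota>\<close>, the columns in \<open>\<iota>\<close> give
  \<open>Z = - Y Z_\<iota>^T\<close>, and the block on \<open>\<iota>\<close> makes
  \<open>Z_\<iota>\<close> antisymmetric. The omitted equations make it triangular, hence zero, and
  Z with it.\<close>

lemma red_eqs_independent:
  assumes A: "symmetric_pencil A" "\<not> degenerate m n A" and \<iota>: "\<iota> \<in> index_sets m p"
    and w: "\<And>e. e \<in> feqs m n p \<Longrightarrow> feq m n A \<iota> e w = 0"
    and dep: "\<And>v. v \<in> xy_vars m n p \<Longrightarrow> (\<Sum>e\<in>red_eqs m n p \<iota>. b e * dfeq m n A \<iota> e v w) = 0"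
    and e: "e \<in> red_eqs m n p \<iota>"
  shows "b e = 0"
proof -
  define \<zeta> where "\<zeta> e = (if e \<in> red_eqs m n p \<iota> then b e else 0)" for e
  have sum_eq: "(\<Sum>e\<in>feqs m n p. \<zeta> e * dfeq m n A \<iota> e v w) = (\<Sum>e\<in>red_eqs m n p \<iota>. b e * dfeq m n A \<iota> e v w)" for v
    by (rule sum.mono_neutral_cong_right[OF finite_feqs red_eqs_subset]) (auto simp: \<zeta>_def)
  have gY: "(\<Sum>e\<in>feqs m n p. \<zeta> e * dfeq m n A \<iota> e (Y k j) w) = 0" if "k < m" "j < m - p" for k j
    unfolding sum_eq by (rule dep) (use that in \<open>auto simp: xy_vars_def\<close>)
  have gX: "(\<Sum>e\<in>feqs m n p. \<zeta> e * dfeq m n A \<iota> e (X l) w) = 0" if "l < n" for l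
    unfolding sum_eq by (rule dep) (use that in \<open>auto simp: xy_vars_def\<close>)
  let ?M = "mult_matrix (m - p) \<zeta> w"
  have "annihilator m n A (\<lambda>l. w (X l)) ?M" by (rule multipliers_annihilated(2)[OF A(1) \<iota> w gY])
  moreover have "\<forall>l<n. (\<Sum>i<m. \<Sum>k<m. A (Suc l,i,k) * ?M i k) = 0"
    using mult_matrix_pairing[OF A(1), where m = m and n = n and p = p and \<zeta> = \<zeta> and w = w and \<iota> = \<iota>] gX by simp
  ultimately have M0: "?M i k = 0" if "i < m" "k < m" for i k
    using A(2) that unfolding degenerate_def by blast
  have YI: "w (Y (idx \<iota> a) j) = (if a = j then 1 else 0)" if "a < m - p" "j < m - p" for a j
    using w[of "EqId a j"] that by (simp add: feqs_def)
  have key: "\<zeta> (EqAY i c) + (\<Sum>j<m - p. \<zeta> (EqAY (idx \<iota> c) j) * w (Y i j)) = 0" if "i < m" "c < m - p" for i c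
  proof -
    have "(\<Sum>j<m - p. \<zeta> (EqAY i j) * w (Y (idx \<iota> c) j)) = (\<Sum>j<m - p. if j = c then \<zeta> (EqAY i j) else 0)"
      using YI that by (intro sum.cong refl) auto
    then show ?thesis using M0[of i "idx \<iota> c"] that idx_less[OF \<iota>] by (simp add: mult_matrix_def)
  qed
  have T: "\<zeta> (EqAY (idx \<iota> a) c) + \<zeta> (EqAY (idx \<iota> c) a) = 0" if "a < m - p" "c < m - p" for a c
  proof -
    have "(\<Sum>j<m - p. \<zeta> (EqAY (idx \<iota> c) j) * w (Y (idx \<iota> a) j)) = (\<Sum>j<m - p. if j = a then \<zeta> (EqAY (idx \<iota> c) j) else 0)"
      using YI that by (intro sum.cong refl) auto
    then show ?thesis using key[of "idx \<iota> a" c] that idx_less[OF \<iota>] by simp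
  qed
  have low: "\<zeta> (EqAY (idx \<iota> a) j) = 0" if "j < a" "a < m - p" for a j
    using that by (auto simp: \<zeta>_def red_eqs_def)
  have T0: "\<zeta> (EqAY (idx \<iota> a) c) = 0" if "a < m - p" "c < m - p" for a c
  proof (cases a c rule: linorder_cases)
    case less
    then show ?thesis using T[OF that] low[of a c] that by simp
  next
    case equal
    then show ?thesis using T[OF that] by simp
  next
    case greater
    then show ?thesis using low that by simp
  qed
  have Z0: "\<zeta> (EqAY i c) = 0" if "i < m" "c < m - p" for i c
    using key[OF that] T0 that by simp
  have U0: "\<zeta> (EqId a j) = 0" if "a < m - p" "j < m - p" for a j
    by (rule multipliers_annihilated(1)[OF A(1) \<iota> w gY that])
  have "e \<in> feqs m n p" using e red_eqs_subset by blast
  then have "\<zeta> e = 0" using Z0 U0 by (cases e) (auto simp: feqs_def)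
  then show ?thesis using e by (simp add: \<zeta>_def)
qed

lemma polyfun_feq:
  assumes "K = UNIV \<or> K = \<rat> \<and> (\<forall>k i j. A (k,i,j) \<in> \<rat>)" "\<iota> \<in> index_sets m p" "e \<in> feqs m n p"
  shows "polyfun K (xy_vars m n p) (feq m n A \<iota> e)"
proof -
  have K: "A (k,i,j) \<in> K" "0 \<in> K" "1 \<in> K" "-1 \<in> K" for k i j using assms(1) by auto
  show ?thesis
  proof (cases e)
    case (EqAY i j)
    then have "j < m - p" using assms(3) by (auto simp: feqs_def)
    then have "polyfun K (xy_vars m n p) (\<lambda>w. \<Sum>k<m. Amat n A w i k * w (Y k j))"
      unfolding Amat_def by (intro polyfun_sum pf_mult pf_add pf_const pf_var K) (auto simp: xy_vars_def)
    moreover have "feq m n A \<iota> e = (\<lambda>w. \<Sum>k<m. Amat n A w i k * w (Y k j))"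
      by (simp add: fun_eq_iff EqAY)
    ultimately show ?thesis by simp
  next
    case (EqId a j)
    then have "a < m - p" "j < m - p" using assms(3) by (auto simp: feqs_def)
    then have "polyfun K (xy_vars m n p) (\<lambda>w. w (Y (idx \<iota> a) j) - (if a = j then 1 else 0))"
      using K idx_less[OF assms(2)] by (intro polyfun_diff pf_var polyfun_if pf_const) (auto simp: xy_vars_def)
    moreover have "feq m n A \<iota> e = (\<lambda>w. w (Y (idx \<iota> a) j) - (if a = j then 1 else 0))"
      by (simp add: fun_eq_iff EqId)
    ultimately show ?thesis by simp
  qed
qed

text \<open>The reduced equations cut out the set globally, so any radius serves, and their number
  does not depend on the point; this gives the common codimension.\<close>

theorem smooth_equidim_Vset:
  assumes A: "symmetric_pencil A" "\<not> degenerate m n A" and \<iota>: "\<iota> \<in> index_sets m p"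
  shows "smooth_equidim (xy_vars m n p) (Vset m n A p \<iota>)"
proof -
  have fin: "finite (red_eqs m n p \<iota>)" using finite_subset[OF red_eqs_subset finite_feqs] .
  obtain es where es: "set es = red_eqs m n p \<iota>" "distinct es"
    using finite_distinct_list[OF fin] by blast
  define gs where "gs = map (feq m n A \<iota>) es"
  have gs_nth: "gs ! i = feq m n A \<iota> (es ! i)" if "i < length es" for i
    using that by (simp add: gs_def)
  have indep: "a i = 0" if x: "x \<in> Vset m n A p \<iota>"
    and a: "\<forall>v\<in>xy_vars m n p. (\<Sum>i<length es. a i * pdiff (gs ! i) v x) = 0" and i: "i < length es" for x a i
  proof -
    define b where "b e = a (THE i. i < length es \<and> es ! i = e)" for e
    have b_nth: "b (es ! i) = a i" if "i < length es" for i
    proof -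
      have "(THE k. k < length es \<and> es ! k = es ! i) = i"
        using that es(2) by (intro the_equality) (auto simp: nth_eq_iff_index_eq)
      then show ?thesis by (simp add: b_def)
    qed
    have bij: "bij_betw ((!) es) {..<length es} (red_eqs m n p \<iota>)"
      by (rule bij_betw_nth) (use es in auto)
    have "(\<Sum>e\<in>red_eqs m n p \<iota>. b e * dfeq m n A \<iota> e v x) = 0" if "v \<in> xy_vars m n p" for v
    proof -
      have "(\<Sum>e\<in>red_eqs m n p \<iota>. b e * dfeq m n A \<iota> e v x) = (\<Sum>i<length es. b (es ! i) * dfeq m n A \<iota> (es ! i) v x)"
        by (rule sum.reindex_bij_betw[OF bij, symmetric])
      also have "\<dots> = (\<Sum>i<length es. a i * pdiff (gs ! i) v x)"
        by (intro sum.cong refl) (simp add: b_nth gs_nth pdiff_feq)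
      finally show ?thesis using a that by simp
    qed
    then have "b (es ! i) = 0"
      using x i es(1) by (intro red_eqs_independent[OF A \<iota>, of x b]) (auto simp: Vset_def)
    then show ?thesis using b_nth[OF i] by simp
  qed
  have cut: "y \<in> Vset m n A p \<iota> \<longleftrightarrow> (\<forall>g\<in>set gs. g y = 0)" if "y \<in> aff (xy_vars m n p)" for y
    using that feqs_if_red_eqs[OF A(1) \<iota>, of n y] red_eqs_subset[of m n p \<iota>] es(1)
    by (auto simp: Vset_def gs_def)
  have pf: "polyfun UNIV (xy_vars m n p) g \<and> (\<forall>y\<in>Vset m n A p \<iota>. g y = 0)" if "g \<in> set gs" for g
    using that polyfun_feq[of UNIV A \<iota> m p _ n] \<iota> es(1) red_eqs_subset[of m n p \<iota>]
    by (auto simp: gs_def Vset_def)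
  show ?thesis unfolding smooth_equidim_def
  proof (intro exI[of _ "length es"] ballI)
    fix x assume x: "x \<in> Vset m n A p \<iota>"
    show "\<exists>\<epsilon>>0. \<exists>gs. length gs = length es \<and>
      (\<forall>g\<in>set gs. polyfun UNIV (xy_vars m n p) g \<and> (\<forall>y\<in>Vset m n A p \<iota>. g y = 0)) \<and>
      (\<forall>a. (\<forall>v\<in>xy_vars m n p. (\<Sum>i<length es. a i * pdiff (gs ! i) v x) = 0) \<longrightarrow> (\<forall>i<length es. a i = 0)) \<and>
      (\<forall>y\<in>aff (xy_vars m n p). (\<forall>v\<in>xy_vars m n p. cmod (y v - x v) < \<epsilon>) \<longrightarrow>
          (y \<in> Vset m n A p \<iota>) = (\<forall>g\<in>set gs. g y = 0))"
      by (rule exI[of _ 1], rule conjI, simp, rule exI[of _ gs]) (use indep[OF x] cut pf in \<open>auto simp: gs_def\<close>)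
  qed
qed

subsection \<open>Lagrange multipliers by penalization\<close>

text \<open>A biorthogonal family, built in the manner of Gram-Schmidt. \<open>R\<close> is the new
  row minus its expansion in the old ones, nonzero at some \<open>v0\<close> by
  independence.\<close>

lemma dual_basis:
  fixes D :: "'e \<Rightarrow> 'v \<Rightarrow> 'a::field"
  assumes "finite E" "finite V"
    and "\<forall>a. (\<forall>v\<in>V. (\<Sum>e\<in>E. a e * D e v) = 0) \<longrightarrow> (\<forall>e\<in>E. a e = 0)"
  shows "\<exists>L. \<forall>e\<in>E. \<forall>e'\<in>E. (\<Sum>v\<in>V. L e v * D e' v) = (if e = e' then 1 else 0)"
  using assms(1,3)
proof (induction E)
  case (insert e0 E)
  have IH: "\<forall>a. (\<forall>v\<in>V. (\<Sum>e\<in>E. a e * D e v) = 0) \<longrightarrow> (\<forall>e\<in>E. a e = 0)"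
  proof (intro allI impI ballI)
    fix a e assume a: "\<forall>v\<in>V. (\<Sum>e\<in>E. a e * D e v) = 0" and e: "e \<in> E"
    have "(\<Sum>e\<in>insert e0 E. (a(e0 := 0)) e * D e v) = (\<Sum>e\<in>E. a e * D e v)" for v
      using insert.hyps by (auto intro!: sum.cong)
    then have "(a(e0 := 0)) e = 0" using spec[OF insert.prems, of "a(e0 := 0)"] a e by auto
    then show "a e = 0" using e insert.hyps by (auto split: if_splits)
  qed
  obtain L where L: "\<And>e e'. e \<in> E \<Longrightarrow> e' \<in> E \<Longrightarrow> (\<Sum>v\<in>V. L e v * D e' v) = (if e = e' then 1 else 0)"
    using insert.IH[OF IH] by blast
  define c where "c e = (\<Sum>v\<in>V. L e v * D e0 v)" for e
  define R where "R v = D e0 v - (\<Sum>e\<in>E. c e * D e v)" for v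
  have "\<exists>v0\<in>V. R v0 \<noteq> 0"
  proof (rule ccontr)
    assume "\<not> ?thesis"
    then have R0: "R v = 0" if "v \<in> V" for v using that by blast
    have "(\<Sum>e\<in>insert e0 E. (if e = e0 then 1 else - c e) * D e v) = R v" for v
    proof -
      have "(\<Sum>e\<in>E. (if e = e0 then 1 else - c e) * D e v) = (\<Sum>e\<in>E. - (c e * D e v))"
        using insert.hyps by (intro sum.cong) auto
      then show ?thesis using insert.hyps by (simp add: R_def sum_negf)
    qed
    then have "(if e0 = e0 then 1 else - c e0) = 0"
      using spec[OF insert.prems, of "\<lambda>e. if e = e0 then 1 else - c e"] R0 by simp
    then show False by simp
  qed
  then obtain v0 where v0: "v0 \<in> V" "R v0 \<noteq> 0" by blast
  \<comment> \<open>Evaluation at \<open>v0\<close> after subtracting the component along the old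
    rows: it kills these and, divided by \<open>R v0\<close>, is 1 on the new one.\<close>
  define L0 where "L0 v = ((if v = v0 then 1 else 0) - (\<Sum>e\<in>E. L e v * D e v0)) / R v0" for v
  have L0: "(\<Sum>v\<in>V. L0 v * h v) = (h v0 - (\<Sum>e\<in>E. (\<Sum>v\<in>V. L e v * h v) * D e v0)) / R v0" for h
  proof -
    have "(\<Sum>v\<in>V. L0 v * h v) = ((\<Sum>v\<in>V. (if v = v0 then h v else 0)) - (\<Sum>v\<in>V. \<Sum>e\<in>E. L e v * h v * D e v0)) / R v0"
      unfolding sum_subtractf[symmetric] sum_divide_distrib
      by (intro sum.cong refl)
        (simp add: L0_def left_diff_distrib right_diff_distrib sum_distrib_left sum_distrib_right mult_ac)
    also have "(\<Sum>v\<in>V. \<Sum>e\<in>E. L e v * h v * D e v0) = (\<Sum>e\<in>E. (\<Sum>v\<in>V. L e v * h v) * D e v0)"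
      by (subst sum.swap) (simp add: sum_distrib_right)
    finally show ?thesis using assms(2) v0(1) by simp
  qed
  have L0E: "(\<Sum>v\<in>V. L0 v * D e v) = 0" if "e \<in> E" for e
  proof -
    have "(\<Sum>e'\<in>E. (\<Sum>v\<in>V. L e' v * D e v) * D e' v0) = (\<Sum>e'\<in>E. if e' = e then D e v0 else 0)"
      using L that by (intro sum.cong refl) auto
    then show ?thesis using that insert.hyps by (simp add: L0)
  qed
  have L00: "(\<Sum>v\<in>V. L0 v * D e0 v) = 1"
    using v0(2) by (simp add: L0 c_def[symmetric]) (simp add: R_def)
  define L' where "L' e v = (if e = e0 then L0 v else L e v - c e * L0 v)" for e v
  have "(\<Sum>v\<in>V. L' e v * D e' v) = (if e = e' then 1 else 0)" if "e \<in> insert e0 E" "e' \<in> insert e0 E" for e e'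
  proof (cases "e = e0")
    case True
    then show ?thesis using that L0E L00 insert.hyps by (auto simp: L'_def)
  next
    case False
    then have eE: "e \<in> E" using that by auto
    have eq: "(\<Sum>v\<in>V. L' e v * D e' v) = (\<Sum>v\<in>V. L e v * D e' v) - c e * (\<Sum>v\<in>V. L0 v * D e' v)"
      using False by (simp add: L'_def left_diff_distrib sum_subtractf sum_distrib_left mult.assoc)
    show ?thesis
    proof (cases "e' = e0")
      case True
      then show ?thesis unfolding eq using False L00 by (simp add: c_def)
    next
      case False
      then show ?thesis unfolding eq using that L L0E eE by auto
    qed
  qed
  then show ?case by blast
qed auto

text \<open>Coordinates outside \<open>V\<close> are frozen at singletons, so Tychonoff's theorem
  applies although the type of variables may be infinite.\<close>

lemma compact_box:
  fixes w0 :: "'v \<Rightarrow> real"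
  shows "compact {w. (\<forall>v\<in>V. \<bar>w v - w0 v\<bar> \<le> d) \<and> (\<forall>v. v \<notin> V \<longrightarrow> w v = w0 v)}"
proof -
  let ?B = "\<lambda>v. if v \<in> V then {w0 v - d..w0 v + d} else {w0 v}"
  have "compactin (product_topology (\<lambda>_::'v. euclidean :: real topology) UNIV) (PiE UNIV ?B)"
    by (subst compactin_PiE) (auto simp: compactin_euclidean_iff)
  then have "compact (PiE UNIV ?B)" by (simp add: euclidean_product_topology compactin_euclidean_iff)
  moreover have "PiE UNIV ?B = {w. (\<forall>v\<in>V. \<bar>w v - w0 v\<bar> \<le> d) \<and> (\<forall>v. v \<notin> V \<longrightarrow> w v = w0 v)}"
    by (auto simp: PiE_iff abs_le_iff split: if_splits) (smt (verit) singletonD)+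
  ultimately show ?thesis by simp
qed

lemma DERIV_coordinate:
  "((\<lambda>t. (w(v := t)) u) has_real_derivative (if u = v then 1 else 0)) (at s)"
  by (cases "u = v") auto

text \<open>Minimize \<open>\<langle>b, w\<rangle> + |w - w0|\<^sup>2 + k \<Sum> f\<^sub>e(w)\<^sup>2\<close> on a small box around \<open>w0\<close>: for large \<open>k\<close> the minimizer
  is an interior point.\<close>
lemma penalized_stationary_point:
  fixes f :: "'e \<Rightarrow> ('v \<Rightarrow> real) \<Rightarrow> real"
  assumes fin: "finite E" "finite V"
    and cont: "\<And>e. e \<in> E \<Longrightarrow> continuous_on UNIV (f e)"
    and deriv: "\<And>e v w. e \<in> E \<Longrightarrow> v \<in> V \<Longrightarrow> ((\<lambda>t. f e (w(v := t))) has_real_derivative f' e v w) (at (w v))"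
    and zero: "\<And>e. e \<in> E \<Longrightarrow> f e w0 = 0" and \<delta>: "\<delta> > 0"
    and locmin: "\<And>w. (\<forall>v\<in>V. \<bar>w v - w0 v\<bar> \<le> \<delta>) \<Longrightarrow> (\<forall>v. v \<notin> V \<longrightarrow> w v = w0 v) \<Longrightarrow>
       (\<forall>e\<in>E. f e w = 0) \<Longrightarrow> (\<Sum>v\<in>V. b v * w0 v) \<le> (\<Sum>v\<in>V. b v * w v)"
  shows "\<exists>w z. (\<forall>v\<in>V. \<bar>w v - w0 v\<bar> < \<delta>) \<and> (\<forall>v. v \<notin> V \<longrightarrow> w v = w0 v) \<and>
    (\<forall>v\<in>V. b v + 2 * (w v - w0 v) + (\<Sum>e\<in>E. z e * f' e v w) = 0)"
proof -
  define F where "F w = (\<Sum>v\<in>V. b v * w v)" for w :: "'v \<Rightarrow> real"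
  define N where "N w = (\<Sum>v\<in>V. (w v - w0 v)\<^sup>2)" for w :: "'v \<Rightarrow> real"
  define \<Phi> where "\<Phi> w = (\<Sum>e\<in>E. (f e w)\<^sup>2)" for w
  define G where "G k w = F w + N w + real k * \<Phi> w" for k w
  have contG: "continuous_on UNIV (G k)" for k
    unfolding G_def F_def N_def \<Phi>_def
    by (intro continuous_intros cont continuous_on_product_coordinates) auto
  have \<Phi>0: "\<Phi> w \<ge> 0" for w by (simp add: \<Phi>_def sum_nonneg)
  define Bx where "Bx = {w. (\<forall>v\<in>V. \<bar>w v - w0 v\<bar> \<le> \<delta>) \<and> (\<forall>v. v \<notin> V \<longrightarrow> w v = w0 v)}"
  have Bx: "compact Bx" unfolding Bx_def by (rule compact_box)
  \<comment> \<open>The part of the box where some coordinate reaches the maximal distance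
    \<open>\<delta>\<close>. A minimizer over the box that avoids it is interior in all directions
    of \<open>V\<close>.\<close>
  define K where "K = Bx \<inter> (\<Union>v\<in>V. {w. \<delta> \<le> \<bar>w v - w0 v\<bar>})"
  have "closed (\<Union>v\<in>V. {w. \<delta> \<le> \<bar>w v - w0 v\<bar>})"
    using fin(2)
    by (intro closed_UN ballI closed_Collect_le continuous_intros continuous_on_product_coordinates) auto
  then have K: "compact K" unfolding K_def using Bx by (rule compact_Int_closed[rotated])
  have w0G: "G k w0 = F w0" for k using zero by (simp add: G_def N_def \<Phi>_def)
  \<comment> \<open>On \<open>K\<close> either a constraint fails and a large penalty wins, or all
    hold and local minimality together with the positive term \<open>N w\<close> wins. The open sets
    so obtained increase with \<open>k\<close>, so compactness yields a single
    \<open>k\<close>.\<close>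
  have "\<exists>k. \<forall>w\<in>K. F w0 < G k w"
  proof -
    have op: "open {w. F w0 < G k w}" for k
      by (intro open_Collect_less contG continuous_on_const)
    have cov: "K \<subseteq> (\<Union>k\<in>UNIV. {w. F w0 < G k w})"
    proof
      fix w assume w: "w \<in> K"
      then obtain v where v: "v \<in> V" "\<delta> \<le> \<bar>w v - w0 v\<bar>" by (auto simp: K_def)
      have "0 < (w v - w0 v)\<^sup>2" using v(2) \<delta> by auto
      also have "\<dots> \<le> N w" unfolding N_def using v(1) fin(2) by (intro member_le_sum) auto
      finally have N: "N w > 0" .
      show "w \<in> (\<Union>k\<in>UNIV. {w. F w0 < G k w})"
      proof (cases "\<Phi> w = 0")
        case True
        then have "\<forall>e\<in>E. f e w = 0" using fin(1) by (simp add: \<Phi>_def sum_nonneg_eq_0_iff)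
        then have "F w0 \<le> F w" unfolding F_def using w by (intro locmin) (auto simp: K_def Bx_def)
        then have "F w0 < G 0 w" using N by (simp add: G_def)
        then show ?thesis by blast
      next
        case False
        then have pos: "\<Phi> w > 0" using \<Phi>0[of w] by simp
        obtain k :: nat where "(F w0 - F w) / \<Phi> w < real k" using reals_Archimedean2 by blast
        then have "F w0 - F w < real k * \<Phi> w" using pos by (simp add: field_simps)
        then have "F w0 < G k w" using N by (simp add: G_def)
        then show ?thesis by blast
      qed
    qed
    obtain C where C: "finite C" "K \<subseteq> (\<Union>k\<in>C. {w. F w0 < G k w})"
      by (rule compactE_image[OF K op cov])
    have "F w0 < G (Max C) w" if w: "w \<in> K" for w
    proof -
      obtain k where k: "k \<in> C" "F w0 < G k w" using C(2) w by blast
      then have "real k * \<Phi> w \<le> real (Max C) * \<Phi> w"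
        using C(1) \<Phi>0 by (intro mult_right_mono) auto
      then show ?thesis using k by (simp add: G_def)
    qed
    then show ?thesis by blast
  qed
  then obtain k where k: "\<And>w. w \<in> K \<Longrightarrow> F w0 < G k w" by blast
  have w0B: "w0 \<in> Bx" using \<delta> by (simp add: Bx_def)
  then obtain w where w: "w \<in> Bx" "\<And>y. y \<in> Bx \<Longrightarrow> G k w \<le> G k y"
    using continuous_attains_inf[OF Bx _ continuous_on_subset[OF contG]] by blast
  have "w \<notin> K" using k[of w] w(2)[OF w0B] w0G by force
  then have int: "\<bar>w v - w0 v\<bar> < \<delta>" if "v \<in> V" for v using that w(1) by (force simp: K_def)
  define z where "z e = 2 * real k * f e w" for e
  have "b v + 2 * (w v - w0 v) + (\<Sum>e\<in>E. z e * f' e v w) = 0" if v: "v \<in> V" for v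
  proof -
    have dF: "((\<lambda>t. b u * (w(v := t)) u) has_real_derivative b u * (if u = v then 1 else 0)) (at (w v))" for u
      by (rule DERIV_cmult) (rule DERIV_coordinate)
    have dN: "((\<lambda>t. ((w(v := t)) u - w0 u)\<^sup>2) has_real_derivative 2 * (w u - w0 u) * (if u = v then 1 else 0)) (at (w v))" for u
      by (cases "u = v") (auto intro!: derivative_eq_intros)
    have d\<Phi>: "((\<lambda>t. (f e (w(v := t)))\<^sup>2) has_real_derivative 2 * f e w * f' e v w) (at (w v))" if "e \<in> E" for e
      using DERIV_power[OF deriv[OF that v, of w], of 2] by (simp add: mult_ac)
    have "((\<lambda>t. G k (w(v := t))) has_real_derivative
        (\<Sum>u\<in>V. b u * (if u = v then 1 else 0)) + (\<Sum>u\<in>V. 2 * (w u - w0 u) * (if u = v then 1 else 0))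
        + real k * (\<Sum>e\<in>E. 2 * f e w * f' e v w)) (at (w v))"
      unfolding G_def F_def N_def \<Phi>_def
      by (intro DERIV_add DERIV_sum DERIV_cmult[of _ _ _ _ "real k"] dF dN d\<Phi>)
    moreover have "\<forall>y. \<bar>w v - y\<bar> < \<delta> - \<bar>w v - w0 v\<bar> \<longrightarrow> G k (w(v := w v)) \<le> G k (w(v := y))"
    proof (intro allI impI)
      fix y assume y: "\<bar>w v - y\<bar> < \<delta> - \<bar>w v - w0 v\<bar>"
      then have "w(v := y) \<in> Bx" using w(1) v by (auto simp: Bx_def)
      then show "G k (w(v := w v)) \<le> G k (w(v := y))" using w(2) by simp
    qed
    ultimately have "(\<Sum>u\<in>V. b u * (if u = v then 1 else 0)) + (\<Sum>u\<in>V. 2 * (w u - w0 u) * (if u = v then 1 else 0))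
        + real k * (\<Sum>e\<in>E. 2 * f e w * f' e v w) = 0"
      using int[OF v] by (intro DERIV_local_min) auto
    moreover have "(\<Sum>u\<in>V. b u * (if u = v then 1 else 0)) = b v"
      using fin(2) v by (subst sum.remove[of _ v]) (auto intro!: sum.neutral)
    moreover have "(\<Sum>u\<in>V. 2 * (w u - w0 u) * (if u = v then 1 else 0)) = 2 * (w v - w0 v)"
      using fin(2) v by (subst sum.remove[of _ v]) (auto intro!: sum.neutral)
    moreover have "real k * (\<Sum>e\<in>E. 2 * f e w * f' e v w) = (\<Sum>e\<in>E. z e * f' e v w)"
      by (simp add: z_def sum_distrib_left mult_ac)
    ultimately show ?thesis by simp
  qed
  then show ?thesis using int w(1) by (intro exI[of _ w] exI[of _ z]) (auto simp: Bx_def)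
qed

text \<open>Penalized stationary points in shrinking boxes converge to \<open>w0\<close>. Tested
  against the dual basis of the gradients at \<open>w0\<close>, stationarity becomes a linear system
  for the multipliers whose matrix \<open>Nk\<close> tends to the identity and whose right-hand side
  \<open>y\<close> converges. So the multipliers converge too, and the condition passes to the
  limit.\<close>

theorem lagrange_multipliers:
  fixes f :: "'e \<Rightarrow> ('v \<Rightarrow> real) \<Rightarrow> real"
  assumes fin: "finite E" "finite V"
    and cont: "\<And>e. e \<in> E \<Longrightarrow> continuous_on UNIV (f e)"
    and deriv: "\<And>e v w. e \<in> E \<Longrightarrow> v \<in> V \<Longrightarrow> ((\<lambda>t. f e (w(v := t))) has_real_derivative f' e v w) (at (w v))"
    and lim: "\<And>e v W. e \<in> E \<Longrightarrow> v \<in> V \<Longrightarrow> (\<And>u. (\<lambda>k. W k u) \<longlonglongrightarrow> w0 u) \<Longrightarrow> (\<lambda>k. f' e v (W k)) \<longlonglongrightarrow> f' e v w0"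
    and zero: "\<And>e. e \<in> E \<Longrightarrow> f e w0 = 0" and \<epsilon>: "\<epsilon> > 0"
    and locmin: "\<And>w. (\<forall>v\<in>V. \<bar>w v - w0 v\<bar> \<le> \<epsilon>) \<Longrightarrow> (\<forall>v. v \<notin> V \<longrightarrow> w v = w0 v) \<Longrightarrow>
       (\<forall>e\<in>E. f e w = 0) \<Longrightarrow> (\<Sum>v\<in>V. b v * w0 v) \<le> (\<Sum>v\<in>V. b v * w v)"
    and indep: "\<forall>a. (\<forall>v\<in>V. (\<Sum>e\<in>E. a e * f' e v w0) = 0) \<longrightarrow> (\<forall>e\<in>E. a e = 0)"
  shows "\<exists>z. \<forall>v\<in>V. b v + (\<Sum>e\<in>E. z e * f' e v w0) = 0"
proof -
  obtain L where L: "\<And>e e'. e \<in> E \<Longrightarrow> e' \<in> E \<Longrightarrow> (\<Sum>v\<in>V. L e v * f' e' v w0) = (if e = e' then 1 else 0)"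
    using dual_basis[where D = "\<lambda>e v. f' e v w0", OF fin indep] by blast
  have "\<forall>k. \<exists>w z. (\<forall>v\<in>V. \<bar>w v - w0 v\<bar> < \<epsilon> / real (Suc k)) \<and> (\<forall>v. v \<notin> V \<longrightarrow> w v = w0 v) \<and>
    (\<forall>v\<in>V. b v + 2 * (w v - w0 v) + (\<Sum>e\<in>E. z e * f' e v w) = 0)"
  proof (intro allI penalized_stationary_point[OF fin cont deriv zero])
    fix k w assume "\<forall>v\<in>V. \<bar>w v - w0 v\<bar> \<le> \<epsilon> / real (Suc k)" and w: "\<forall>v. v \<notin> V \<longrightarrow> w v = w0 v" "\<forall>e\<in>E. f e w = 0"
    moreover have "\<epsilon> / real (Suc k) \<le> \<epsilon>" using \<epsilon> by (simp add: field_simps)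
    ultimately show "(\<Sum>v\<in>V. b v * w0 v) \<le> (\<Sum>v\<in>V. b v * w v)" by (intro locmin) force+
  qed (use \<epsilon> in auto)
  from choice[OF this] obtain W where
    "\<forall>k. \<exists>z. (\<forall>v\<in>V. \<bar>W k v - w0 v\<bar> < \<epsilon> / real (Suc k)) \<and> (\<forall>v. v \<notin> V \<longrightarrow> W k v = w0 v) \<and>
      (\<forall>v\<in>V. b v + 2 * (W k v - w0 v) + (\<Sum>e\<in>E. z e * f' e v (W k)) = 0)" by (rule exE)
  from choice[OF this] obtain z where Wz0:
    "\<forall>k. (\<forall>v\<in>V. \<bar>W k v - w0 v\<bar> < \<epsilon> / real (Suc k)) \<and> (\<forall>v. v \<notin> V \<longrightarrow> W k v = w0 v) \<and>
      (\<forall>v\<in>V. b v + 2 * (W k v - w0 v) + (\<Sum>e\<in>E. z k e * f' e v (W k)) = 0)" by (rule exE)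
  have Wz: "\<And>k v. v \<in> V \<Longrightarrow> \<bar>W k v - w0 v\<bar> < \<epsilon> / real (Suc k)"
      "\<And>k v. v \<notin> V \<Longrightarrow> W k v = w0 v"
      "\<And>k v. v \<in> V \<Longrightarrow> b v + 2 * (W k v - w0 v) + (\<Sum>e\<in>E. z k e * f' e v (W k)) = 0"
    using Wz0 by blast+
  have W: "(\<lambda>k. W k v) \<longlonglongrightarrow> w0 v" for v
  proof (cases "v \<in> V")
    case True
    have "(\<lambda>k. \<epsilon> / real (Suc k)) \<longlonglongrightarrow> 0"
      using tendsto_mult[OF tendsto_const[of \<epsilon>] LIMSEQ_inverse_real_of_nat] by (simp add: field_simps)
    then have "(\<lambda>k. W k v - w0 v) \<longlonglongrightarrow> 0"
      by (rule Lim_null_comparison[rotated]) (use Wz(1)[OF True] in \<open>auto intro!: always_eventually less_imp_le\<close>)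
    then show ?thesis by (simp add: LIM_zero_iff)
  qed (simp add: Wz)
  have D: "(\<lambda>k. f' e v (W k)) \<longlonglongrightarrow> f' e v w0" if "e \<in> E" "v \<in> V" for e v by (rule lim[OF that W])
  define Nk where "Nk k e e' = (\<Sum>v\<in>V. L e v * f' e' v (W k))" for k e e'
  have Nk: "(\<lambda>k. Nk k e e') \<longlonglongrightarrow> (if e = e' then 1 else 0)" if "e \<in> E" "e' \<in> E" for e e'
    unfolding Nk_def L[OF that, symmetric] by (intro tendsto_intros D that)
  define y where "y k e = - (\<Sum>v\<in>V. L e v * (b v + 2 * (W k v - w0 v)))" for k e
  define zs where "zs e = - (\<Sum>v\<in>V. L e v * b v)" for e
  have y: "(\<lambda>k. y k e) \<longlonglongrightarrow> zs e" for e
  proof -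
    have "(\<lambda>k. y k e) \<longlonglongrightarrow> - (\<Sum>v\<in>V. L e v * (b v + 2 * (w0 v - w0 v)))"
      unfolding y_def by (intro tendsto_intros W)
    then show ?thesis by (simp add: zs_def)
  qed
  have Nz: "(\<Sum>e'\<in>E. Nk k e e' * z k e') = y k e" for k e
  proof -
    have "(\<Sum>e'\<in>E. Nk k e e' * z k e') = (\<Sum>v\<in>V. L e v * (\<Sum>e'\<in>E. z k e' * f' e' v (W k)))"
      unfolding Nk_def sum_distrib_left sum_distrib_right
      by (subst sum.swap) (simp add: mult_ac)
    also have "\<dots> = (\<Sum>v\<in>V. - (L e v * (b v + 2 * (W k v - w0 v))))"
    proof (rule sum.cong[OF refl])
      fix v assume "v \<in> V"
      then have "(\<Sum>e'\<in>E. z k e' * f' e' v (W k)) = - (b v + 2 * (W k v - w0 v))" using Wz(3)[of v k] by simp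
      then show "L e v * (\<Sum>e'\<in>E. z k e' * f' e' v (W k)) = - (L e v * (b v + 2 * (W k v - w0 v)))"
        by (simp only: mult_minus_right)
    qed
    finally show ?thesis by (simp add: y_def sum_negf)
  qed
  define s where "s k = (\<Sum>e\<in>E. \<bar>z k e\<bar>)" for k
  \<comment> \<open>The distance of \<open>Nk\<close> from the identity. The size \<open>s k\<close>
    of the multipliers is at most that of \<open>y k\<close> plus \<open>\<eta> k * s k\<close>, so
    it is bounded once \<open>\<eta> k < 1 / 2\<close>, and the error \<open>\<eta> k * s k\<close>
    tends to zero.\<close>
  define \<eta> where "\<eta> k = (\<Sum>e\<in>E. \<Sum>e'\<in>E. \<bar>Nk k e e' - (if e = e' then 1 else 0)\<bar>)" for k
  have \<eta>: "\<eta> \<longlonglongrightarrow> 0"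
  proof -
    have "\<eta> \<longlonglongrightarrow> (\<Sum>e\<in>E. \<Sum>e'\<in>E. \<bar>(if e = e' then 1 else 0) - (if e = e' then 1 else 0 :: real)\<bar>)"
      unfolding \<eta>_def by (intro tendsto_intros Nk)
    then show ?thesis by simp
  qed
  have s0: "s k \<ge> 0" and zs_le: "e \<in> E \<Longrightarrow> \<bar>z k e\<bar> \<le> s k" for k e
    using fin(1) by (auto simp: s_def sum_nonneg intro!: member_le_sum)
  have diff: "\<bar>z k e - y k e\<bar> \<le> (\<Sum>e'\<in>E. \<bar>Nk k e e' - (if e = e' then 1 else 0)\<bar>) * s k" if e: "e \<in> E" for k e
  proof -
    have "(\<Sum>e'\<in>E. (if e = e' then 1 else 0) * z k e') = z k e"
      using fin(1) e by (subst sum.remove[of _ e]) (auto intro!: sum.neutral split: if_splits)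
    then have "y k e - z k e = (\<Sum>e'\<in>E. (Nk k e e' - (if e = e' then 1 else 0)) * z k e')"
      by (simp add: Nz[symmetric] left_diff_distrib sum_subtractf)
    then have "\<bar>z k e - y k e\<bar> \<le> (\<Sum>e'\<in>E. \<bar>(Nk k e e' - (if e = e' then 1 else 0)) * z k e'\<bar>)"
      by (metis abs_minus_commute sum_abs)
    also have "\<dots> \<le> (\<Sum>e'\<in>E. \<bar>Nk k e e' - (if e = e' then 1 else 0)\<bar> * s k)"
      by (intro sum_mono) (auto simp: abs_mult intro!: mult_left_mono zs_le)
    finally show ?thesis by (simp add: sum_distrib_right)
  qed
  have s_le: "s k \<le> (\<Sum>e\<in>E. \<bar>y k e\<bar>) + \<eta> k * s k" for k
  proof -
    have "(\<Sum>e\<in>E. \<bar>z k e\<bar>) \<le> (\<Sum>e\<in>E. \<bar>y k e\<bar> + (\<Sum>e'\<in>E. \<bar>Nk k e e' - (if e = e' then 1 else 0)\<bar>) * s k)"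
    proof (rule sum_mono)
      fix e assume "e \<in> E"
      from diff[OF this, of k]
      show "\<bar>z k e\<bar> \<le> \<bar>y k e\<bar> + (\<Sum>e'\<in>E. \<bar>Nk k e e' - (if e = e' then 1 else 0)\<bar>) * s k" by linarith
    qed
    also have "\<dots> = (\<Sum>e\<in>E. \<bar>y k e\<bar>) + \<eta> k * s k" by (simp add: sum.distrib \<eta>_def sum_distrib_right)
    finally show ?thesis by (simp only: s_def[of k, symmetric])
  qed
  have "(\<lambda>k. \<eta> k * s k) \<longlonglongrightarrow> 0"
  proof -
    have Y: "(\<lambda>k. \<Sum>e\<in>E. \<bar>y k e\<bar>) \<longlonglongrightarrow> (\<Sum>e\<in>E. \<bar>zs e\<bar>)" by (intro tendsto_intros y)
    have "(\<lambda>k. 2 * \<eta> k * (\<Sum>e\<in>E. \<bar>y k e\<bar>)) \<longlonglongrightarrow> 2 * 0 * (\<Sum>e\<in>E. \<bar>zs e\<bar>)"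
      by (intro tendsto_intros \<eta> Y)
    then have lim0: "(\<lambda>k. 2 * \<eta> k * (\<Sum>e\<in>E. \<bar>y k e\<bar>)) \<longlonglongrightarrow> 0" by simp
    have ev: "\<forall>\<^sub>F k in sequentially. \<eta> k < 1 / 2" by (rule order_tendstoD(2)[OF \<eta>]) simp
    have \<eta>0: "\<eta> k \<ge> 0" for k by (simp add: \<eta>_def sum_nonneg)
    have "\<forall>\<^sub>F k in sequentially. norm (\<eta> k * s k) \<le> 2 * \<eta> k * (\<Sum>e\<in>E. \<bar>y k e\<bar>)"
      using ev
    proof eventually_elim
      case (elim k)
      have "\<eta> k * s k \<le> s k / 2" using elim s0[of k] mult_right_mono[of "\<eta> k" "1/2" "s k"] by simp
      then have "s k \<le> 2 * (\<Sum>e\<in>E. \<bar>y k e\<bar>)" using s_le[of k] by simp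
      then have "\<eta> k * s k \<le> \<eta> k * (2 * (\<Sum>e\<in>E. \<bar>y k e\<bar>))" using \<eta>0 by (rule mult_left_mono)
      then show ?case using \<eta>0[of k] s0[of k] by (simp add: abs_mult mult_ac)
    qed
    then show ?thesis using lim0 by (rule Lim_null_comparison)
  qed
  then have zlim: "(\<lambda>k. z k e) \<longlonglongrightarrow> zs e" if e: "e \<in> E" for e
  proof -
    have "norm (z k e - y k e) \<le> \<eta> k * s k" for k
    proof -
      have "(\<Sum>e'\<in>E. \<bar>Nk k e e' - (if e = e' then 1 else 0)\<bar>) \<le> \<eta> k"
        unfolding \<eta>_def using fin(1) e by (intro member_le_sum[of e E "\<lambda>e. \<Sum>e'\<in>E. \<bar>Nk k e e' - (if e = e' then 1 else 0)\<bar>"]) (auto intro: sum_nonneg)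
      then show ?thesis using diff[OF e, of k] mult_right_mono[OF _ s0[of k]] by fastforce
    qed
    then have "(\<lambda>k. z k e - y k e) \<longlonglongrightarrow> 0"
      by (intro Lim_null_comparison[OF _ \<open>(\<lambda>k. \<eta> k * s k) \<longlonglongrightarrow> 0\<close>]) auto
    from tendsto_add[OF this y[of e]] show ?thesis by simp
  qed
  have "b v + (\<Sum>e\<in>E. zs e * f' e v w0) = 0" if v: "v \<in> V" for v
  proof -
    have "(\<lambda>k. b v + 2 * (W k v - w0 v) + (\<Sum>e\<in>E. z k e * f' e v (W k))) \<longlonglongrightarrow>
        b v + 2 * (w0 v - w0 v) + (\<Sum>e\<in>E. zs e * f' e v w0)"
      by (intro tendsto_intros W zlim D v)
    then have "(\<lambda>k::nat. 0) \<longlonglongrightarrow> b v + (\<Sum>e\<in>E. zs e * f' e v w0)" using Wz(3)[OF v] by simp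
    then show ?thesis by (metis LIMSEQ_const_iff)
  qed
  then show ?thesis by blast
qed

subsection \<open>Rank-constrained minimizers\<close>

text \<open>\<open>mat_rank\<close> is a column rank; symmetry turns the rows indexed by
  \<open>J\<close> into columns. Equal columns would be a dependence, so passing to the set of
  columns keeps the cardinality.\<close>

lemma mat_rank_ge:
  fixes S :: "nat \<Rightarrow> nat \<Rightarrow> real"
  assumes sym: "\<And>i k. i < m \<Longrightarrow> k < m \<Longrightarrow> S i k = S k i" and J: "J \<subseteq> {..<m}"
    and indep: "\<forall>a. (\<forall>k<m. (\<Sum>j\<in>J. a j * S j k) = 0) \<longrightarrow> (\<forall>j\<in>J. a j = 0)"
  shows "card J \<le> mat_rank m S"
proof -
  interpret vs: vec_space "TYPE(real)" m .
  define M where "M = Matrix.mat m m (\<lambda>(i,j). S i j)"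
  have M: "M \<in> carrier_mat m m" by (simp add: M_def)
  have fin: "finite J" using J finite_subset by blast
  have col: "col M j $ k = S k j" if "j < m" "k < m" for j k using that by (simp add: M_def)
  have inj: "inj_on (col M) J"
  proof (rule inj_onI, rule ccontr)
    fix i j assume ij: "i \<in> J" "j \<in> J" "col M i = col M j" "i \<noteq> j"
    have "(\<Sum>l\<in>J. (if l = i then 1 else if l = j then -1 else 0) * S l k) = 0" if "k < m" for k
    proof -
      have "(\<Sum>l\<in>J. (if l = i then 1 else if l = j then -1 else 0) * S l k) =
          (\<Sum>l\<in>J. (if l = i then S l k else 0) - (if l = j then S l k else 0))"
        using ij(4) by (intro sum.cong) auto
      also have "\<dots> = S i k - S j k" using fin ij by (simp add: sum_subtractf)
      also have "S i k = S k i" using sym ij J that by auto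
      also have "S j k = S k j" using sym ij J that by auto
      also have "S k i - S k j = 0"
      proof -
        have "i < m" "j < m" using ij J by auto
        then show ?thesis using col[of i k] col[of j k] ij(3) that by simp
      qed
      finally show ?thesis .
    qed
    then show False using indep[rule_format, of "\<lambda>l. if l = i then 1 else if l = j then -1 else 0" i] ij by auto
  qed
  have sub: "col M ` J \<subseteq> set (cols M)" using J M by (auto simp: cols_def)
  have carr: "col M ` J \<subseteq> carrier_vec m" using M by auto
  have "vs.lin_indpt (col M ` J)"
  proof (rule vs.finite_lin_indpt2, goal_cases)
    case 1
    show ?case using fin by simp
  next
    case 2
    show ?case using carr by simp
  next
    case (3 a)
    have a: "vs.lincomb a (col M ` J) = 0\<^sub>v m" using 3(2) by simp
    have "(\<Sum>j\<in>J. a (col M j) * S j k) = 0" if "k < m" for k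
    proof -
      have "0 = vs.lincomb a (col M ` J) $ k" using a that by simp
      also have "\<dots> = (\<Sum>x\<in>col M ` J. a x * x $ k)" by (rule vs.lincomb_index[OF that carr])
      also have "\<dots> = (\<Sum>j\<in>J. a (col M j) * col M j $ k)" by (simp add: sum.reindex[OF inj])
      also have "\<dots> = (\<Sum>j\<in>J. a (col M j) * S j k)"
      proof (rule sum.cong[OF refl])
        fix j assume "j \<in> J"
        then have j: "j < m" using J by auto
        then show "a (col M j) * col M j $ k = a (col M j) * S j k"
          using col[OF j that] sym[OF j that] by simp
      qed
      finally show ?thesis by simp
    qed
    then have "\<forall>k<m. (\<Sum>j\<in>J. a (col M j) * S j k) = 0" by blast
    then have "\<forall>j\<in>J. a (col M j) = 0" by (rule spec[OF indep, of "\<lambda>j. a (col M j)", THEN mp])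
    then show ?case by (simp add: class_ring_simps)
  qed
  from vs.rank_ge_card_indpt[OF M sub this]
  show ?thesis using card_image[OF inj] by (simp add: mat_rank_def M_def)
qed

text \<open>If a maximal independent set of columns had more than \<open>card J\<close> elements,
  their coefficient vectors would satisfy a nontrivial relation by
  \<open>underdetermined_system\<close>, and the columns would inherit it.\<close>

lemma mat_rank_le:
  fixes S :: "nat \<Rightarrow> nat \<Rightarrow> real"
  assumes J: "J \<subseteq> {..<m}" and span: "\<And>i k. i < m \<Longrightarrow> k < m \<Longrightarrow> S k i = (\<Sum>j\<in>J. T i j * S k j)"
  shows "mat_rank m S \<le> card J"
proof -
  interpret vs: vec_space "TYPE(real)" m .
  define M where "M = Matrix.mat m m (\<lambda>(i,j). S i j)"
  have M: "M \<in> carrier_mat m m" by (simp add: M_def)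
  have fin: "finite J" using J finite_subset by blast
  have cols: "set (cols M) \<subseteq> carrier_vec m" using cols_dim[of M] M by auto
  obtain U where max: "maximal U (\<lambda>T. T \<subseteq> set (cols M) \<and> vs.lin_indpt T)"
    using maximal_exists[of "\<lambda>T. T \<subseteq> set (cols M) \<and> vs.lin_indpt T" "card (set (cols M))" "{}"]
    by (meson List.finite_set card_mono empty_iff empty_subsetI vs.finite_lin_indpt2 rev_finite_subset)
  then have U: "U \<subseteq> set (cols M)" "vs.lin_indpt U" by (auto simp: maximal_def)
  have finU: "finite U" using U(1) finite_subset by blast
  have carr: "U \<subseteq> carrier_vec m" using U(1) cols by blast
  have "\<forall>u\<in>U. \<exists>i<m. u = col M i"
    using U(1) M by (fastforce simp: cols_def)
  then obtain ix where ix: "\<And>u. u \<in> U \<Longrightarrow> ix u < m" "\<And>u. u \<in> U \<Longrightarrow> u = col M (ix u)" by metis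
  have entry: "u $ k = (\<Sum>j\<in>J. T (ix u) j * S k j)" if "u \<in> U" "k < m" for u k
  proof -
    have "u $ k = S k (ix u)" using ix[OF that(1)] that(2) by (metis M_def index_col index_mat(1) dim_row_mat(1) dim_col_mat(1) case_prod_conv)
    then show ?thesis using span ix(1)[OF that(1)] that(2) by simp
  qed
  have "card U \<le> card J"
  proof (rule ccontr)
    assume "\<not> card U \<le> card J"
    then obtain x where x: "\<exists>u\<in>U. x u \<noteq> 0" "\<forall>j\<in>J. (\<Sum>u\<in>U. x u * T (ix u) j) = 0"
      using underdetermined_system[OF fin finU, of "\<lambda>u j. T (ix u) j"] by auto
    have "vs.lincomb x U = 0\<^sub>v m"
    proof (rule eq_vecI)
      fix k assume "k < dim_vec (0\<^sub>v m :: real vec)"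
      then have k: "k < m" by simp
      have "vs.lincomb x U $ k = (\<Sum>u\<in>U. x u * u $ k)" by (rule vs.lincomb_index[OF k carr])
      also have "\<dots> = (\<Sum>u\<in>U. \<Sum>j\<in>J. x u * T (ix u) j * S k j)"
        using entry k by (intro sum.cong refl) (simp add: sum_distrib_left mult.assoc)
      also have "\<dots> = (\<Sum>j\<in>J. (\<Sum>u\<in>U. x u * T (ix u) j) * S k j)"
        by (subst sum.swap) (simp add: sum_distrib_right)
      also have "\<dots> = 0" using x(2) by simp
      finally show "vs.lincomb x U $ k = 0\<^sub>v m $ k" using k by simp
    next
      show "dim_vec (vs.lincomb x U) = dim_vec (0\<^sub>v m :: real vec)"
        using vs.lincomb_dim[OF finU carr] by simp
    qed
    then have "x \<in> U \<rightarrow> {\<zero>\<^bsub>class_ring\<^esub>}"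
      using vs.not_lindepD[OF U(2) finU subset_refl, of x] by (simp add: class_ring_simps)
    then show False using x(1) by (auto simp: class_ring_simps)
  qed
  then show ?thesis using vs.rank_card_indpt[OF M max] by (simp add: mat_rank_def M_def)
qed

section \<open>Positive semidefinite matrices and their principal blocks\<close>

text \<open>Moving from \<open>u\<close> in direction \<open>i\<close> changes the form by 2 t d +
  t^2 S_ii, which cannot stay nonnegative for small t of both signs unless the slope d
  vanishes.\<close>

lemma psd_kernel:
  fixes S :: "nat \<Rightarrow> nat \<Rightarrow> real"
  assumes sym: "\<And>i k. i < m \<Longrightarrow> k < m \<Longrightarrow> S i k = S k i" and psd: "psd m S"
    and zero: "(\<Sum>i<m. \<Sum>k<m. u i * S i k * u k) = 0" and i: "i < m"
  shows "(\<Sum>k<m. S i k * u k) = 0"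
proof -
  define d where "d = (\<Sum>k<m. S i k * u k)"
  have quad: "0 \<le> 2 * t * d + t\<^sup>2 * S i i" for t
  proof -
    define e :: "nat \<Rightarrow> real" where "e k = (if k = i then 1 else 0)" for k
    have "(\<Sum>a<m. \<Sum>k<m. (u a + t * e a) * S a k * (u k + t * e k)) =
        (\<Sum>a<m. \<Sum>k<m. u a * S a k * u k) + t * (\<Sum>a<m. \<Sum>k<m. e a * (S a k * u k))
        + t * (\<Sum>a<m. \<Sum>k<m. u a * S a k * e k) + t\<^sup>2 * (\<Sum>a<m. \<Sum>k<m. e a * (S a k * e k))"
      unfolding sum_distrib_left sum.distrib[symmetric]
      by (intro sum.cong refl) (simp add: algebra_simps power2_eq_square)
    moreover have e1: "(\<Sum>a<m. e a * h a) = h i" for h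
      using i by (subst sum.remove[of _ i]) (auto simp: e_def intro!: sum.neutral)
    moreover have "(\<Sum>a<m. \<Sum>k<m. e a * (S a k * u k)) = d"
      unfolding d_def sum_distrib_left[symmetric] e1 ..
    moreover have "(\<Sum>a<m. \<Sum>k<m. u a * S a k * e k) = d"
    proof -
      have "(\<Sum>a<m. \<Sum>k<m. u a * S a k * e k) = (\<Sum>a<m. \<Sum>k<m. e k * (u a * S a k))" by (simp only: mult.commute)
      also have "\<dots> = (\<Sum>a<m. u a * S a i)" by (simp only: e1)
      also have "\<dots> = d" unfolding d_def using sym i by (intro sum.cong refl) (auto simp: mult.commute)
      finally show ?thesis .
    qed
    moreover have "(\<Sum>a<m. \<Sum>k<m. e a * (S a k * e k)) = S i i"
    proof -
      have "(\<Sum>a<m. \<Sum>k<m. e a * (S a k * e k)) = (\<Sum>k<m. S i k * e k)"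
        unfolding sum_distrib_left[symmetric] e1 ..
      also have "\<dots> = (\<Sum>k<m. e k * S i k)" by (simp only: mult.commute)
      finally show ?thesis by (simp only: e1)
    qed
    ultimately have "(\<Sum>a<m. \<Sum>k<m. (u a + t * e a) * S a k * (u k + t * e k)) = 2 * t * d + t\<^sup>2 * S i i"
      using zero by simp
    moreover have "0 \<le> (\<Sum>a<m. \<Sum>k<m. (u a + t * e a) * S a k * (u k + t * e k))"
      using psd[unfolded psd_def, rule_format, of "\<lambda>a. u a + t * e a"] .
    ultimately show ?thesis by simp
  qed
  have Sii: "S i i \<ge> 0" using quad[of 1] quad[of "-1"] by simp
  show ?thesis
  proof (rule ccontr)
    assume "\<not> ?thesis"
    then have d: "d \<noteq> 0" by (simp add: d_def)
    \<comment> \<open>Adding 1 keeps the divisor positive when \<open>S i i\<close> is 0; the value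
      of the form is then -d^2 (S_ii + 2) / s^2.\<close>
    define s where "s = S i i + 1"
    define t where "t = - d / s"
    have ts: "t * s = - d" using Sii by (simp add: t_def s_def)
    have "s\<^sup>2 * (2 * t * d + t\<^sup>2 * S i i) = 2 * (t * s) * d * s + (t * s)\<^sup>2 * S i i"
      by (simp add: algebra_simps power2_eq_square)
    also have "\<dots> = - (d\<^sup>2 * (S i i + 2))" unfolding ts by (simp add: s_def algebra_simps power2_eq_square)
    also have "\<dots> < 0" using d Sii by simp
    finally show False using quad[of t] by (simp add: mult_less_0_iff)
  qed
qed

text \<open>If the form vanished at a nonzero vector supported on \<open>J\<close>, that vector
  would lie in the kernel of S by \<open>psd_kernel\<close>, against the independence of the rows.
  So the block is positive definite, and compactness of the unit sphere gives the bound.\<close>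

lemma pd_block_bound:
  fixes S :: "nat \<Rightarrow> nat \<Rightarrow> real"
  assumes sym: "\<And>i k. i < m \<Longrightarrow> k < m \<Longrightarrow> S i k = S k i" and psd: "psd m S" and J: "J \<subseteq> {..<m}"
    and indep: "\<forall>a. (\<forall>k<m. (\<Sum>j\<in>J. a j * S j k) = 0) \<longrightarrow> (\<forall>j\<in>J. a j = 0)"
  shows "\<exists>\<mu>>0. \<forall>u. \<mu> * (\<Sum>i\<in>J. (u i)\<^sup>2) \<le> (\<Sum>i\<in>J. \<Sum>k\<in>J. u i * S i k * u k)"
proof -
  have fin: "finite J" using J finite_subset by blast
  define Q where "Q u = (\<Sum>i\<in>J. \<Sum>k\<in>J. u i * S i k * u k)" for u
  define N where "N u = (\<Sum>i\<in>J. (u i)\<^sup>2)" for u :: "nat \<Rightarrow> real"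
  have pos: "Q u > 0" if u: "N u \<noteq> 0" for u
  proof -
    define v where "v i = (if i \<in> J then u i else 0)" for i
    have out: "(\<Sum>k<m. h k * v k) = (\<Sum>k\<in>J. h k * u k)" for h :: "nat \<Rightarrow> real"
      using J by (intro sum.mono_neutral_cong_right) (auto simp: v_def)
    have Qv: "(\<Sum>i<m. \<Sum>k<m. v i * S i k * v k) = Q u"
    proof -
      have "(\<Sum>i<m. \<Sum>k<m. v i * S i k * v k) = (\<Sum>i<m. (\<Sum>k\<in>J. S i k * u k) * v i)"
        unfolding out sum_distrib_right by (intro sum.cong refl) (simp add: mult_ac)
      also have "\<dots> = (\<Sum>i\<in>J. (\<Sum>k\<in>J. S i k * u k) * u i)" by (rule out)
      finally show ?thesis by (simp add: Q_def sum_distrib_left sum_distrib_right mult_ac)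
    qed
    have "Q u \<ge> 0" using psd[unfolded psd_def, rule_format, of v] unfolding Qv .
    moreover have "Q u \<noteq> 0"
    proof
      assume "Q u = 0"
      then have ker: "(\<Sum>k<m. S i k * v k) = 0" if "i < m" for i
        using psd_kernel[OF sym psd, of v i] Qv that by simp
      have "(\<Sum>j\<in>J. u j * S j k) = 0" if "k < m" for k
      proof -
        have "(\<Sum>j\<in>J. u j * S j k) = (\<Sum>j\<in>J. S k j * u j)"
          using sym J that by (intro sum.cong refl) (auto simp: mult.commute subset_iff)
        then show ?thesis using ker[OF that] by (simp add: out)
      qed
      then have "\<forall>j\<in>J. u j = 0" using indep by blast
      then show False using u by (simp add: N_def)
    qed
    ultimately show ?thesis by simp
  qed
  define Bx :: "(nat \<Rightarrow> real) set" where "Bx = {w. (\<forall>v\<in>J. \<bar>w v - (\<lambda>_. 0) v\<bar> \<le> 1) \<and> (\<forall>v. v \<notin> J \<longrightarrow> w v = (\<lambda>_. 0) v)}"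
  define Sp where "Sp = Bx \<inter> {u. N u = 1}"
  have contN: "continuous_on UNIV N" and contQ: "continuous_on UNIV Q"
    unfolding N_def Q_def by (intro continuous_intros continuous_on_product_coordinates)+
  have "compact Bx" unfolding Bx_def by (rule compact_box)
  moreover have "closed {u. N u = 1}" by (intro closed_Collect_eq contN continuous_on_const)
  ultimately have comp: "compact Sp" unfolding Sp_def by (rule compact_Int_closed)
  have hom: "N (\<lambda>i. if i \<in> J then s * u i else 0) = s\<^sup>2 * N u" "Q (\<lambda>i. if i \<in> J then s * u i else 0) = s\<^sup>2 * Q u" for s u
    by (auto simp: N_def Q_def power_mult_distrib sum_distrib_left mult_ac power2_eq_square intro!: sum.cong)
  have scaled: "(\<lambda>i. if i \<in> J then u i / sqrt (N u) else 0) \<in> Sp" if "N u > 0" for u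
  proof -
    have "\<bar>u i / sqrt (N u)\<bar> \<le> 1" if "i \<in> J" for i
    proof -
      have "(u i)\<^sup>2 \<le> N u" unfolding N_def using fin that by (intro member_le_sum) auto
      then have "\<bar>u i\<bar> \<le> sqrt (N u)" by (metis real_sqrt_abs real_sqrt_le_mono)
      moreover have s: "sqrt (N u) > 0" using \<open>N u > 0\<close> by simp
      ultimately show ?thesis by (simp only: abs_divide abs_of_pos[OF s] divide_le_eq_1_pos[OF s])
    qed
    moreover have "N (\<lambda>i. if i \<in> J then u i / sqrt (N u) else 0) = 1"
    proof -
      have "(\<lambda>i. if i \<in> J then u i / sqrt (N u) else 0) = (\<lambda>i. if i \<in> J then 1 / sqrt (N u) * u i else 0)" by auto
      then have "N (\<lambda>i. if i \<in> J then u i / sqrt (N u) else 0) = (1 / sqrt (N u))\<^sup>2 * N u" by (simp only: hom)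
      then show ?thesis using that by (simp add: power_divide)
    qed
    ultimately show ?thesis by (auto simp: Sp_def Bx_def)
  qed
  have N0: "N u \<ge> 0" for u by (simp add: N_def sum_nonneg)
  show ?thesis
  proof (cases "Sp = {}")
    \<comment> \<open>The sphere is empty only for empty \<open>J\<close>, where any positive
      constant works.\<close>
    case True
    then have "N u = 0" for u using scaled[of u] N0[of u] by (cases "N u = 0") auto
    then have "\<forall>j\<in>J. u j = 0" for u :: "nat \<Rightarrow> real" using fin by (auto simp: N_def sum_nonneg_eq_0_iff)
    from this[of "\<lambda>_. 1"] have "J = {}" by simp
    then show ?thesis by (intro exI[of _ 1]) auto
  next
    case False
    then obtain u0 where u0: "u0 \<in> Sp" "\<And>u. u \<in> Sp \<Longrightarrow> Q u0 \<le> Q u"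
      using continuous_attains_inf[OF comp False continuous_on_subset[OF contQ]] by blast
    have "Q u0 > 0" using u0(1) pos by (simp add: Sp_def)
    moreover have "Q u0 * N u \<le> Q u" for u
    proof (cases "N u = 0")
      case True
      then have "\<forall>j\<in>J. u j = 0" using fin by (simp add: N_def sum_nonneg_eq_0_iff)
      then have "Q u = 0" by (simp add: Q_def)
      then show ?thesis using True by simp
    next
      case False
      then have Np: "N u > 0" using N0[of u] by simp
      have "Q u0 \<le> Q (\<lambda>i. if i \<in> J then (1 / sqrt (N u)) * u i else 0)" using u0(2)[OF scaled[OF Np]] by (simp cong: if_cong)
      also have "\<dots> = Q u / N u" unfolding hom using Np by (simp add: power_divide)
      finally show ?thesis using Np by (simp add: field_simps)
    qed
    ultimately show ?thesis unfolding Q_def N_def by blast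
  qed
qed

text \<open>Since |u_i u_k| is at most the mean of the two squares, entrywise errors up to
  \<open>\<eta>\<close> change the form by at most \<open>\<eta> * card J\<close> times the squared
  norm.\<close>

lemma pd_block_perturb:
  fixes S S' :: "nat \<Rightarrow> nat \<Rightarrow> real"
  assumes fin: "finite J" and \<mu>: "\<And>u. \<mu> * (\<Sum>i\<in>J. (u i)\<^sup>2) \<le> (\<Sum>i\<in>J. \<Sum>k\<in>J. u i * S i k * u k)"
    and close: "\<And>i k. i \<in> J \<Longrightarrow> k \<in> J \<Longrightarrow> \<bar>S' i k - S i k\<bar> \<le> \<eta>" and \<eta>: "\<eta> * real (card J) \<le> \<mu>" "0 \<le> \<eta>"
  shows "0 \<le> (\<Sum>i\<in>J. \<Sum>k\<in>J. u i * S' i k * u k)"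
proof -
  have "(\<Sum>i\<in>J. \<Sum>k\<in>J. u i * S' i k * u k) = (\<Sum>i\<in>J. \<Sum>k\<in>J. u i * S i k * u k) + (\<Sum>i\<in>J. \<Sum>k\<in>J. u i * (S' i k - S i k) * u k)"
    unfolding sum.distrib[symmetric] by (intro sum.cong refl) (simp add: algebra_simps)
  moreover have "- (\<eta> * real (card J) * (\<Sum>i\<in>J. (u i)\<^sup>2)) \<le> (\<Sum>i\<in>J. \<Sum>k\<in>J. u i * (S' i k - S i k) * u k)"
  proof -
    have "(\<Sum>i\<in>J. \<Sum>k\<in>J. - (\<eta> * ((u i)\<^sup>2 + (u k)\<^sup>2) / 2)) \<le> (\<Sum>i\<in>J. \<Sum>k\<in>J. u i * (S' i k - S i k) * u k)"
    proof (intro sum_mono)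
      fix i k assume ik: "i \<in> J" "k \<in> J"
      have "\<bar>u i * (S' i k - S i k) * u k\<bar> = \<bar>S' i k - S i k\<bar> * (\<bar>u i\<bar> * \<bar>u k\<bar>)" by (simp add: abs_mult)
      also have "\<dots> \<le> \<eta> * (\<bar>u i\<bar> * \<bar>u k\<bar>)" using close[OF ik] by (intro mult_right_mono) auto
      also have "\<dots> \<le> \<eta> * (((u i)\<^sup>2 + (u k)\<^sup>2) / 2)"
      proof (rule mult_left_mono)
        have "0 \<le> (\<bar>u i\<bar> - \<bar>u k\<bar>)\<^sup>2" by simp
        then show "\<bar>u i\<bar> * \<bar>u k\<bar> \<le> ((u i)\<^sup>2 + (u k)\<^sup>2) / 2" by (simp add: power2_diff)
      qed (rule \<eta>(2))
      finally show "- (\<eta> * ((u i)\<^sup>2 + (u k)\<^sup>2) / 2) \<le> u i * (S' i k - S i k) * u k" by simp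
    qed
    moreover have "(\<Sum>i\<in>J. \<Sum>k\<in>J. - (\<eta> * ((u i)\<^sup>2 + (u k)\<^sup>2) / 2)) = - (\<eta> * real (card J) * (\<Sum>i\<in>J. (u i)\<^sup>2))"
    proof -
      have "(\<Sum>i\<in>J. \<Sum>k\<in>J. (u i)\<^sup>2 + (u k)\<^sup>2) = 2 * real (card J) * (\<Sum>i\<in>J. (u i)\<^sup>2)"
        by (simp add: sum.distrib sum_distrib_left mult.assoc)
      then have "(\<eta> / 2) * (\<Sum>i\<in>J. \<Sum>k\<in>J. (u i)\<^sup>2 + (u k)\<^sup>2) = \<eta> * real (card J) * (\<Sum>i\<in>J. (u i)\<^sup>2)" by simp
      moreover have "(\<Sum>i\<in>J. \<Sum>k\<in>J. - (\<eta> * ((u i)\<^sup>2 + (u k)\<^sup>2) / 2)) = - ((\<eta> / 2) * (\<Sum>i\<in>J. \<Sum>k\<in>J. (u i)\<^sup>2 + (u k)\<^sup>2))"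
        unfolding sum_distrib_left sum_negf by simp
      ultimately show ?thesis by (simp only:)
    qed
    ultimately show ?thesis by simp
  qed
  moreover have "\<eta> * real (card J) * (\<Sum>i\<in>J. (u i)\<^sup>2) \<le> \<mu> * (\<Sum>i\<in>J. (u i)\<^sup>2)"
    using \<eta>(1) by (intro mult_right_mono) (auto intro: sum_nonneg)
  ultimately show ?thesis using \<mu>[of u] by linarith
qed

text \<open>The vectors \<open>T i\<close> lie in the kernel and restrict to the unit vectors
  outside \<open>J\<close>. Subtracting the right combination from \<open>v\<close> makes it
  supported on \<open>J\<close> and leaves the value of the form unchanged.\<close>

lemma psd_from_block:
  fixes S :: "nat \<Rightarrow> nat \<Rightarrow> real"
  assumes sym: "\<And>i k. i < m \<Longrightarrow> k < m \<Longrightarrow> S i k = S k i" and J: "J \<subseteq> {..<m}"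
    and ker: "\<And>a i. a < m \<Longrightarrow> i < m \<Longrightarrow> i \<notin> J \<Longrightarrow> (\<Sum>k<m. S a k * T i k) = 0"
    and T: "\<And>i k. i < m \<Longrightarrow> k < m \<Longrightarrow> i \<notin> J \<Longrightarrow> k \<notin> J \<Longrightarrow> T i k = (if i = k then 1 else 0)"
    and block: "\<And>u. 0 \<le> (\<Sum>i\<in>J. \<Sum>k\<in>J. u i * S i k * u k)"
  shows "psd m S"
  unfolding psd_def
proof
  fix v :: "nat \<Rightarrow> real"
  let ?I = "{..<m} - J"
  define u where "u k = v k - (\<Sum>i\<in>?I. v i * T i k)" for k
  have u0: "u k = 0" if "k \<in> ?I" for k
  proof -
    have "(\<Sum>i\<in>?I. v i * T i k) = (\<Sum>i\<in>?I. if i = k then v i else 0)"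
      using that by (intro sum.cong refl) (auto simp: T)
    then show ?thesis using that by (simp add: u_def)
  qed
  have Sv: "(\<Sum>k<m. S a k * v k) = (\<Sum>k<m. S a k * u k)" if "a < m" for a
  proof -
    have "(\<Sum>k<m. S a k * u k) = (\<Sum>k<m. S a k * v k) - (\<Sum>k<m. \<Sum>i\<in>?I. v i * (S a k * T i k))"
      by (simp add: u_def right_diff_distrib sum_subtractf sum_distrib_left mult_ac)
    also have "(\<Sum>k<m. \<Sum>i\<in>?I. v i * (S a k * T i k)) = (\<Sum>i\<in>?I. v i * (\<Sum>k<m. S a k * T i k))"
      by (subst sum.swap) (simp add: sum_distrib_left)
    also have "\<dots> = 0" using ker that by (intro sum.neutral) auto
    finally show ?thesis by simp
  qed
  have swap: "(\<Sum>a<m. p a * (\<Sum>k<m. S a k * q k)) = (\<Sum>k<m. q k * (\<Sum>a<m. S k a * p a))" for p q :: "nat \<Rightarrow> real"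
    unfolding sum_distrib_left
    by (subst sum.swap) (intro sum.cong refl, use sym in \<open>auto simp: mult_ac\<close>)
  have "(\<Sum>i<m. \<Sum>j<m. v i * S i j * v j) = (\<Sum>a<m. v a * (\<Sum>k<m. S a k * v k))"
    by (simp add: sum_distrib_left mult.assoc)
  also have "\<dots> = (\<Sum>a<m. v a * (\<Sum>k<m. S a k * u k))" using Sv by simp
  also have "\<dots> = (\<Sum>k<m. u k * (\<Sum>a<m. S k a * v a))" by (rule swap)
  also have "\<dots> = (\<Sum>k<m. u k * (\<Sum>a<m. S k a * u a))" using Sv by simp
  also have "\<dots> = (\<Sum>k\<in>J. u k * (\<Sum>a\<in>J. S k a * u a))"
  proof -
    have "(\<Sum>a<m. S k a * u a) = (\<Sum>a\<in>J. S k a * u a)" for k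
      using J u0 by (intro sum.mono_neutral_right) auto
    then show ?thesis using J u0 by (simp, intro sum.mono_neutral_right) auto
  qed
  also have "\<dots> = (\<Sum>i\<in>J. \<Sum>k\<in>J. u i * S i k * u k)" by (simp add: sum_distrib_left mult.assoc)
  finally show "0 \<le> (\<Sum>i<m. \<Sum>j<m. v i * S i j * v j)" using block by simp
qed

section \<open>Real points of the incidence varieties\<close>

lemma rational_entry_real:
  assumes "(a::complex) \<in> \<rat>"
  shows "complex_of_real (Re a) = a"
proof -
  obtain q where q: "a = of_rat q" using assms by (auto elim: Rats_cases)
  obtain i j where "q = Rat.Fract i j" "j > 0" by (cases q)
  then have "a = complex_of_real (of_int i / of_int j)" using q by (simp add: of_rat_rat)
  then show ?thesis by simp
qed

lemma Amat_of_real: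
  assumes "\<forall>k i j. A (k,i,j) \<in> \<rat>"
  shows "Amat n A (\<lambda>v. of_real (w v)) i k = of_real (Areal n A (\<lambda>l. w (X l)) i k)"
  using assms rational_entry_real by (simp add: Amat_def Areal_def)

lemma feq_of_real:
  assumes "\<forall>k i j. A (k,i,j) \<in> \<rat>"
  shows "feq m n A \<iota> e (\<lambda>v. of_real (w v)) = of_real (Re (feq m n A \<iota> e (\<lambda>v. of_real (w v))))"
  by (cases e) (auto simp: Amat_of_real[OF assms] complex_eq_iff)

lemma dfeq_of_real:
  assumes "\<forall>k i j. A (k,i,j) \<in> \<rat>"
  shows "dfeq m n A \<iota> e v (\<lambda>v. of_real (w v)) = of_real (Re (dfeq m n A \<iota> e v (\<lambda>v. of_real (w v))))"
proof -
  have im: "Im (A (k,i,j)) = 0" for k i j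
    using arg_cong[OF rational_entry_real[of "A (k,i,j)"], of Im] assms by simp
  show ?thesis
    by (cases e; cases v) (auto simp: dfeq_def Amat_of_real[OF assms] complex_eq_iff im)
qed

lemma sum_objective:
  fixes w :: "var \<Rightarrow> real"
  shows "(\<Sum>v\<in>xy_vars m n p. (case v of X l \<Rightarrow> c l | _ \<Rightarrow> 0) * w v) = (\<Sum>l<n. c l * w (X l))"
proof -
  have "(\<Sum>v\<in>xy_vars m n p. (case v of X l \<Rightarrow> c l | _ \<Rightarrow> 0) * w v) = (\<Sum>v\<in>X ` {..<n}. (case v of X l \<Rightarrow> c l | _ \<Rightarrow> 0) * w v)"
    by (rule sum.mono_neutral_right[OF finite_xy_vars]) (auto simp: xy_vars_def)
  also have "\<dots> = (\<Sum>l<n. c l * w (X l))" by (subst sum.reindex) (auto simp: inj_on_def)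
  finally show ?thesis .
qed

lemma Areal_sym: "symmetric_pencil A \<Longrightarrow> Areal n A x i k = Areal n A x k i"
  by (simp add: Areal_def symmetric_pencil_def)

lemma Areal_cong: "(\<And>l. l < n \<Longrightarrow> x l = y l) \<Longrightarrow> Areal n A x = Areal n A y"
  by (auto simp: Areal_def fun_eq_iff)

lemma Areal_close:
  assumes "\<And>l. l < n \<Longrightarrow> \<bar>y l - x l\<bar> \<le> \<epsilon>"
  shows "\<bar>Areal n A y i k - Areal n A x i k\<bar> \<le> \<epsilon> * (\<Sum>l<n. \<bar>Re (A (Suc l,i,k))\<bar>)"
proof -
  have "Areal n A y i k - Areal n A x i k = (\<Sum>l<n. (y l - x l) * Re (A (Suc l,i,k)))"
    by (simp add: Areal_def sum_subtractf left_diff_distrib)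
  also have "\<bar>\<dots>\<bar> \<le> (\<Sum>l<n. \<bar>(y l - x l) * Re (A (Suc l,i,k))\<bar>)" by (rule sum_abs)
  also have "\<dots> \<le> (\<Sum>l<n. \<epsilon> * \<bar>Re (A (Suc l,i,k))\<bar>)"
    using assms by (intro sum_mono) (auto simp: abs_mult intro!: mult_right_mono)
  finally show ?thesis by (simp add: sum_distrib_left)
qed

text \<open>Near a feasible point \<open>x\<close> of rank exactly \<open>p\<close>, every real point of \<open>\<V>\<^sub>p\<^sub>,\<^sub>\<iota>\<close> is feasible, because a
  positive definite principal block of size \<open>p\<close> persists.\<close>
lemma real_points_feasible:
  assumes A: "symmetric_pencil A" "\<forall>k i j. A (k,i,j) \<in> \<rat>" and \<iota>: "\<iota> = {..<m} - J" "\<iota> \<in> index_sets m p" "card J \<le> r"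
    and psd: "psd m (Areal n A x)" and J: "J \<subseteq> {..<m}"
    and indep: "\<forall>a. (\<forall>k<m. (\<Sum>j\<in>J. a j * Areal n A x j k) = 0) \<longrightarrow> (\<forall>j\<in>J. a j = 0)"
  shows "\<exists>\<epsilon>>0. \<forall>w. (\<forall>l<n. \<bar>w (X l) - x l\<bar> \<le> \<epsilon>) \<longrightarrow>
    (\<forall>e\<in>feqs m n p. feq m n A \<iota> e (\<lambda>v. of_real (w v)) = 0) \<longrightarrow> feasible m n A r (\<lambda>l. if l < n then w (X l) else 0)"
proof -
  have fin: "finite J" using J finite_subset by blast
  obtain \<mu> where \<mu>: "\<mu> > 0" "\<And>u. \<mu> * (\<Sum>i\<in>J. (u i)\<^sup>2) \<le> (\<Sum>i\<in>J. \<Sum>k\<in>J. u i * Areal n A x i k * u k)"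
    using pd_block_bound[OF Areal_sym[OF A(1)] psd J indep] by blast
  \<comment> \<open>The summand 1 avoids division by zero for empty \<open>J\<close>.\<close>
  define \<eta> where "\<eta> = \<mu> / (real (card J) + 1)"
  have \<eta>: "\<eta> > 0" "\<eta> * real (card J) \<le> \<mu>" using \<mu>(1) by (auto simp: \<eta>_def field_simps)
  \<comment> \<open>Dominates the Lipschitz constants of all entries of the block; the summand 1
    keeps it positive.\<close>
  define C where "C = 1 + (\<Sum>i\<in>J. \<Sum>k\<in>J. \<Sum>l<n. \<bar>Re (A (Suc l,i,k))\<bar>)"
  have C: "C > 0" unfolding C_def by (intro add_pos_nonneg sum_nonneg) auto
  have C_le: "(\<Sum>l<n. \<bar>Re (A (Suc l,i,k))\<bar>) \<le> C" if "i \<in> J" "k \<in> J" for i k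
  proof -
    have "(\<Sum>l<n. \<bar>Re (A (Suc l,i,k))\<bar>) \<le> (\<Sum>k\<in>J. \<Sum>l<n. \<bar>Re (A (Suc l,i,k))\<bar>)"
      using fin that by (intro member_le_sum[of k J "\<lambda>k. \<Sum>l<n. \<bar>Re (A (Suc l,i,k))\<bar>"]) (auto intro: sum_nonneg)
    also have "\<dots> \<le> (\<Sum>i\<in>J. \<Sum>k\<in>J. \<Sum>l<n. \<bar>Re (A (Suc l,i,k))\<bar>)"
      using fin that by (intro member_le_sum[of i J "\<lambda>i. \<Sum>k\<in>J. \<Sum>l<n. \<bar>Re (A (Suc l,i,k))\<bar>"]) (auto intro!: sum_nonneg)
    finally show ?thesis by (simp add: C_def)
  qed
  have "feasible m n A r (\<lambda>l. if l < n then w (X l) else 0)"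
    if close: "\<forall>l<n. \<bar>w (X l) - x l\<bar> \<le> \<eta> / C"
      and w: "\<forall>e\<in>feqs m n p. feq m n A \<iota> e (\<lambda>v. of_real (w v)) = 0" for w :: "var \<Rightarrow> real"
  proof -
    let ?S = "Areal n A (\<lambda>l. w (X l))"
    have S_eq: "Areal n A (\<lambda>l. if l < n then w (X l) else 0) = ?S" by (rule Areal_cong) simp
    have near: "\<bar>?S i k - Areal n A x i k\<bar> \<le> \<eta>" if "i \<in> J" "k \<in> J" for i k
    proof -
      have "\<bar>?S i k - Areal n A x i k\<bar> \<le> \<eta> / C * (\<Sum>l<n. \<bar>Re (A (Suc l,i,k))\<bar>)"
        by (rule Areal_close) (use close in auto)
      also have "\<dots> \<le> \<eta> / C * C" using C_le[OF that] C \<eta>(1) by (intro mult_left_mono) auto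
      finally show ?thesis using C by simp
    qed
    have block: "0 \<le> (\<Sum>i\<in>J. \<Sum>k\<in>J. u i * ?S i k * u k)" for u
      by (rule pd_block_perturb[OF fin \<mu>(2) near \<eta>(2)]) (use \<eta>(1) in auto)
    define pos where "pos i = the_inv_into {..<m - p} (idx \<iota>) i" for i
    have bij: "bij_betw (idx \<iota>) {..<m - p} \<iota>" by (rule bij_idx[OF \<iota>(2)])
    have pos: "pos i < m - p" "idx \<iota> (pos i) = i" if "i < m" "i \<notin> J" for i
      using bij that \<iota>(1) f_the_inv_into_f_bij_betw[OF bij, of i] the_inv_into_into[of "idx \<iota>" "{..<m - p}" i "{..<m - p}"]
      by (auto simp: pos_def bij_betw_def)
    define T where "T i k = w (Y k (pos i))" for i k
    have ker: "(\<Sum>k<m. ?S a k * T i k) = 0" if "a < m" "i < m" "i \<notin> J" for a i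
    proof -
      have "EqAY a (pos i) \<in> feqs m n p" using pos that by (auto simp: feqs_def)
      then have "feq m n A \<iota> (EqAY a (pos i)) (\<lambda>v. of_real (w v)) = 0" by (rule bspec[OF w])
      then have "complex_of_real (\<Sum>k<m. ?S a k * T i k) = 0" by (simp add: Amat_of_real[OF A(2)] T_def)
      then show ?thesis by (simp only: of_real_eq_0_iff)
    qed
    have TI: "T i k = (if i = k then 1 else 0)" if "i < m" "k < m" "i \<notin> J" "k \<notin> J" for i k
    proof -
      have "EqId (pos k) (pos i) \<in> feqs m n p" using pos that by (auto simp: feqs_def)
      then have "feq m n A \<iota> (EqId (pos k) (pos i)) (\<lambda>v. of_real (w v)) = 0" by (rule bspec[OF w])
      then have "complex_of_real (T i k) = complex_of_real (if pos k = pos i then 1 else 0)"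
        using pos that by (simp add: T_def)
      moreover have "pos k = pos i \<longleftrightarrow> i = k" using pos that by metis
      ultimately show ?thesis by (simp only: of_real_eq_iff)
    qed
    have "psd m ?S" by (rule psd_from_block[OF Areal_sym[OF A(1)] J ker TI block])
    \<comment> \<open>The kernel vectors \<open>T i\<close> express the columns outside
      \<open>J\<close> through those in \<open>J\<close>.\<close>
    moreover have "mat_rank m ?S \<le> card J"
    proof (rule mat_rank_le[OF J, where T = "\<lambda>i j. if i \<in> J then (if i = j then 1 else 0) else - T i j"])
      fix i k assume ik: "i < m" "k < m"
      show "?S k i = (\<Sum>j\<in>J. (if i \<in> J then (if i = j then 1 else 0) else - T i j) * ?S k j)"
      proof (cases "i \<in> J")
        case True
        then have "(\<Sum>j\<in>J. (if i \<in> J then (if i = j then 1 else 0) else - T i j) * ?S k j) = (\<Sum>j\<in>J. if i = j then ?S k j else 0)"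
          by (intro sum.cong refl) auto
        then show ?thesis using True fin by simp
      next
        case False
        have "(\<Sum>j\<in>{..<m} - J. ?S k j * T i j) = (\<Sum>j\<in>{..<m} - J. if i = j then ?S k j else 0)"
          using TI ik False by (intro sum.cong refl) auto
        also have "\<dots> = ?S k i" using ik False by simp
        finally have "(\<Sum>j\<in>J. ?S k j * T i j) + ?S k i = 0"
          using ker[OF ik(2,1) False] by (simp add: sum_split[OF J])
        then show ?thesis using False by (simp add: sum_negf mult.commute)
      qed
    qed
    ultimately show ?thesis using \<iota>(3) by (simp add: feasible_def S_eq)
  qed
  moreover have "\<eta> / C > 0" using \<eta>(1) C by simp
  ultimately show ?thesis by blast
qed

text \<open>\<open>p\<close> is the actual rank at the minimizer, possibly below \<open>r\<close>:
  the block on \<open>J\<close> must be positive definite in order to persist nearby. The multiplier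
  rule is applied over the reals and to the reduced equations, because the full system may have
  dependent gradients.\<close>

theorem minimizer_Lag_zero:
  assumes A: "symmetric_pencil A" "\<forall>k i j. A (k,i,j) \<in> \<rat>" "\<not> degenerate m n A" and c: "\<forall>l<n. c l \<in> \<rat>"
    and x: "x \<in> minimizers m n A c r"
  shows "\<exists>p\<le>r. \<exists>\<iota>\<in>index_sets m p. \<exists>w. (\<forall>l<n. w (X l) = of_real (x l)) \<and> (\<forall>q\<in>Lag m n A c p \<iota>. q w = 0)"
proof -
  let ?S = "Areal n A x"
  have feas: "psd m ?S" "mat_rank m ?S \<le> r" using x by (auto simp: minimizers_def feasible_def)
  obtain J B where J: "J \<subseteq> {..<m}"
    and indep: "\<forall>a. (\<forall>k<m. (\<Sum>j\<in>J. a j * ?S j k) = 0) \<longrightarrow> (\<forall>j\<in>J. a j = 0)"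
    and B: "\<forall>i<m. i \<notin> J \<longrightarrow> (\<forall>k<m. ?S i k = (\<Sum>j\<in>J. B i j * ?S j k))"
    by (rule row_basis[of m ?S])
  have fin: "finite J" using J finite_subset by blast
  define p where "p = card J"
  define \<iota> where "\<iota> = {..<m} - J"
  have "card \<iota> = m - p" using J by (simp add: \<iota>_def p_def card_Diff_subset fin)
  then have \<iota>: "\<iota> \<in> index_sets m p" by (auto simp: index_sets_def \<iota>_def)
  have pr: "p \<le> r" using mat_rank_ge[OF Areal_sym[OF A(1)] J indep] feas(2) by (simp add: p_def)
  \<comment> \<open>The columns of Y are the kernel vectors read off from the row relations
    \<open>B\<close>, normalized to the identity on \<open>\<iota>\<close>.\<close>
  define w0 :: "var \<Rightarrow> real" where "w0 v = (case v of X l \<Rightarrow> x l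
    | Y k j \<Rightarrow> (if k \<in> J then - B (idx \<iota> j) k else (if idx \<iota> j = k then 1 else 0)) | Z e \<Rightarrow> 0)" for v
  let ?cw = "\<lambda>w v. complex_of_real (w v)"
  have idx_J: "idx \<iota> j < m" "idx \<iota> j \<notin> J" if "j < m - p" for j
    using idx_mem[OF \<iota> that] by (auto simp: \<iota>_def)
  have zero: "feq m n A \<iota> e (?cw w0) = 0" if e: "e \<in> feqs m n p" for e
  proof (cases e)
    case (EqAY i j)
    then have ij: "i < m" "j < m - p" using e by (auto simp: feqs_def)
    have S_w0: "Areal n A (\<lambda>l. w0 (X l)) = ?S" by (simp add: w0_def)
    have "(\<Sum>k<m. ?S i k * w0 (Y k j)) = (\<Sum>k\<in>J. ?S i k * w0 (Y k j)) + (\<Sum>k\<in>{..<m} - J. ?S i k * w0 (Y k j))"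
      by (rule sum_split[OF J])
    also have "(\<Sum>k\<in>J. ?S i k * w0 (Y k j)) = - (\<Sum>k\<in>J. B (idx \<iota> j) k * ?S k i)"
      unfolding sum_negf[symmetric]
      by (intro sum.cong refl) (simp add: w0_def Areal_sym[OF A(1), of n x i])
    also have "(\<Sum>k\<in>J. B (idx \<iota> j) k * ?S k i) = ?S (idx \<iota> j) i" using B idx_J[OF ij(2)] ij(1) by simp
    also have "(\<Sum>k\<in>{..<m} - J. ?S i k * w0 (Y k j)) = (\<Sum>k\<in>{..<m} - J. if idx \<iota> j = k then ?S i k else 0)"
      by (intro sum.cong refl) (auto simp: w0_def)
    also have "\<dots> = ?S i (idx \<iota> j)" using idx_J[OF ij(2)] by simp
    finally have "(\<Sum>k<m. ?S i k * w0 (Y k j)) = 0" using Areal_sym[OF A(1), of n x i] by simp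
    moreover have "feq m n A \<iota> e (?cw w0) = of_real (\<Sum>k<m. ?S i k * w0 (Y k j))"
      by (simp add: EqAY Amat_of_real[OF A(2)] S_w0)
    ultimately show ?thesis by simp
  next
    case (EqId a j)
    then have "a < m - p" "j < m - p" using e by (auto simp: feqs_def)
    then show ?thesis using EqId idx_J idx_inj[OF \<iota>, of j a] by (auto simp: w0_def)
  qed
  obtain \<epsilon> where \<epsilon>: "\<epsilon> > 0" "\<And>w. (\<forall>l<n. \<bar>w (X l) - x l\<bar> \<le> \<epsilon>) \<Longrightarrow>
      (\<forall>e\<in>feqs m n p. feq m n A \<iota> e (?cw w) = 0) \<Longrightarrow> feasible m n A r (\<lambda>l. if l < n then w (X l) else 0)"
    using real_points_feasible[OF A(1,2) \<iota>_def \<iota> pr[unfolded p_def] feas(1) J indep] by blast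
  define b where "b v = (case v of X l \<Rightarrow> Re (c l) | _ \<Rightarrow> 0)" for v
  define f where "f e w = Re (feq m n A \<iota> e (?cw w))" for e w
  define f' where "f' e v w = Re (dfeq m n A \<iota> e v (?cw w))" for e v w
  have fR: "feq m n A \<iota> e (?cw w) = of_real (f e w)" for e w unfolding f_def by (rule feq_of_real[OF A(2)])
  have f'R: "dfeq m n A \<iota> e v (?cw w) = of_real (f' e v w)" for e v w unfolding f'_def by (rule dfeq_of_real[OF A(2)])
  have "\<exists>z. \<forall>v\<in>xy_vars m n p. b v + (\<Sum>e\<in>red_eqs m n p \<iota>. z e * f' e v w0) = 0"
  proof (rule lagrange_multipliers[where f = f and \<epsilon> = \<epsilon>])
    show "finite (red_eqs m n p \<iota>)" using finite_subset[OF red_eqs_subset finite_feqs] .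
    show "finite (xy_vars m n p)" by (rule finite_xy_vars)
    show "continuous_on UNIV (f e)" for e
      unfolding f_def
      by (cases e) (auto simp: Amat_def intro!: continuous_intros continuous_on_product_coordinates)
    show "((\<lambda>t. f e (w(v := t))) has_real_derivative f' e v w) (at (w v))" for e v w
    proof -
      have "f e (w(v := t)) = f e w + (t - w v) * f' e v w" for t
      proof -
        have "(\<lambda>u. complex_of_real ((w(v := t)) u)) = (?cw w)(v := of_real t)" by auto
        then have "feq m n A \<iota> e (?cw (w(v := t))) = feq m n A \<iota> e (?cw w) + (of_real t - of_real (w v)) * dfeq m n A \<iota> e v (?cw w)"
          by (simp only: feq_upd)
        then show ?thesis by (simp add: f_def f'R)
      qed
      moreover have "((\<lambda>t. f e w + (t - w v) * f' e v w) has_real_derivative f' e v w) (at (w v))"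
        by (auto intro!: derivative_eq_intros)
      ultimately show ?thesis by simp
    qed
    show "(\<lambda>k. f' e v (W k)) \<longlonglongrightarrow> f' e v w0" if W: "\<And>u. (\<lambda>k. W k u) \<longlonglongrightarrow> w0 u" for e v W
      unfolding f'_def
      by (cases e; cases v) (auto simp: dfeq_def Amat_def intro!: tendsto_intros W)
    show "f e w0 = 0" if "e \<in> red_eqs m n p \<iota>" for e
      using zero[of e] that red_eqs_subset[of m n p \<iota>] by (auto simp: f_def)
    show "\<epsilon> > 0" by (rule \<epsilon>(1))
    show "(\<Sum>v\<in>xy_vars m n p. b v * w0 v) \<le> (\<Sum>v\<in>xy_vars m n p. b v * w v)"
      if close: "\<forall>v\<in>xy_vars m n p. \<bar>w v - w0 v\<bar> \<le> \<epsilon>" and eqs: "\<forall>e\<in>red_eqs m n p \<iota>. f e w = 0" for w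
    proof -
      have "feq m n A \<iota> e (?cw w) = 0" if "e \<in> feqs m n p" for e
        by (rule feqs_if_red_eqs[OF A(1) \<iota> _ that]) (use eqs fR in auto)
      moreover have "\<forall>l<n. \<bar>w (X l) - x l\<bar> \<le> \<epsilon>"
      proof (intro allI impI)
        fix l assume "l < n"
        then have "X l \<in> xy_vars m n p" by (auto simp: xy_vars_def)
        then show "\<bar>w (X l) - x l\<bar> \<le> \<epsilon>" using bspec[OF close, of "X l"] by (simp add: w0_def)
      qed
      ultimately have "feasible m n A r (\<lambda>l. if l < n then w (X l) else 0)" by (intro \<epsilon>(2)) auto
      then have "(\<Sum>l<n. Re (c l) * x l) \<le> (\<Sum>l<n. Re (c l) * (if l < n then w (X l) else 0))"
        using x unfolding minimizers_def by blast
      then show ?thesis unfolding b_def sum_objective by (simp add: w0_def)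
    qed
    show "\<forall>a. (\<forall>v\<in>xy_vars m n p. (\<Sum>e\<in>red_eqs m n p \<iota>. a e * f' e v w0) = 0) \<longrightarrow> (\<forall>e\<in>red_eqs m n p \<iota>. a e = 0)"
    proof (intro allI impI ballI)
      fix a e assume a: "\<forall>v\<in>xy_vars m n p. (\<Sum>e\<in>red_eqs m n p \<iota>. a e * f' e v w0) = 0" and e: "e \<in> red_eqs m n p \<iota>"
      \<comment> \<open>Gradients are real at a real point, so a real dependence is also a complex
        one, and nondegeneracy, a condition over the complex numbers, excludes it.\<close>
      have "complex_of_real (a e) = 0"
      proof (rule red_eqs_independent[OF A(1,3) \<iota> zero _ e, where b = "\<lambda>e. of_real (a e)"])
        fix v assume v: "v \<in> xy_vars m n p"
        have "(\<Sum>e\<in>red_eqs m n p \<iota>. of_real (a e) * dfeq m n A \<iota> e v (?cw w0)) =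
            complex_of_real (\<Sum>e\<in>red_eqs m n p \<iota>. a e * f' e v w0)" by (simp add: f'R)
        then show "(\<Sum>e\<in>red_eqs m n p \<iota>. of_real (a e) * dfeq m n A \<iota> e v (?cw w0)) = 0" using a v by simp
      qed
      then show "a e = 0" by simp
    qed
  qed
  then obtain z where z: "\<And>v. v \<in> xy_vars m n p \<Longrightarrow> b v + (\<Sum>e\<in>red_eqs m n p \<iota>. z e * f' e v w0) = 0" by blast
  \<comment> \<open>The omitted equations receive multiplier 0, which turns a solution for the
    reduced equations into one of the full Lagrange system.\<close>
  define w where "w v = (case v of Z e \<Rightarrow> (if e \<in> red_eqs m n p \<iota> then of_real (z e) else 0) | _ \<Rightarrow> ?cw w0 v)" for v
  have Amat_w: "Amat n A w = Amat n A (?cw w0)" by (simp add: fun_eq_iff Amat_def w_def)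
  have feq_w: "feq m n A \<iota> e w = feq m n A \<iota> e (?cw w0)" for e
    by (cases e) (simp_all add: Amat_w, simp_all add: w_def)
  have dfeq_w: "dfeq m n A \<iota> e v w = dfeq m n A \<iota> e v (?cw w0)" for e v
    by (cases e; cases v) (simp_all add: dfeq_def Amat_w, simp_all add: w_def)
  have "q w = 0" if "q \<in> Lag m n A c p \<iota>" for q
    using that unfolding Lag_def
  proof (elim UnE imageE)
    fix e assume "q = feq m n A \<iota> e" "e \<in> feqs m n p"
    then show ?thesis using zero feq_w by simp
  next
    fix v assume q: "q = (\<lambda>w. (\<Sum>e\<in>feqs m n p. w (Z e) * pdiff (feq m n A \<iota> e) v w) + pdiff (Lc n c) v w)"
      and v: "v \<in> xy_vars m n p"
    have "(\<Sum>e\<in>feqs m n p. w (Z e) * pdiff (feq m n A \<iota> e) v w) = (\<Sum>e\<in>red_eqs m n p \<iota>. of_real (z e) * of_real (f' e v w0))"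
      by (rule sum.mono_neutral_cong_right[OF finite_feqs red_eqs_subset])
        (auto simp: w_def[of "Z _"] pdiff_feq dfeq_w f'R)
    moreover have "pdiff (Lc n c) v w = of_real (b v)"
      using v c rational_entry_real by (auto simp: pdiff_Lc b_def xy_vars_def split: var.splits)
    ultimately have "q w = complex_of_real (b v + (\<Sum>e\<in>red_eqs m n p \<iota>. z e * f' e v w0))"
      unfolding q by simp
    then show ?thesis using z[OF v] by simp
  qed
  moreover have "\<forall>l<n. w (X l) = of_real (x l)" by (simp add: w_def w0_def)
  ultimately show ?thesis using pr \<iota> by blast
qed

subsection \<open>The algorithm\<close>

lemma polyfun_Lag:
  assumes A: "\<forall>k i j. A (k,i,j) \<in> \<rat>" and c: "\<forall>l<n. c l \<in> \<rat>" and \<iota>: "\<iota> \<in> index_sets m p"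
    and q: "q \<in> Lag m n A c p \<iota>"
  shows "polyfun \<rat> (lag_vars m n p) q"
  using q unfolding Lag_def
proof (elim UnE imageE)
  fix e assume "q = feq m n A \<iota> e" "e \<in> feqs m n p"
  then show ?thesis using polyfun_mono[OF polyfun_feq[of \<rat> A \<iota> m p e n]] A \<iota> by (auto simp: lag_vars_def)
next
  fix v assume q: "q = (\<lambda>w. (\<Sum>e\<in>feqs m n p. w (Z e) * pdiff (feq m n A \<iota> e) v w) + pdiff (Lc n c) v w)"
    and v: "v \<in> xy_vars m n p"
  have Aq: "A (k,i,j) \<in> \<rat>" for k i j using A by blast
  have d: "polyfun \<rat> (lag_vars m n p) (\<lambda>w. dfeq m n A \<iota> e v w)" if e: "e \<in> feqs m n p" for e
  proof (cases e)
    case e': (EqAY i j)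
    then have j: "j < m - p" using e by (auto simp: feqs_def)
    show ?thesis
    proof (cases v)
      case (X l)
      have "polyfun \<rat> (lag_vars m n p) (\<lambda>w. if l < n then \<Sum>k<m. A (Suc l,i,k) * w (Y k j) else 0)"
        by (intro polyfun_if polyfun_sum pf_mult pf_const pf_var Aq) (use j in \<open>auto simp: lag_vars_def xy_vars_def\<close>)
      then show ?thesis by (simp add: dfeq_def e' X)
    next
      case (Y k j')
      have "polyfun \<rat> (lag_vars m n p) (\<lambda>w. if j = j' \<and> k < m then Amat n A w i k else 0)"
        unfolding Amat_def
        by (intro polyfun_if polyfun_sum pf_add pf_mult pf_const pf_var Aq) (auto simp: lag_vars_def xy_vars_def)
      then show ?thesis by (simp add: dfeq_def e' Y)
    next
      case (Z e')
      then show ?thesis using v by (auto simp: xy_vars_def)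
    qed
  next
    case (EqId a j)
    then show ?thesis by (cases v) (auto simp: dfeq_def intro!: pf_const)
  qed
  have "polyfun \<rat> (lag_vars m n p) (\<lambda>w. (\<Sum>e\<in>feqs m n p. w (Z e) * dfeq m n A \<iota> e v w) +
      (case v of X l \<Rightarrow> (if l < n then c l else 0) | _ \<Rightarrow> 0))"
    by (intro pf_add polyfun_sum pf_mult d pf_var pf_const) (use c in \<open>auto simp: lag_vars_def split: var.split\<close>)
  then show ?thesis unfolding q pdiff_feq pdiff_Lc .
qed

lemma finite_Lag: "finite (Lag m n A c p \<iota>)"
  unfolding Lag_def using finite_feqs finite_xy_vars by blast

lemma finite_lag_vars: "finite (lag_vars m n p)"
  unfolding lag_vars_def using finite_feqs finite_xy_vars by blast

text \<open>Finiteness of a coordinate on the Lagrange zeros puts a rational polynomial in that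
  coordinate alone into the elimination ideal. A zero of the ideal need not lift to a Lagrange zero,
  so it is this polynomial that confines it.\<close>

lemma elim_zeros_algebraic:
  assumes A: "symmetric_pencil A" "\<forall>k i j. A (k,i,j) \<in> \<rat>" and c: "\<forall>l<n. c l \<in> \<rat>"
    and fin: "\<forall>l<n. finite {x l | x. kkt m n A x c}" and \<iota>: "\<iota> \<in> index_sets m p"
  shows "finite (elim_zeros m n A c p \<iota>)" "x \<in> elim_zeros m n A c p \<iota> \<Longrightarrow> l < n \<Longrightarrow> algebraic_Q (x l)"
proof -
  have "\<exists>r. r \<noteq> 0 \<and> (\<forall>x\<in>elim_zeros m n A c p \<iota>. cpoly r (x l) = 0)" if l: "l < n" for l
  proof -
    have Xl: "X l \<in> lag_vars m n p" using l by (auto simp: lag_vars_def xy_vars_def)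
    have proj: "w (X l) \<in> {x l | x. kkt m n A x c}" if "\<forall>q\<in>Lag m n A c p \<iota>. q w = 0" for w
      using Lag_zero_kkt[OF A(1) \<iota>, of n c w] that by fastforce
    have "finite {x l | x. kkt m n A x c}" using fin l by blast
    then have "\<exists>r. r \<noteq> 0 \<and> (\<lambda>w. cpoly r (w (X l))) \<in> ideal_gen (lag_vars m n p) (Lag m n A c p \<iota>)"
    proof (rule elimination_finite_projection[OF finite_lag_vars Xl finite_Lag polyfun_Lag[OF A(2) c \<iota>], rotated])
      show "w (X l) \<in> {x l | x. kkt m n A x c}" if "\<forall>q\<in>Lag m n A c p \<iota>. q w = 0" for w
        by (rule proj[OF that])
    qed
    then obtain r where r: "r \<noteq> 0" "(\<lambda>w. cpoly r (w (X l))) \<in> ideal_gen (lag_vars m n p) (Lag m n A c p \<iota>)" by blast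
    have "polyfun \<rat> {X l | l. l < n} (\<lambda>w. cpoly r (w (X l)))"
      using l by (induction r) (auto simp: cpoly_simps cpoly_pCons intro!: polyfun.intros)
    then have mem: "(\<lambda>w. cpoly r (w (X l))) \<in> elim_ideal m n A c p \<iota>" using r(2) by (simp add: elim_ideal_def)
    have "cpoly r (x l) = 0" if "x \<in> elim_zeros m n A c p \<iota>" for x
      using that mem unfolding elim_zeros_def by (auto simp: embX_def)
    then show ?thesis using r(1) by blast
  qed
  then obtain r where r: "\<And>l. l < n \<Longrightarrow> r l \<noteq> 0"
    "\<And>l x. l < n \<Longrightarrow> x \<in> elim_zeros m n A c p \<iota> \<Longrightarrow> cpoly (r l) (x l) = 0" by metis
  show "x \<in> elim_zeros m n A c p \<iota> \<Longrightarrow> l < n \<Longrightarrow> algebraic_Q (x l)"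
    using r by (auto simp: algebraic_Q_def)
  define R where "R = (\<Union>l<n. {t. cpoly (r l) t = 0})"
  have "finite R" unfolding R_def using finite_cpoly_roots r(1) by auto
  then have "finite {x. \<forall>l. (l \<in> {..<n} \<longrightarrow> x l \<in> R) \<and> (l \<notin> {..<n} \<longrightarrow> x l = 0)}"
    by (intro finite_set_of_finite_funs) auto
  moreover have "elim_zeros m n A c p \<iota> \<subseteq> {x. \<forall>l. (l \<in> {..<n} \<longrightarrow> x l \<in> R) \<and> (l \<notin> {..<n} \<longrightarrow> x l = 0)}"
  proof
    fix x assume x: "x \<in> elim_zeros m n A c p \<iota>"
    then have "x \<in> cvecs n" by (simp add: elim_zeros_def)
    then show "x \<in> {x. \<forall>l. (l \<in> {..<n} \<longrightarrow> x l \<in> R) \<and> (l \<notin> {..<n} \<longrightarrow> x l = 0)}"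
      using r(2)[OF _ x] by (auto simp: R_def cvecs_def aff_def)
  qed
  ultimately show "finite (elim_zeros m n A c p \<iota>)" by (rule finite_subset[rotated])
qed

text \<open>The ideal consists of polynomials in x with rational coefficients, so membership of a
  point depends only on the rational equations that hold there.\<close>

lemma elim_zeros_Q_closed:
  assumes s: "s \<in> elim_zeros m n A c p \<iota>" and y: "\<And>i. i \<ge> n \<Longrightarrow> y i = 0"
    and closed: "\<And>f. polyfun \<rat> {..<n} f \<Longrightarrow> f s = 0 \<Longrightarrow> f y = 0"
  shows "y \<in> elim_zeros m n A c p \<iota>"
proof -
  have "g (embX y) = 0" if g: "g \<in> elim_ideal m n A c p \<iota>" for g
  proof (rule closed[where f = "\<lambda>x. g (embX x)"])
    have "polyfun \<rat> {X l | l. l < n} g" using g by (simp add: elim_ideal_def)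
    then show "polyfun \<rat> {..<n} (\<lambda>x. g (embX x))"
      by (rule polyfun_compose[where g = "\<lambda>v x. embX x v", simplified]) (auto simp: embX_def intro!: pf_var)
    show "g (embX s) = 0" using s g by (simp add: elim_zeros_def)
  qed
  then show ?thesis using y by (simp add: elim_zeros_def cvecs_def aff_def)
qed

lemma Lag_zero_elim_zeros:
  assumes w: "\<forall>q\<in>Lag m n A c p \<iota>. q w = 0" "\<forall>l<n. w (X l) = x l" and x: "\<And>i. i \<ge> n \<Longrightarrow> x i = 0"
  shows "x \<in> elim_zeros m n A c p \<iota>"
proof -
  have "g (embX x) = 0" if g: "g \<in> elim_ideal m n A c p \<iota>" for g
  proof -
    have "g (embX x) = g w"
      by (rule polyfun_cong_vars[of \<rat> "{X l | l. l < n}"]) (use g w(2) in \<open>auto simp: elim_ideal_def embX_def\<close>)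
    also have "\<dots> = 0"
    proof -
      obtain h where "\<And>w. g w = (\<Sum>q\<in>Lag m n A c p \<iota>. h q w * q w)"
        using g unfolding elim_ideal_def ideal_gen_def by blast
      then show ?thesis using w(1) by simp
    qed
    finally show ?thesis .
  qed
  then show ?thesis using x by (simp add: elim_zeros_def cvecs_def aff_def)
qed

theorem theorem2:
  fixes m n r :: nat
  assumes "m \<ge> 1" and "n \<ge> 1" and "r \<le> m"
  shows "\<exists>\<A>. zariski_open_in (sym_vars m n) (sym_space m n) \<A> \<and> \<A> \<noteq> {} \<and>
    (\<forall>A\<in>\<A>. (\<forall>k i j. A (k,i,j) \<in> \<rat>) \<longrightarrow>
      (\<exists>\<C>. zariski_open_in {..<n} (cvecs n) \<C> \<and> \<C> \<noteq> {} \<and>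
        (\<forall>c\<in>\<C>. (\<forall>i<n. c i \<in> \<rat>) \<longrightarrow>
          SolveSDP m n A c r \<noteq> {} \<and>
          (\<forall>out\<in>SolveSDP m n A c r. \<exists>Q S. out = Some Q \<and> is_rat_param n Q S \<and> finite S \<and>
              (\<forall>x\<in>minimizers m n A c r. (\<lambda>i. complex_of_real (x i)) \<in> S)))))"
proof -
  obtain \<A> where \<A>: "zariski_open_in (sym_vars m n) (sym_space m n) \<A>" "\<A> \<noteq> {}"
    and gen: "\<And>A. A \<in> \<A> \<Longrightarrow> \<not> degenerate m n A \<and> (\<exists>\<C>. zariski_open_in {..<n} (cvecs n) \<C> \<and> \<C> \<noteq> {} \<and>
        (\<forall>c\<in>\<C>. \<forall>l<n. finite {x l | x. kkt m n A x c}))"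
    using generic_pencil[of m n] by blast
  have main: "SolveSDP m n A c r \<noteq> {} \<and>
      (\<forall>out\<in>SolveSDP m n A c r. \<exists>Q S. out = Some Q \<and> is_rat_param n Q S \<and> finite S \<and>
          (\<forall>x\<in>minimizers m n A c r. (\<lambda>i. complex_of_real (x i)) \<in> S))"
    if A: "A \<in> \<A>" "\<forall>k i j. A (k,i,j) \<in> \<rat>" and c: "\<forall>l<n. c l \<in> \<rat>"
      and fin: "\<forall>l<n. finite {x l | x. kkt m n A x c}" for A c
  proof -
    have symA: "symmetric_pencil A"
      using A(1) \<A>(1) by (auto simp: zariski_open_in_def sym_space_def symmetric_pencil_def)
    have ndeg: "\<not> degenerate m n A" using gen[OF A(1)] by blast
    define S where "S = (\<Union>p\<in>{..r}. \<Union>\<iota>\<in>index_sets m p. elim_zeros m n A c p \<iota>)"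
    have fin_idx: "finite (index_sets m p)" for p
      by (rule finite_subset[of _ "Pow {..<m}"]) (auto simp: index_sets_def)
    have fin_el: "finite (elim_zeros m n A c p \<iota>)" if "\<iota> \<in> index_sets m p" for p \<iota>
      by (rule elim_zeros_algebraic(1)[OF symA A(2) c fin that])
    have finS: "finite S" unfolding S_def using fin_idx fin_el by blast
    \<comment> \<open>Both error branches are excluded by genericity, so the outputs are exactly the
      parametrizations of \<open>S\<close>.\<close>
    have Solve: "SolveSDP m n A c r = Some ` {Q. is_rat_param n Q S}"
      unfolding SolveSDP_def S_def using smooth_equidim_Vset[OF symA ndeg] fin_el by simp
    \<comment> \<open>Guarantees that an output exists, so that the claim about all outputs is not
      vacuous.\<close>
    have "\<exists>Q. is_rat_param n Q S"
    proof (rule ex_rat_param[OF finS])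
      show "algebraic_Q (s i)" if "s \<in> S" "i < n" for s i
        using that elim_zeros_algebraic(2)[OF symA A(2) c fin] unfolding S_def by blast
      show "s i = 0" if "s \<in> S" "i \<ge> n" for s i
        using that by (auto simp: S_def elim_zeros_def cvecs_def aff_def)
      show "y \<in> S" if s: "s \<in> S" and y: "\<And>i. i \<ge> n \<Longrightarrow> y i = 0"
        "\<And>f. polyfun \<rat> {..<n} f \<Longrightarrow> f s = 0 \<Longrightarrow> f y = 0" for s y
      proof -
        obtain p \<iota> where p: "p \<in> {..r}" "\<iota> \<in> index_sets m p" "s \<in> elim_zeros m n A c p \<iota>"
          using s unfolding S_def by blast
        have "y \<in> elim_zeros m n A c p \<iota>"
        proof (rule elim_zeros_Q_closed[OF p(3) y(1)])
          show "f y = 0" if "polyfun \<rat> {..<n} f" "f s = 0" for f by (rule y(2)[OF that])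
        qed
        then show ?thesis using p unfolding S_def by blast
      qed
    qed
    moreover have "(\<lambda>i. complex_of_real (x i)) \<in> S" if x: "x \<in> minimizers m n A c r" for x
    proof -
      obtain p \<iota> w where p: "p \<le> r" "\<iota> \<in> index_sets m p" "\<forall>l<n. w (X l) = of_real (x l)"
        "\<forall>q\<in>Lag m n A c p \<iota>. q w = 0"
        using minimizer_Lag_zero[OF symA A(2) ndeg c x] by blast
      have "x i = 0" if "i \<ge> n" for i using x that by (auto simp: minimizers_def feasible_def)
      then have "(\<lambda>i. complex_of_real (x i)) \<in> elim_zeros m n A c p \<iota>"
        by (intro Lag_zero_elim_zeros[OF p(4,3)]) simp
      then show ?thesis using p(1,2) unfolding S_def by blast
    qed
    ultimately show ?thesis unfolding Solve using finS by blast
  qed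
  show ?thesis
  proof (intro exI[of _ \<A>] conjI ballI impI \<A>)
    fix A assume A: "A \<in> \<A>" "\<forall>k i j. A (k,i,j) \<in> \<rat>"
    obtain \<C> where \<C>: "zariski_open_in {..<n} (cvecs n) \<C>" "\<C> \<noteq> {}"
      and fin: "\<forall>c\<in>\<C>. \<forall>l<n. finite {x l | x. kkt m n A x c}"
      using gen[OF A(1)] by blast
    show "\<exists>\<C>. zariski_open_in {..<n} (cvecs n) \<C> \<and> \<C> \<noteq> {} \<and>
        (\<forall>c\<in>\<C>. (\<forall>i<n. c i \<in> \<rat>) \<longrightarrow>
          SolveSDP m n A c r \<noteq> {} \<and>
          (\<forall>out\<in>SolveSDP m n A c r. \<exists>Q S. out = Some Q \<and> is_rat_param n Q S \<and> finite S \<and>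
              (\<forall>x\<in>minimizers m n A c r. (\<lambda>i. complex_of_real (x i)) \<in> S)))"
    proof (intro exI[of _ \<C>] conjI[OF \<C>(1)] conjI[OF \<C>(2)] ballI impI)
      fix c assume "c \<in> \<C>" "\<forall>i<n. c i \<in> \<rat>"
      then show "SolveSDP m n A c r \<noteq> {} \<and>
          (\<forall>out\<in>SolveSDP m n A c r. \<exists>Q S. out = Some Q \<and> is_rat_param n Q S \<and> finite S \<and>
              (\<forall>x\<in>minimizers m n A c r. (\<lambda>i. complex_of_real (x i)) \<in> S))"
        using main[OF A] fin by blast
    qed
  qed
qed

end
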